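(* Let $\mathscr{T}$ be an idempotent-complete triangulated category and $\mathscr{C},\mathscr{D}\subseteq\mathscr{T}$ thick subcategories. Then $(\mathscr{C},\mathscr{D})$ is a WT pair in $\mathscr{T}$ if and only if there is a finite silting collection $\mathcal{P}$ in $\mathscr{T}$, with associated silting t-structure $t_{\mathcal{P}}$, such that (i) $\mathrm{Hom}_{\mathscr{T}}(P,X)$ is finite-dimensional for all $X\in\mathscr{T}$ and $P\in\mathcal{P}$, (ii) $\mathrm{thick}_{\mathscr{T}}(\mathcal{P})=\mathscr{C}$, (iii) $\mathscr{T}=\bigcup_{n\in\mathbb{Z}}\mathscr{T}^{t_{\mathcal{P}}\le n}$ and $\mathscr{D}=\bigcup_{n\in\mathbb{Z}}\mathscr{T}^{t_{\mathcal{P}}\ge n}$.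
   Context: All categories are linear over a fixed field. t-structures $t=(\mathscr{T}^{t\le0},\mathscr{T}^{t\ge0})$ use the cohomological convention ($\mathscr{T}^{t\le0}[1]\subseteq\mathscr{T}^{t\le0}$); $\mathscr{T}^{t\le n}=\mathscr{T}^{t\le0}[-n]$, $\mathscr{T}^{t\ge n}=\mathscr{T}^{t\ge0}[-n]$; heart $\heartsuit_t=\mathscr{T}^{t\le0}\cap\mathscr{T}^{t\ge0}$. It is non-degenerate if $\bigcap_n\mathscr{T}^{t\le n}=0=\bigcap_n\mathscr{T}^{t\ge n}$, bounded above if $\mathscr{T}=\bigcup_n\mathscr{T}^{t\le n}$. An abelian category is finite-length if all objects have finite length. A weight structure on $\mathscr{T}$ is a pair $w=(\mathscr{T}_{w\le0},\mathscr{T}_{w\ge0})$ of Karoubi-closed full subcategories with $\mathscr{T}_{w\le0}[1]\subseteq\mathscr{T}_{w\le0}$, $\mathscr{T}_{w\ge0}[-1]\subseteq\mathscr{T}_{w\ge0}$, $\mathrm{Hom}(\mathscr{T}_{w\ge0}[-1],\mathscr{T}_{w\le0})=0$, and every $X$ sits in a triangle $w_{>0}X\to X\to w_{\le0}X\to w_{>0}X[1]$ with $w_{>0}X\in\mathscr{T}_{w\ge0}[-1]$, $w_{\le0}X\in\mathscr{T}_{w\le0}$. It is bounded above if $\mathscr{T}=\bigcup_n\mathscr{T}_{w\le0}[-n]$. Its coheart is $\mathscr{T}_{w\le0}\cap\mathscr{T}_{w\ge0}$. $w$ is left adjacent to $t$ if $\mathrm{Hom}(\mathscr{T}_{w\ge0},\mathscr{T}^{t\le-1})=0=\mathrm{Hom}(\mathscr{T}_{w\le0},\mathscr{T}^{t\ge1})$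 (equivalently $\mathscr{T}_{w\le0}=\mathscr{T}^{t\le0}$). $(\mathscr{C},\mathscr{D})$ is a WT pair in $\mathscr{T}$ if there is a weight structure $w$ and a non-degenerate t-structure $t$ on $\mathscr{T}$ such that (1) $w$ is left adjacent to $t$; (2) $w$ and $t$ are bounded above; (3) $\mathscr{C}$ is the thick subcategory of $\mathscr{T}$ generated by the coheart of $w$, and $\mathscr{D}$ is the triangulated subcategory of $\mathscr{T}$ generated by $\heartsuit_t$; (4) the coheart of $w$ is Krull--Schmidt with finitely many indecomposables (up to isomorphism), and $\heartsuit_t$ is Hom-finite, finite-length, with finitely many simples. A silting collection in $\mathscr{T}$ is a set $\mathcal{P}$ of indecomposable pairwise non-isomorphic objects such that the full subcategory of direct summands of finite coproducts of objects of $\mathcal{P}$ is Krull--Schmidt and $t_{\mathcal{P}}=(\mathcal{P}^{\perp_{>0}},\mathcal{P}^{\perp_{<0}})$ is a t-structure on $\mathscr{T}$ (the associated silting t-structure), where $\mathcal{P}^{\perp_{>0}}=\{Y\mid\mathrm{Hom}(P,Y[m])=0\ \forall m>0,P\in\mathcal{P}\}$ and $\mathcal{P}^{\perp_{<0}}$ is analogous. $\mathrm{thick}_{\mathscr{T}}(\mathcal{P})$ is the thick subcategory generated by $\mathcal{P}$. *)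

theory Defs
  imports "Jordan_Normal_Form.Missing_VectorSpace" "HOL.Hull"
begin

section \<open>Linear categories\<close>

text \<open>
  Hom-spaces are \<open>HOL-Algebra\<close> modules; the ring-multiplication fields that the record type
  inherits are never used. Composition is a single function on morphisms and hom-spaces of
  different pairs of objects need not be disjoint: a morphism is always considered together with
  its source and target, and every axiom is stated for such typed morphisms.
\<close>

record ('o, 'm, 'k) lin_cat =
  obj :: "'o set"
  Hom :: "'o \<Rightarrow> 'o \<Rightarrow> ('k, 'm) module"
  idm :: "'o \<Rightarrow> 'm"
  cmp :: "'m \<Rightarrow> 'm \<Rightarrow> 'm" (infixl \<open>\<cdot>\<index>\<close> 70)

abbreviation mor :: "('o, 'm, 'k, 'z) lin_cat_scheme \<Rightarrow> 'o \<Rightarrow> 'o \<Rightarrow> 'm set"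
  where "mor C X Y \<equiv> carrier (Hom C X Y)"

abbreviation zmor :: "('o, 'm, 'k, 'z) lin_cat_scheme \<Rightarrow> 'o \<Rightarrow> 'o \<Rightarrow> 'm"
  where "zmor C X Y \<equiv> \<zero>\<^bsub>Hom C X Y\<^esub>"

text \<open>In \<open>g \<cdot> f\<close> the morphism \<open>f\<close> is applied first.\<close>

locale linear_category =
  fixes K :: "('k, 'r) ring_scheme" and C :: "('o, 'm, 'k, 'z) lin_cat_scheme" (structure)
  assumes field_K: "field K"
    and Hom_vectorspace: "\<lbrakk>X \<in> obj C; Y \<in> obj C\<rbrakk> \<Longrightarrow> vectorspace K (Hom C X Y)"
    and idm_closed: "X \<in> obj C \<Longrightarrow> idm C X \<in> mor C X X"
    and cmp_linear_right:
      "\<lbrakk>X \<in> obj C; Y \<in> obj C; Z \<in> obj C; g \<in> mor C Y Z\<rbrakk>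
        \<Longrightarrow> linear_map K (Hom C X Y) (Hom C X Z) (\<lambda>f. g \<cdot> f)"
    and cmp_linear_left:
      "\<lbrakk>X \<in> obj C; Y \<in> obj C; Z \<in> obj C; f \<in> mor C X Y\<rbrakk>
        \<Longrightarrow> linear_map K (Hom C Y Z) (Hom C X Z) (\<lambda>g. g \<cdot> f)"
    and cmp_assoc:
      "\<lbrakk>W \<in> obj C; X \<in> obj C; Y \<in> obj C; Z \<in> obj C;
        f \<in> mor C W X; g \<in> mor C X Y; h \<in> mor C Y Z\<rbrakk> \<Longrightarrow> h \<cdot> (g \<cdot> f) = (h \<cdot> g) \<cdot> f"
    and idm_left: "\<lbrakk>X \<in> obj C; Y \<in> obj C; f \<in> mor C X Y\<rbrakk> \<Longrightarrow> idm C Y \<cdot> f = f"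
    and idm_right: "\<lbrakk>X \<in> obj C; Y \<in> obj C; f \<in> mor C X Y\<rbrakk> \<Longrightarrow> f \<cdot> idm C X = f"

text \<open>
  Full subcategories are given by their sets of objects; \<open>full C S\<close> is such a subcategory
  regarded as a category, so that notions like monomorphism or simple object can be formed
  inside it.
\<close>

definition full :: "('o, 'm, 'k, 'z) lin_cat_scheme \<Rightarrow> 'o set \<Rightarrow> ('o, 'm, 'k, 'z) lin_cat_scheme"
  where "full C S = C\<lparr>obj := S\<rparr>"

definition is_isomorphism :: "('o, 'm, 'k, 'z) lin_cat_scheme \<Rightarrow> 'o \<Rightarrow> 'o \<Rightarrow> 'm \<Rightarrow> bool"
  where "is_isomorphism C X Y f \<longleftrightarrow> X \<in> obj C \<and> Y \<in> obj C \<and> f \<in> mor C X Y \<and>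
    (\<exists>g\<in>mor C Y X. g \<cdot>\<^bsub>C\<^esub> f = idm C X \<and> f \<cdot>\<^bsub>C\<^esub> g = idm C Y)"

definition isomorphic :: "('o, 'm, 'k, 'z) lin_cat_scheme \<Rightarrow> 'o \<Rightarrow> 'o \<Rightarrow> bool"
  where "isomorphic C X Y \<longleftrightarrow> (\<exists>f. is_isomorphism C X Y f)"

definition iso_closed :: "('o, 'm, 'k, 'z) lin_cat_scheme \<Rightarrow> 'o set \<Rightarrow> bool"
  where "iso_closed C S \<longleftrightarrow> (\<forall>X\<in>S. \<forall>Y. isomorphic C X Y \<longrightarrow> Y \<in> S)"

definition finite_up_to_iso :: "('o, 'm, 'k, 'z) lin_cat_scheme \<Rightarrow> 'o set \<Rightarrow> bool"
  where "finite_up_to_iso C S \<longleftrightarrow>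
    (\<exists>F. finite F \<and> F \<subseteq> S \<and> (\<forall>X\<in>S. \<exists>Y\<in>F. isomorphic C X Y))"

definition hom_zero :: "('o, 'm, 'k, 'z) lin_cat_scheme \<Rightarrow> 'o set \<Rightarrow> 'o set \<Rightarrow> bool"
  where "hom_zero C S S' \<longleftrightarrow> (\<forall>X\<in>S. \<forall>Y\<in>S'. mor C X Y = {zmor C X Y})"

definition zero_object :: "('o, 'm, 'k, 'z) lin_cat_scheme \<Rightarrow> 'o \<Rightarrow> bool"
  where "zero_object C X \<longleftrightarrow> X \<in> obj C \<and> hom_zero C {X} (obj C) \<and> hom_zero C (obj C) {X}"

text \<open>Finite coproducts in a linear category are the same as biproducts.\<close>

definition is_biproduct :: "('o, 'm, 'k, 'z) lin_cat_scheme \<Rightarrow> 'o list \<Rightarrow> 'o \<Rightarrow> bool"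
  where "is_biproduct C Xs X \<longleftrightarrow> X \<in> obj C \<and> set Xs \<subseteq> obj C \<and>
    (\<exists>inj proj.
      (\<forall>i<length Xs. inj i \<in> mor C (Xs ! i) X \<and> proj i \<in> mor C X (Xs ! i)) \<and>
      (\<forall>i<length Xs. \<forall>j<length Xs.
        proj i \<cdot>\<^bsub>C\<^esub> inj j = (if i = j then idm C (Xs ! i) else zmor C (Xs ! j) (Xs ! i))) \<and>
      (\<Oplus>\<^bsub>Hom C X X\<^esub>i\<in>{..<length Xs}. inj i \<cdot>\<^bsub>C\<^esub> proj i) = idm C X)"

text \<open>The empty list yields a zero object.\<close>

definition additive_category :: "('o, 'm, 'k, 'z) lin_cat_scheme \<Rightarrow> bool"
  where "additive_category C \<longleftrightarrow> (\<forall>Xs. set Xs \<subseteq> obj C \<longrightarrow> (\<exists>X. is_biproduct C Xs X))"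

definition direct_summand :: "('o, 'm, 'k, 'z) lin_cat_scheme \<Rightarrow> 'o \<Rightarrow> 'o \<Rightarrow> bool"
  where "direct_summand C X Y \<longleftrightarrow> (\<exists>Z. is_biproduct C [X, Z] Y)"

definition retract :: "('o, 'm, 'k, 'z) lin_cat_scheme \<Rightarrow> 'o \<Rightarrow> 'o \<Rightarrow> bool"
  where "retract C X Y \<longleftrightarrow> X \<in> obj C \<and> Y \<in> obj C \<and>
    (\<exists>s\<in>mor C X Y. \<exists>r\<in>mor C Y X. r \<cdot>\<^bsub>C\<^esub> s = idm C X)"

definition Karoubi_closed :: "('o, 'm, 'k, 'z) lin_cat_scheme \<Rightarrow> 'o set \<Rightarrow> bool"
  where "Karoubi_closed C S \<longleftrightarrow> (\<forall>Y\<in>S. \<forall>X. retract C X Y \<longrightarrow> X \<in> S)"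

definition idempotent_complete :: "('o, 'm, 'k, 'z) lin_cat_scheme \<Rightarrow> bool"
  where "idempotent_complete C \<longleftrightarrow> (\<forall>X\<in>obj C. \<forall>e\<in>mor C X X. e \<cdot>\<^bsub>C\<^esub> e = e \<longrightarrow>
    (\<exists>Y\<in>obj C. \<exists>r\<in>mor C X Y. \<exists>s\<in>mor C Y X. r \<cdot>\<^bsub>C\<^esub> s = idm C Y \<and> s \<cdot>\<^bsub>C\<^esub> r = e))"

definition indecomposable :: "('o, 'm, 'k, 'z) lin_cat_scheme \<Rightarrow> 'o \<Rightarrow> bool"
  where "indecomposable C X \<longleftrightarrow> X \<in> obj C \<and> \<not> zero_object C X \<and>
    (\<forall>Y Z. is_biproduct C [Y, Z] X \<longrightarrow> zero_object C Y \<or> zero_object C Z)"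

definition local_ring :: "('a, 'b) ring_scheme \<Rightarrow> bool"
  where "local_ring R \<longleftrightarrow> ring R \<and> \<one>\<^bsub>R\<^esub> \<noteq> \<zero>\<^bsub>R\<^esub> \<and>
    (\<forall>a\<in>carrier R - Units R. \<forall>b\<in>carrier R - Units R. a \<oplus>\<^bsub>R\<^esub> b \<notin> Units R)"

definition End_ring :: "('o, 'm, 'k, 'z) lin_cat_scheme \<Rightarrow> 'o \<Rightarrow> ('k, 'm) module"
  where "End_ring C X = (Hom C X X)\<lparr>mult := cmp C, one := idm C X\<rparr>"

definition Krull_Schmidt :: "('o, 'm, 'k, 'z) lin_cat_scheme \<Rightarrow> bool"
  where "Krull_Schmidt C \<longleftrightarrow> additive_category C \<and>
    (\<forall>X\<in>obj C. \<exists>Xs. is_biproduct C Xs X \<and> (\<forall>Y\<in>set Xs. local_ring (End_ring C Y)))"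

definition Hom_finite :: "('k, 'r) ring_scheme \<Rightarrow> ('o, 'm, 'k, 'z) lin_cat_scheme \<Rightarrow> bool"
  where "Hom_finite K C \<longleftrightarrow> (\<forall>X\<in>obj C. \<forall>Y\<in>obj C. vectorspace.fin_dim K (Hom C X Y))"


section \<open>Simple objects and finite length\<close>

definition is_mono :: "('o, 'm, 'k, 'z) lin_cat_scheme \<Rightarrow> 'o \<Rightarrow> 'o \<Rightarrow> 'm \<Rightarrow> bool"
  where "is_mono C X Y f \<longleftrightarrow> X \<in> obj C \<and> Y \<in> obj C \<and> f \<in> mor C X Y \<and>
    (\<forall>W\<in>obj C. \<forall>u\<in>mor C W X. \<forall>v\<in>mor C W X. f \<cdot>\<^bsub>C\<^esub> u = f \<cdot>\<^bsub>C\<^esub> v \<longrightarrow> u = v)"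

definition is_cokernel :: "('o, 'm, 'k, 'z) lin_cat_scheme \<Rightarrow> 'o \<Rightarrow> 'o \<Rightarrow> 'o \<Rightarrow> 'm \<Rightarrow> 'm \<Rightarrow> bool"
  where "is_cokernel C X Y Z f g \<longleftrightarrow> X \<in> obj C \<and> Y \<in> obj C \<and> Z \<in> obj C \<and>
    f \<in> mor C X Y \<and> g \<in> mor C Y Z \<and> g \<cdot>\<^bsub>C\<^esub> f = zmor C X Z \<and>
    (\<forall>W\<in>obj C. \<forall>h\<in>mor C Y W. h \<cdot>\<^bsub>C\<^esub> f = zmor C X W \<longrightarrow>
      (\<exists>!u. u \<in> mor C Z W \<and> u \<cdot>\<^bsub>C\<^esub> g = h))"

definition simple_object :: "('o, 'm, 'k, 'z) lin_cat_scheme \<Rightarrow> 'o \<Rightarrow> bool"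
  where "simple_object C X \<longleftrightarrow> X \<in> obj C \<and> \<not> zero_object C X \<and>
    (\<forall>Y f. is_mono C Y X f \<longrightarrow> zero_object C Y \<or> is_isomorphism C Y X f)"

text \<open>
  Existence of a composition series. This is applied only to hearts of t-structures, which are
  abelian categories.
\<close>

inductive has_finite_length :: "('o, 'm, 'k, 'z) lin_cat_scheme \<Rightarrow> 'o \<Rightarrow> bool"
  for C :: "('o, 'm, 'k, 'z) lin_cat_scheme"
  where
    zero: "zero_object C X \<Longrightarrow> has_finite_length C X"
  | step: "\<lbrakk>has_finite_length C X; is_mono C X Y f; is_cokernel C X Y S f g; simple_object C S\<rbrakk>
      \<Longrightarrow> has_finite_length C Y"

definition finite_length :: "('o, 'm, 'k, 'z) lin_cat_scheme \<Rightarrow> bool"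
  where "finite_length C \<longleftrightarrow> (\<forall>X\<in>obj C. has_finite_length C X)"


section \<open>Triangulated categories\<close>

text \<open>\<open>(X, Y, Z, f, g, h) \<in> tri T\<close> is the distinguished triangle \<open>X -f\<rightarrow> Y -g\<rightarrow> Z -h\<rightarrow> X[1]\<close>.\<close>

record ('o, 'm, 'k) tri_cat = "('o, 'm, 'k) lin_cat" +
  sh :: "'o \<Rightarrow> 'o"
  shm :: "'m \<Rightarrow> 'm"
  tri :: "('o \<times> 'o \<times> 'o \<times> 'm \<times> 'm \<times> 'm) set"

text \<open>
  The shift is a strict automorphism of the linear category, so that \<open>X[n]\<close> is defined for all
  integers \<open>n\<close> and satisfies \<open>X[m][n] = X[m + n]\<close>; the octahedral axiom is included.
\<close>

locale triangulated_category = linear_category K T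
  for K :: "('k, 'r) ring_scheme" and T :: "('o, 'm, 'k, 'z) tri_cat_scheme" (structure) +
  assumes additive: "additive_category T"
    and sh_bij: "bij_betw (sh T) (obj T) (obj T)"
    and shm_linear: "\<lbrakk>X \<in> obj T; Y \<in> obj T\<rbrakk>
      \<Longrightarrow> linear_map K (Hom T X Y) (Hom T (sh T X) (sh T Y)) (shm T)"
    and shm_bij: "\<lbrakk>X \<in> obj T; Y \<in> obj T\<rbrakk>
      \<Longrightarrow> bij_betw (shm T) (mor T X Y) (mor T (sh T X) (sh T Y))"
    and shm_idm: "X \<in> obj T \<Longrightarrow> shm T (idm T X) = idm T (sh T X)"
    and shm_cmp: "\<lbrakk>X \<in> obj T; Y \<in> obj T; Z \<in> obj T; f \<in> mor T X Y; g \<in> mor T Y Z\<rbrakk>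
      \<Longrightarrow> shm T (g \<cdot> f) = shm T g \<cdot> shm T f"
    and tri_typed: "(X, Y, Z, f, g, h) \<in> tri T \<Longrightarrow>
      X \<in> obj T \<and> Y \<in> obj T \<and> Z \<in> obj T \<and>
      f \<in> mor T X Y \<and> g \<in> mor T Y Z \<and> h \<in> mor T Z (sh T X)"
    and tri_iso: "\<lbrakk>(X, Y, Z, f, g, h) \<in> tri T;
      f' \<in> mor T X' Y'; g' \<in> mor T Y' Z'; h' \<in> mor T Z' (sh T X');
      is_isomorphism T X X' a; is_isomorphism T Y Y' b; is_isomorphism T Z Z' c;
      b \<cdot> f = f' \<cdot> a; c \<cdot> g = g' \<cdot> b; shm T a \<cdot> h = h' \<cdot> c\<rbrakk>
      \<Longrightarrow> (X', Y', Z', f', g', h') \<in> tri T"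
    and tri_idm: "\<lbrakk>X \<in> obj T; zero_object T Z\<rbrakk>
      \<Longrightarrow> (X, X, Z, idm T X, zmor T X Z, zmor T Z (sh T X)) \<in> tri T"
    and tri_cone: "\<lbrakk>X \<in> obj T; Y \<in> obj T; f \<in> mor T X Y\<rbrakk>
      \<Longrightarrow> \<exists>Z g h. (X, Y, Z, f, g, h) \<in> tri T"
    and tri_rotate: "\<lbrakk>X \<in> obj T; Y \<in> obj T; Z \<in> obj T;
      f \<in> mor T X Y; g \<in> mor T Y Z; h \<in> mor T Z (sh T X)\<rbrakk>
      \<Longrightarrow> (X, Y, Z, f, g, h) \<in> tri T \<longleftrightarrow>
        (Y, Z, sh T X, g, h, \<ominus>\<^bsub>Hom T (sh T X) (sh T Y)\<^esub> shm T f) \<in> tri T"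
    and tri_morphism: "\<lbrakk>(X, Y, Z, f, g, h) \<in> tri T; (X', Y', Z', f', g', h') \<in> tri T;
      a \<in> mor T X X'; b \<in> mor T Y Y'; b \<cdot> f = f' \<cdot> a\<rbrakk>
      \<Longrightarrow> \<exists>c\<in>mor T Z Z'. c \<cdot> g = g' \<cdot> b \<and> shm T a \<cdot> h = h' \<cdot> c"
    and tri_octahedron: "\<lbrakk>(X, Y, U, f, i, i') \<in> tri T; (Y, Z, V, g, j, j') \<in> tri T;
      (X, Z, W, g \<cdot> f, k, k') \<in> tri T\<rbrakk>
      \<Longrightarrow> \<exists>u\<in>mor T U W. \<exists>v\<in>mor T W V. (U, W, V, u, v, shm T i \<cdot> j') \<in> tri T \<and>
        u \<cdot> i = k \<cdot> g \<and> k' \<cdot> u = i' \<and> v \<cdot> k = j \<and> j' \<cdot> v = shm T f \<cdot> k'"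

definition shift :: "('o, 'm, 'k, 'z) tri_cat_scheme \<Rightarrow> int \<Rightarrow> 'o \<Rightarrow> 'o"
  where "shift T n X =
    (if 0 \<le> n then (sh T ^^ nat n) X else (inv_into (obj T) (sh T) ^^ nat (- n)) X)"

abbreviation shift_set :: "('o, 'm, 'k, 'z) tri_cat_scheme \<Rightarrow> int \<Rightarrow> 'o set \<Rightarrow> 'o set"
  where "shift_set T n S \<equiv> shift T n ` S"

definition triangulated_subcat :: "('o, 'm, 'k, 'z) tri_cat_scheme \<Rightarrow> 'o set \<Rightarrow> bool"
  where "triangulated_subcat T S \<longleftrightarrow> S \<subseteq> obj T \<and> iso_closed T S \<and>
    (\<forall>X. zero_object T X \<longrightarrow> X \<in> S) \<and> shift_set T 1 S \<subseteq> S \<and> shift_set T (- 1) S \<subseteq> S \<and>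
    (\<forall>X Y Z f g h. (X, Y, Z, f, g, h) \<in> tri T \<longrightarrow> X \<in> S \<longrightarrow> Y \<in> S \<longrightarrow> Z \<in> S)"

definition thick_subcat :: "('o, 'm, 'k, 'z) tri_cat_scheme \<Rightarrow> 'o set \<Rightarrow> bool"
  where "thick_subcat T S \<longleftrightarrow> triangulated_subcat T S \<and>
    (\<forall>Y\<in>S. \<forall>X. direct_summand T X Y \<longrightarrow> X \<in> S)"

text \<open>
  The triangulated (thick) subcategory generated by \<open>G\<close> is
  \<open>triangulated_subcat T hull G\<close> (\<open>thick_subcat T hull G\<close>).
\<close>


section \<open>t-structures\<close>

text \<open>A pair \<open>t\<close> consists of the aisle \<open>fst t\<close>, in degrees \<open>\<le> 0\<close>, and the coaisle \<open>snd t\<close>.\<close>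

definition t_le :: "('o, 'm, 'k, 'z) tri_cat_scheme \<Rightarrow> 'o set \<times> 'o set \<Rightarrow> int \<Rightarrow> 'o set"
  where "t_le T t n = shift_set T (- n) (fst t)"

definition t_ge :: "('o, 'm, 'k, 'z) tri_cat_scheme \<Rightarrow> 'o set \<times> 'o set \<Rightarrow> int \<Rightarrow> 'o set"
  where "t_ge T t n = shift_set T (- n) (snd t)"

definition t_structure :: "('o, 'm, 'k, 'z) tri_cat_scheme \<Rightarrow> 'o set \<times> 'o set \<Rightarrow> bool"
  where "t_structure T t \<longleftrightarrow>
    fst t \<subseteq> obj T \<and> snd t \<subseteq> obj T \<and> iso_closed T (fst t) \<and> iso_closed T (snd t) \<and>
    shift_set T 1 (fst t) \<subseteq> fst t \<and> shift_set T (- 1) (snd t) \<subseteq> snd t \<and>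
    hom_zero T (fst t) (t_ge T t 1) \<and>
    (\<forall>X\<in>obj T. \<exists>A\<in>fst t. \<exists>B\<in>t_ge T t 1. \<exists>f g h. (A, X, B, f, g, h) \<in> tri T)"

definition heart :: "'o set \<times> 'o set \<Rightarrow> 'o set"
  where "heart t = fst t \<inter> snd t"

definition t_nondegenerate :: "('o, 'm, 'k, 'z) tri_cat_scheme \<Rightarrow> 'o set \<times> 'o set \<Rightarrow> bool"
  where "t_nondegenerate T t \<longleftrightarrow>
    (\<Inter>n. t_le T t n) = {X. zero_object T X} \<and> (\<Inter>n. t_ge T t n) = {X. zero_object T X}"

definition t_bounded_above :: "('o, 'm, 'k, 'z) tri_cat_scheme \<Rightarrow> 'o set \<times> 'o set \<Rightarrow> bool"
  where "t_bounded_above T t \<longleftrightarrow> obj T = (\<Union>n. t_le T t n)"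


section \<open>Weight structures\<close>

text \<open>A pair \<open>w\<close> consists of \<open>fst w\<close>, in weights \<open>\<le> 0\<close>, and \<open>snd w\<close>, in weights \<open>\<ge> 0\<close>.\<close>

definition weight_structure :: "('o, 'm, 'k, 'z) tri_cat_scheme \<Rightarrow> 'o set \<times> 'o set \<Rightarrow> bool"
  where "weight_structure T w \<longleftrightarrow>
    fst w \<subseteq> obj T \<and> snd w \<subseteq> obj T \<and> Karoubi_closed T (fst w) \<and> Karoubi_closed T (snd w) \<and>
    shift_set T 1 (fst w) \<subseteq> fst w \<and> shift_set T (- 1) (snd w) \<subseteq> snd w \<and>
    hom_zero T (shift_set T (- 1) (snd w)) (fst w) \<and>
    (\<forall>X\<in>obj T. \<exists>A\<in>shift_set T (- 1) (snd w). \<exists>B\<in>fst w. \<exists>f g h. (A, X, B, f, g, h) \<in> tri T)"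

definition coheart :: "'o set \<times> 'o set \<Rightarrow> 'o set"
  where "coheart w = fst w \<inter> snd w"

definition w_bounded_above :: "('o, 'm, 'k, 'z) tri_cat_scheme \<Rightarrow> 'o set \<times> 'o set \<Rightarrow> bool"
  where "w_bounded_above T w \<longleftrightarrow> obj T = (\<Union>n. shift_set T (- n) (fst w))"

definition left_adjacent ::
    "('o, 'm, 'k, 'z) tri_cat_scheme \<Rightarrow> 'o set \<times> 'o set \<Rightarrow> 'o set \<times> 'o set \<Rightarrow> bool"
  where "left_adjacent T w t \<longleftrightarrow>
    hom_zero T (snd w) (t_le T t (- 1)) \<and> hom_zero T (fst w) (t_ge T t 1)"


section \<open>WT pairs and silting collections\<close>

definition WT_pair ::
    "('k, 'r) ring_scheme \<Rightarrow> ('o, 'm, 'k, 'z) tri_cat_scheme \<Rightarrow> 'o set \<Rightarrow> 'o set \<Rightarrow> bool"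
  where "WT_pair K T C D \<longleftrightarrow> (\<exists>w t.
    weight_structure T w \<and> t_structure T t \<and> t_nondegenerate T t \<and>
    left_adjacent T w t \<and>
    w_bounded_above T w \<and> t_bounded_above T t \<and>
    C = thick_subcat T hull coheart w \<and> D = triangulated_subcat T hull heart t \<and>
    Krull_Schmidt (full T (coheart w)) \<and>
    finite_up_to_iso T {X. indecomposable (full T (coheart w)) X} \<and>
    Hom_finite K (full T (heart t)) \<and> finite_length (full T (heart t)) \<and>
    finite_up_to_iso T {X. simple_object (full T (heart t)) X})"

definition add_closure :: "('o, 'm, 'k, 'z) lin_cat_scheme \<Rightarrow> 'o set \<Rightarrow> 'o set"
  where "add_closure C P =
    {X. \<exists>Xs Y. set Xs \<subseteq> P \<and> is_biproduct C Xs Y \<and> direct_summand C X Y}"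

definition perp_pos :: "('o, 'm, 'k, 'z) tri_cat_scheme \<Rightarrow> 'o set \<Rightarrow> 'o set"
  where "perp_pos T P = {Y \<in> obj T. \<forall>m>0. hom_zero T P {shift T m Y}}"

definition perp_neg :: "('o, 'm, 'k, 'z) tri_cat_scheme \<Rightarrow> 'o set \<Rightarrow> 'o set"
  where "perp_neg T P = {Y \<in> obj T. \<forall>m<0. hom_zero T P {shift T m Y}}"

definition silting_t :: "('o, 'm, 'k, 'z) tri_cat_scheme \<Rightarrow> 'o set \<Rightarrow> 'o set \<times> 'o set"
  where "silting_t T P = (perp_pos T P, perp_neg T P)"

definition silting_collection :: "('o, 'm, 'k, 'z) tri_cat_scheme \<Rightarrow> 'o set \<Rightarrow> bool"
  where "silting_collection T P \<longleftrightarrow>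
    (\<forall>X\<in>P. indecomposable T X) \<and>
    (\<forall>X\<in>P. \<forall>Y\<in>P. X \<noteq> Y \<longrightarrow> \<not> isomorphic T X Y) \<and>
    Krull_Schmidt (full T (add_closure T P)) \<and>
    t_structure T (silting_t T P)"

end

theory Submission
  imports Defs
begin

text \<open>
  If \<open>w\<close> is left adjacent to \<open>t\<close>, then weights \<open>\<le> 0\<close> form the aisle of \<open>t\<close> and the coheart consists of
  the objects without maps into degrees \<open>\<ge> 1\<close> and \<open>\<le> -1\<close>. Weight decompositions and boundedness
  above push an object that receives no maps from shifts of the coheart into ever lower degrees, so
  it vanishes by non-degeneracy; hence representatives \<open>P\<close> of the indecomposables of the coheart
  recover \<open>t\<close> as the silting t-structure, and truncating both arguments reduces \<open>Hom(p, X)\<close> to the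
  Hom-finite heart. Conversely, given \<open>P\<close>, right approximations by finite sums of objects of \<open>P\<close>
  kill the top cohomology of an object; iterating them yields weight decompositions whose coheart is
  the additive closure of \<open>P\<close>. On the heart, \<open>\<Sum>p. dim Hom(p, -)\<close> is additive on short exact
  sequences and positive on non-zero objects, which bounds lengths, and each simple object is a
  composition factor of the top cohomology of some \<open>p\<close>.
\<close>

section \<open>Linear categories\<close>

text \<open>Every exact sequence of Hom spaces enters through two factorizations,
  \<open>tri_factor_right\<close> and \<open>tri_factor_left\<close>, and is used where an outer
  term vanishes. Vanishing splits triangles, and splitting produces retracts, whereas the
  definitions ask for direct summands; idempotent completeness bridges the two. The heart is handled
  through triangles as well: its monomorphisms are the maps between heart objects whose cone lies in
  the heart, so subobjects, quotients and lengths become statements about triangles. For a silting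
  collection, the spaces \<open>Hom(p, X[m])\<close> detect the degrees in which \<open>X\<close>
  lives. An object on which all of them vanish lies in degrees \<le> 0 and \<ge> 1 at once, so it is
  zero; non-degeneracy and the positivity of the dimension count both come from this. Finite
  dimension of \<open>Hom(p, X)\<close> keeps the approximating sums finite. An approximation kills
  the top degree because \<open>P\<close> itself lies in degrees \<le> 0, so that maps from
  \<open>P\<close> into the cone lift without obstruction.\<close>

context linear_map
begin

text \<open>The vectors that \<open>T\<close> sends into the target span form a submodule containing
  \<open>B\<close>, and the span of \<open>B\<close> is the least such.\<close>

lemma map_span:
  assumes "B \<subseteq> carrier V" "v \<in> V.module.span B"
  shows "T v \<in> W.module.span (T ` B)"
proof -
  have TB: "T ` B \<subseteq> carrier W" using assms(1) by auto
  have sub: "subspace K (W.module.span (T ` B)) W" using TB by (rule W.span_is_subspace)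
  then have subm: "submodule K (W.module.span (T ` B)) W" by (rule W.is_module)
  let ?N = "{v \<in> carrier V. T v \<in> W.module.span (T ` B)}"
  have "submodule K ?N V"
  proof (rule submodule.intro)
    show "module K V" by (rule V.module.module_axioms)
    show "?N \<subseteq> carrier V" by auto
    show "\<zero>\<^bsub>V\<^esub> \<in> ?N" using submodule.zero_closed[OF subm] by (simp add: T0_is_0)
    show "\<And>v w. v \<in> ?N \<Longrightarrow> w \<in> ?N \<Longrightarrow> v \<oplus>\<^bsub>V\<^esub> w \<in> ?N"
      using submodule.m_closed[OF subm] by simp
    show "\<And>c v. c \<in> carrier K \<Longrightarrow> v \<in> ?N \<Longrightarrow> c \<odot>\<^bsub>V\<^esub> v \<in> ?N"
      using submodule.smult_closed[OF subm] by simp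
  qed
  moreover have "B \<subseteq> ?N" using assms(1) W.module.in_own_span[OF TB] by auto
  ultimately have "V.module.span B \<subseteq> ?N" by (intro V.module.span_is_subset) auto
  then show ?thesis using assms(2) by auto
qed

text \<open>By injectivity a vanishing combination of the images pulls back to a vanishing
  combination of \<open>A\<close> with coefficients \<open>a \<circ> T\<close>.\<close>

lemma lin_indpt_image:
  assumes inj: "inj_on T (carrier V)" and "finite A" "A \<subseteq> carrier V" "V.module.lin_indpt A"
  shows "W.module.lin_indpt (T ` A)"
proof (rule W.module.finite_lin_indpt2)
  show "finite (T ` A)" "T ` A \<subseteq> carrier W" using assms by auto
  fix a assume a: "a \<in> T ` A \<rightarrow> carrier K" and z: "W.module.lincomb a (T ` A) = \<zero>\<^bsub>W\<^esub>"
  have aT: "a \<circ> T \<in> A \<rightarrow> carrier K" using a by auto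
  have "T (V.module.lincomb (a \<circ> T) A) = \<zero>\<^bsub>W\<^esub>"
    using z lincomb_linear_image[OF inj assms(3) a assms(2)] by simp
  moreover have "V.module.lincomb (a \<circ> T) A \<in> carrier V" using aT assms by (intro V.module.lincomb_closed)
  ultimately have "V.module.lincomb (a \<circ> T) A = \<zero>\<^bsub>V\<^esub>"
    using inj T0_is_0 V.module.M.zero_closed by (metis inj_onD)
  then have "\<not> (a \<circ> T) v \<noteq> \<zero>\<^bsub>K\<^esub>" if "v \<in> A" for v
    using assms aT that V.module.lin_dep_crit[of A A "a \<circ> T" v] by blast
  then show "\<forall>v\<in>T ` A. a v = \<zero>\<^bsub>K\<^esub>" by auto
qed

text \<open>Independent sets survive in \<open>W\<close>, so \<open>W.dim\<close> bounds their size,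
  and a maximal one is a finite generating set of \<open>V\<close>. The bound is proved for finite
  subsets first, since an infinite independent set would contain finite ones larger than
  \<open>W.dim\<close>.\<close>

lemma inj_fin_dim:
  assumes fd: "W.fin_dim" and inj: "inj_on T (carrier V)"
  shows "V.fin_dim"
proof -
  have bound: "finite A \<and> card A \<le> W.dim" if A: "A \<subseteq> carrier V" "V.module.lin_indpt A" for A
  proof -
    have small: "card B \<le> W.dim" if "finite B" "B \<subseteq> A" for B
    proof -
      have "W.module.lin_indpt (T ` B)"
        using that A lin_indpt_image[OF inj that(1)] V.module.subset_li_is_li[OF A(2)] by blast
      then have "card (T ` B) \<le> W.dim" using W.li_le_dim(2)[OF fd, of "T ` B"] that A by blast
      moreover have "card (T ` B) = card B"
        using that A inj by (intro card_image) (meson inj_on_subset)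
      ultimately show ?thesis by simp
    qed
    show ?thesis
      using small infinite_arbitrarily_large[of A "Suc W.dim"] by fastforce
  qed
  have "V.module.lin_indpt {}" by (rule V.module.finite_lin_indpt2) auto
  then obtain A where A: "finite A" "maximal A (\<lambda>S. S \<subseteq> carrier V \<and> V.module.lin_indpt S)"
    using maximal_exists[of "\<lambda>S. S \<subseteq> carrier V \<and> V.module.lin_indpt S" W.dim "{}"] bound by auto
  then have "V.module.gen_set A" by (intro V.max_li_is_gen)
  then show ?thesis unfolding V.fin_dim_def using A unfolding maximal_def by auto
qed

lemma dim_image_inj:
  assumes "V.fin_dim" "inj_on T (carrier V)"
  shows "vectorspace.dim K (W.vs (T ` carrier V)) = V.dim"
  using rank_nullity[OF assms(1)] inj_imp_dim_ker0[OF assms(2)] by (simp add: im_def)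

end

text \<open>Non-units of a local ring are closed under addition, and the empty sum is excluded
  because \<open>1 \<noteq> 0\<close>. Applied to an identity written as a sum of endomorphisms,
  this picks out the component through which an object splits.\<close>

lemma local_ring_finsum_Units:
  assumes "local_ring R" "finite A" "f \<in> A \<rightarrow> carrier R" "finsum R f A \<in> Units R"
  shows "\<exists>i\<in>A. f i \<in> Units R"
  using assms(2-4)
proof (induction A rule: finite_induct)
  case empty
  interpret ring R using assms(1) by (simp add: local_ring_def)
  from empty have "\<zero>\<^bsub>R\<^esub> \<in> Units R" by simp
  then have "\<one>\<^bsub>R\<^esub> = \<zero>\<^bsub>R\<^esub>" unfolding Units_def by auto
  then show ?case using assms(1) by (simp add: local_ring_def)
next
  case (insert x A)
  interpret ring R using assms(1) by (simp add: local_ring_def)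
  have "f x \<oplus>\<^bsub>R\<^esub> finsum R f A \<in> Units R"
    using insert by (simp add: Pi_def)
  moreover have "f x \<in> carrier R" "finsum R f A \<in> carrier R"
    using insert.prems by (auto intro!: finsum_closed)
  ultimately have "f x \<in> Units R \<or> finsum R f A \<in> Units R"
    using assms(1) unfolding local_ring_def by blast
  then show ?case using insert by auto
qed

section \<open>Calculus of morphisms, orthogonality and retracts\<close>

context linear_category
begin

abbreviation orth
  where "orth X Y \<equiv> hom_zero C {X} {Y}"

lemma Hom_group: "\<lbrakk>X \<in> obj C; Y \<in> obj C\<rbrakk> \<Longrightarrow> abelian_group (Hom C X Y)"
  using Hom_vectorspace[of X Y] by (simp add: vectorspace_def module_def)

lemma zmor_closed [simp]: "\<lbrakk>X \<in> obj C; Y \<in> obj C\<rbrakk> \<Longrightarrow> zmor C X Y \<in> mor C X Y"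
  by (rule abelian_groupE(2)[OF Hom_group])

lemma
  assumes "X \<in> obj C" "Y \<in> obj C" "Z \<in> obj C"
  shows cmp_closed: "\<lbrakk>g \<in> mor C Y Z; f \<in> mor C X Y\<rbrakk> \<Longrightarrow> g \<cdot> f \<in> mor C X Z"
    and cmp_zmor_right: "g \<in> mor C Y Z \<Longrightarrow> g \<cdot> zmor C X Y = zmor C X Z"
    and cmp_zmor_left: "f \<in> mor C X Y \<Longrightarrow> zmor C Y Z \<cdot> f = zmor C X Z"
    and cmp_add_right: "\<lbrakk>g \<in> mor C Y Z; f \<in> mor C X Y; f' \<in> mor C X Y\<rbrakk>
      \<Longrightarrow> g \<cdot> (f \<oplus>\<^bsub>Hom C X Y\<^esub> f') = (g \<cdot> f) \<oplus>\<^bsub>Hom C X Z\<^esub> (g \<cdot> f')"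
    and cmp_add_left: "\<lbrakk>g \<in> mor C Y Z; g' \<in> mor C Y Z; f \<in> mor C X Y\<rbrakk>
      \<Longrightarrow> (g \<oplus>\<^bsub>Hom C Y Z\<^esub> g') \<cdot> f = (g \<cdot> f) \<oplus>\<^bsub>Hom C X Z\<^esub> (g' \<cdot> f)"
    and cmp_minus_right: "\<lbrakk>g \<in> mor C Y Z; f \<in> mor C X Y; f' \<in> mor C X Y\<rbrakk>
      \<Longrightarrow> g \<cdot> (f \<ominus>\<^bsub>Hom C X Y\<^esub> f') = (g \<cdot> f) \<ominus>\<^bsub>Hom C X Z\<^esub> (g \<cdot> f')"
    and cmp_minus_left: "\<lbrakk>g \<in> mor C Y Z; g' \<in> mor C Y Z; f \<in> mor C X Y\<rbrakk>
      \<Longrightarrow> (g \<ominus>\<^bsub>Hom C Y Z\<^esub> g') \<cdot> f = (g \<cdot> f) \<ominus>\<^bsub>Hom C X Z\<^esub> (g' \<cdot> f)"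
    and cmp_neg_right: "\<lbrakk>g \<in> mor C Y Z; f \<in> mor C X Y\<rbrakk>
      \<Longrightarrow> g \<cdot> (\<ominus>\<^bsub>Hom C X Y\<^esub> f) = \<ominus>\<^bsub>Hom C X Z\<^esub> (g \<cdot> f)"
    and cmp_neg_left: "\<lbrakk>g \<in> mor C Y Z; f \<in> mor C X Y\<rbrakk>
      \<Longrightarrow> (\<ominus>\<^bsub>Hom C Y Z\<^esub> g) \<cdot> f = \<ominus>\<^bsub>Hom C X Z\<^esub> (g \<cdot> f)"
proof -
  { fix g assume g: "g \<in> mor C Y Z"
    interpret linear_map K "Hom C X Y" "Hom C X Z" "\<lambda>f. g \<cdot> f"
      using cmp_linear_right assms g by blast
    show "f \<in> mor C X Y \<Longrightarrow> g \<cdot> f \<in> mor C X Z" for f by auto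
    show "g \<cdot> zmor C X Y = zmor C X Z" by simp
    show "\<lbrakk>f \<in> mor C X Y; f' \<in> mor C X Y\<rbrakk>
      \<Longrightarrow> g \<cdot> (f \<oplus>\<^bsub>Hom C X Y\<^esub> f') = (g \<cdot> f) \<oplus>\<^bsub>Hom C X Z\<^esub> (g \<cdot> f')" for f f' by simp
    show "\<lbrakk>f \<in> mor C X Y; f' \<in> mor C X Y\<rbrakk>
      \<Longrightarrow> g \<cdot> (f \<ominus>\<^bsub>Hom C X Y\<^esub> f') = (g \<cdot> f) \<ominus>\<^bsub>Hom C X Z\<^esub> (g \<cdot> f')" for f f' by simp
    show "f \<in> mor C X Y \<Longrightarrow> g \<cdot> (\<ominus>\<^bsub>Hom C X Y\<^esub> f) = \<ominus>\<^bsub>Hom C X Z\<^esub> (g \<cdot> f)" for f by simp }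
  { fix f assume f: "f \<in> mor C X Y"
    interpret linear_map K "Hom C Y Z" "Hom C X Z" "\<lambda>g. g \<cdot> f"
      using cmp_linear_left assms f by blast
    show "zmor C Y Z \<cdot> f = zmor C X Z" by simp
    show "\<lbrakk>g \<in> mor C Y Z; g' \<in> mor C Y Z\<rbrakk>
      \<Longrightarrow> (g \<oplus>\<^bsub>Hom C Y Z\<^esub> g') \<cdot> f = (g \<cdot> f) \<oplus>\<^bsub>Hom C X Z\<^esub> (g' \<cdot> f)" for g g' by simp
    show "\<lbrakk>g \<in> mor C Y Z; g' \<in> mor C Y Z\<rbrakk>
      \<Longrightarrow> (g \<ominus>\<^bsub>Hom C Y Z\<^esub> g') \<cdot> f = (g \<cdot> f) \<ominus>\<^bsub>Hom C X Z\<^esub> (g' \<cdot> f)" for g g' by simp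
    show "g \<in> mor C Y Z \<Longrightarrow> (\<ominus>\<^bsub>Hom C Y Z\<^esub> g) \<cdot> f = \<ominus>\<^bsub>Hom C X Z\<^esub> (g \<cdot> f)" for g by simp }
qed

lemma minus_closed:
  "\<lbrakk>X \<in> obj C; Y \<in> obj C; f \<in> mor C X Y; g \<in> mor C X Y\<rbrakk> \<Longrightarrow> f \<ominus>\<^bsub>Hom C X Y\<^esub> g \<in> mor C X Y"
  by (simp add: Hom_group abelian_group.minus_closed)

lemma minus_eq_zmor_iff:
  "\<lbrakk>X \<in> obj C; Y \<in> obj C; f \<in> mor C X Y; g \<in> mor C X Y\<rbrakk>
    \<Longrightarrow> f \<ominus>\<^bsub>Hom C X Y\<^esub> g = zmor C X Y \<longleftrightarrow> f = g"
  using abelian_group.minus_other_side abelian_groupE(5) Hom_group abelian_groupE(2)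
  by (metis abelian_group.r_neg abelian_group.minus_eq)

lemma minus_zmor:
  "\<lbrakk>X \<in> obj C; Y \<in> obj C; f \<in> mor C X Y\<rbrakk> \<Longrightarrow> f \<ominus>\<^bsub>Hom C X Y\<^esub> zmor C X Y = f"
proof -
  assume a: "X \<in> obj C" "Y \<in> obj C" "f \<in> mor C X Y"
  interpret abelian_group "Hom C X Y" using a Hom_group by blast
  show ?thesis using a by (simp add: minus_eq)
qed

lemma cmp_finsum_right:
  assumes "X \<in> obj C" "Y \<in> obj C" "Z \<in> obj C" "g \<in> mor C Y Z" "finite A" "f \<in> A \<rightarrow> mor C X Y"
  shows "g \<cdot> (\<Oplus>\<^bsub>Hom C X Y\<^esub>i\<in>A. f i) = (\<Oplus>\<^bsub>Hom C X Z\<^esub>i\<in>A. g \<cdot> f i)"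
proof -
  interpret V: abelian_group "Hom C X Y" using assms Hom_group by blast
  interpret W: abelian_group "Hom C X Z" using assms Hom_group by blast
  show ?thesis using assms(5,6)
  proof (induction A rule: finite_induct)
    case empty then show ?case using assms by (simp add: cmp_zmor_right)
  next
    case (insert x A)
    then have c: "f \<in> A \<rightarrow> mor C X Y" "f x \<in> mor C X Y" "(\<lambda>i. g \<cdot> f i) \<in> A \<rightarrow> mor C X Z"
      "g \<cdot> f x \<in> mor C X Z" using assms by (auto intro!: cmp_closed[OF assms(1-3)] simp: Pi_iff)
    then show ?case
      using insert assms by (simp add: cmp_add_right[where ?Y = Y] V.finsum_closed)
  qed
qed

lemma cmp_finsum_left:
  assumes "X \<in> obj C" "Y \<in> obj C" "Z \<in> obj C" "f \<in> mor C X Y" "finite A" "g \<in> A \<rightarrow> mor C Y Z"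
  shows "(\<Oplus>\<^bsub>Hom C Y Z\<^esub>i\<in>A. g i) \<cdot> f = (\<Oplus>\<^bsub>Hom C X Z\<^esub>i\<in>A. g i \<cdot> f)"
proof -
  interpret V: abelian_group "Hom C Y Z" using assms Hom_group by blast
  interpret W: abelian_group "Hom C X Z" using assms Hom_group by blast
  show ?thesis using assms(5,6)
  proof (induction A rule: finite_induct)
    case empty then show ?case using assms by (simp add: cmp_zmor_left)
  next
    case (insert x A)
    then have c: "g \<in> A \<rightarrow> mor C Y Z" "g x \<in> mor C Y Z" "(\<lambda>i. g i \<cdot> f) \<in> A \<rightarrow> mor C X Z"
      "g x \<cdot> f \<in> mor C X Z" using assms by (auto intro!: cmp_closed[OF assms(1-3)] simp: Pi_iff)
    then show ?case
      using insert assms by (simp add: cmp_add_left[where ?Y = Y] V.finsum_closed)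
  qed
qed

lemma orthI:
  "\<lbrakk>X \<in> obj C; Y \<in> obj C; \<And>f. f \<in> mor C X Y \<Longrightarrow> f = zmor C X Y\<rbrakk> \<Longrightarrow> orth X Y"
  unfolding hom_zero_def by auto

lemma orthD: "\<lbrakk>orth X Y; f \<in> mor C X Y\<rbrakk> \<Longrightarrow> f = zmor C X Y"
  unfolding hom_zero_def by auto

lemma hom_zero_iff: "hom_zero C A B \<longleftrightarrow> (\<forall>X\<in>A. \<forall>Y\<in>B. orth X Y)"
  unfolding hom_zero_def by auto

lemma hom_zeroD: "\<lbrakk>hom_zero C A B; X \<in> A; Y \<in> B\<rbrakk> \<Longrightarrow> orth X Y"
  using hom_zero_iff by blast

lemma zero_objectI:
  assumes X: "X \<in> obj C" and id0: "idm C X = zmor C X X"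
  shows "zero_object C X"
proof -
  have "orth X Y" "orth Y X" if Y: "Y \<in> obj C" for Y
  proof -
    show "orth X Y"
    proof (rule orthI[OF X Y])
      fix f assume f: "f \<in> mor C X Y"
      have "f = f \<cdot> idm C X" using idm_right[OF X Y f] by simp
      also have "\<dots> = zmor C X Y" using cmp_zmor_right[OF X X Y f] id0 by simp
      finally show "f = zmor C X Y" .
    qed
    show "orth Y X"
    proof (rule orthI[OF Y X])
      fix f assume f: "f \<in> mor C Y X"
      have "f = idm C X \<cdot> f" using idm_left[OF Y X f] by simp
      also have "\<dots> = zmor C Y X" using cmp_zmor_left[OF Y X X f] id0 by simp
      finally show "f = zmor C Y X" .
    qed
  qed
  then show ?thesis unfolding zero_object_def using X hom_zero_iff by blast
qed

lemma zero_object_idm: "zero_object C X \<Longrightarrow> idm C X = zmor C X X"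
  unfolding zero_object_def hom_zero_def using idm_closed by blast

lemma zero_object_orth:
  "zero_object C X \<Longrightarrow> Y \<in> obj C \<Longrightarrow> orth X Y"
  "zero_object C X \<Longrightarrow> Y \<in> obj C \<Longrightarrow> orth Y X"
  unfolding zero_object_def hom_zero_def by blast+

lemma zero_object_obj: "zero_object C X \<Longrightarrow> X \<in> obj C"
  unfolding zero_object_def by blast

lemma zero_object_iff_orth: "X \<in> obj C \<Longrightarrow> zero_object C X \<longleftrightarrow> orth X X"
  using zero_objectI orthD idm_closed zero_object_orth by blast

lemma retract_obj: "retract C X Y \<Longrightarrow> X \<in> obj C" "retract C X Y \<Longrightarrow> Y \<in> obj C"
  unfolding retract_def by auto

lemma retractE:
  assumes "retract C X Y"
  obtains s r where "X \<in> obj C" "Y \<in> obj C" "s \<in> mor C X Y" "r \<in> mor C Y X" "r \<cdot> s = idm C X"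
  using assms unfolding retract_def by auto

lemma retractI:
  "\<lbrakk>X \<in> obj C; Y \<in> obj C; s \<in> mor C X Y; r \<in> mor C Y X; r \<cdot> s = idm C X\<rbrakk> \<Longrightarrow> retract C X Y"
  unfolding retract_def by auto

lemma retract_trans:
  assumes "retract C X Y" "retract C Y Z" shows "retract C X Z"
proof -
  obtain s r where 1: "X \<in> obj C" "Y \<in> obj C" "s \<in> mor C X Y" "r \<in> mor C Y X" "r \<cdot> s = idm C X"
    using assms(1) by (rule retractE)
  obtain s' r' where 2: "Z \<in> obj C" "s' \<in> mor C Y Z" "r' \<in> mor C Z Y" "r' \<cdot> s' = idm C Y"
    using assms(2) by (rule retractE)
  have "(r \<cdot> r') \<cdot> (s' \<cdot> s) = r \<cdot> (r' \<cdot> (s' \<cdot> s))"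
    using 1 2 cmp_assoc[of X Z Y X "s' \<cdot> s" r' r] cmp_closed[of X Y Z s' s] by simp
  also have "r' \<cdot> (s' \<cdot> s) = s"
    using 1 2 cmp_assoc[of X Y Z Y s s' r'] idm_left by simp
  finally have "(r \<cdot> r') \<cdot> (s' \<cdot> s) = idm C X" using 1 by simp
  then show ?thesis using 1 2 cmp_closed by (intro retractI[of X Z "s' \<cdot> s" "r \<cdot> r'"]) auto
qed

lemma orth_retract_left:
  assumes "retract C X Y" "orth Y W" "W \<in> obj C" shows "orth X W"
proof -
  obtain s r where 1: "X \<in> obj C" "Y \<in> obj C" "s \<in> mor C X Y" "r \<in> mor C Y X" "r \<cdot> s = idm C X"
    using assms(1) by (rule retractE)
  show ?thesis
  proof (rule orthI)
    fix f assume f: "f \<in> mor C X W"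
    have "f = f \<cdot> (r \<cdot> s)" using 1 f assms idm_right by simp
    also have "\<dots> = (f \<cdot> r) \<cdot> s" using 1 f assms cmp_assoc[of X Y X W s r f] by simp
    also have "f \<cdot> r = zmor C Y W" using orthD[OF assms(2)] 1 f assms cmp_closed[of Y X W] by blast
    finally show "f = zmor C X W" using 1 assms cmp_zmor_left[of X Y W] by simp
  qed (use 1 assms in auto)
qed

lemma orth_retract_right:
  assumes "retract C X Y" "orth W Y" "W \<in> obj C" shows "orth W X"
proof -
  obtain s r where 1: "X \<in> obj C" "Y \<in> obj C" "s \<in> mor C X Y" "r \<in> mor C Y X" "r \<cdot> s = idm C X"
    using assms(1) by (rule retractE)
  show ?thesis
  proof (rule orthI)
    fix f assume f: "f \<in> mor C W X"
    have "f = (r \<cdot> s) \<cdot> f" using 1 f assms idm_left by simp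
    also have "\<dots> = r \<cdot> (s \<cdot> f)" using 1 f assms cmp_assoc[of W X Y X f s r] by simp
    also have "s \<cdot> f = zmor C W Y" using orthD[OF assms(2)] 1 f assms cmp_closed[of W X Y] by blast
    finally show "f = zmor C W X" using 1 assms cmp_zmor_right[of W Y X] by simp
  qed (use 1 assms in auto)
qed

lemma isomorphic_retract: "isomorphic C X Y \<Longrightarrow> retract C X Y"
  unfolding isomorphic_def is_isomorphism_def retract_def by blast

lemma isomorphic_sym: "isomorphic C X Y \<Longrightarrow> isomorphic C Y X"
  unfolding isomorphic_def is_isomorphism_def by blast

lemma isomorphic_refl: "X \<in> obj C \<Longrightarrow> isomorphic C X X"
  unfolding isomorphic_def is_isomorphism_def using idm_closed[of X] idm_left[of X X "idm C X"] by blast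

lemma is_isomorphism_comp:
  assumes "is_isomorphism C X Y f" "is_isomorphism C Y Z g"
  shows "is_isomorphism C X Z (g \<cdot> f)"
proof -
  obtain f' where f: "X \<in> obj C" "Y \<in> obj C" "f \<in> mor C X Y" "f' \<in> mor C Y X"
    "f' \<cdot> f = idm C X" "f \<cdot> f' = idm C Y"
    using assms(1) unfolding is_isomorphism_def by auto
  obtain g' where g: "Z \<in> obj C" "g \<in> mor C Y Z" "g' \<in> mor C Z Y"
    "g' \<cdot> g = idm C Y" "g \<cdot> g' = idm C Z"
    using assms(2) unfolding is_isomorphism_def by auto
  have "(f' \<cdot> g') \<cdot> (g \<cdot> f) = f' \<cdot> (g' \<cdot> (g \<cdot> f))"
    using f g cmp_assoc[of X Z Y X "g \<cdot> f" g' f'] cmp_closed[of X Y Z] by simp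
  also have "g' \<cdot> (g \<cdot> f) = f" using f g cmp_assoc[of X Y Z Y f g g'] idm_left by simp
  finally have 1: "(f' \<cdot> g') \<cdot> (g \<cdot> f) = idm C X" using f by simp
  have "(g \<cdot> f) \<cdot> (f' \<cdot> g') = g \<cdot> (f \<cdot> (f' \<cdot> g'))"
    using f g cmp_assoc[of Z X Y Z "f' \<cdot> g'" f g] cmp_closed[of Z Y X] by simp
  also have "f \<cdot> (f' \<cdot> g') = g'" using f g cmp_assoc[of Z Y X Y g' f' f] idm_left by simp
  finally have 2: "(g \<cdot> f) \<cdot> (f' \<cdot> g') = idm C Z" using g by simp
  have "g \<cdot> f \<in> mor C X Z" "f' \<cdot> g' \<in> mor C Z X" using f g cmp_closed by auto
  then show ?thesis unfolding is_isomorphism_def using 1 2 f g by blast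
qed

lemma isomorphic_trans: "isomorphic C X Y \<Longrightarrow> isomorphic C Y Z \<Longrightarrow> isomorphic C X Z"
  unfolding isomorphic_def using is_isomorphism_comp by blast

end

section \<open>Biproducts and local endomorphism rings\<close>

lemma full_simps [simp]:
  "obj (full C S) = S" "Hom (full C S) = Hom C" "idm (full C S) = idm C" "cmp (full C S) = cmp C"
  by (simp_all add: full_def)

lemma End_ring_simps [simp]:
  "carrier (End_ring C X) = mor C X X" "zero (End_ring C X) = zmor C X X"
  "add (End_ring C X) = add (Hom C X X)" "mult (End_ring C X) = cmp C" "one (End_ring C X) = idm C X"
  by (simp_all add: End_ring_def)

lemma End_ring_full [simp]: "End_ring (full C S) = End_ring C"
  by (simp add: End_ring_def fun_eq_iff)

lemma finsum_End_ring: "finsum (End_ring C X) = finsum (Hom C X X)"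
  by (simp add: finsum_def)

lemma is_biproduct_full_iff:
  "S \<subseteq> obj C \<Longrightarrow> is_biproduct (full C S) Xs X \<longleftrightarrow> is_biproduct C Xs X \<and> X \<in> S \<and> set Xs \<subseteq> S"
  unfolding is_biproduct_def by auto

lemma is_isomorphism_full_iff:
  "S \<subseteq> obj C \<Longrightarrow> is_isomorphism (full C S) X Y f \<longleftrightarrow> is_isomorphism C X Y f \<and> X \<in> S \<and> Y \<in> S"
  unfolding is_isomorphism_def by auto

lemma hom_zero_full [simp]: "hom_zero (full C S) = hom_zero C"
  by (simp add: hom_zero_def fun_eq_iff)

context linear_category
begin

text \<open>This makes the results of the locale available inside the coheart and inside the
  heart.\<close>

lemma linear_category_full: "S \<subseteq> obj C \<Longrightarrow> linear_category K (full C S)"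
proof -
  assume S: "S \<subseteq> obj C"
  show ?thesis
  proof (rule linear_category.intro, unfold full_simps)
    fix W X Y Z f g h
    assume a: "W \<in> S" "X \<in> S" "Y \<in> S" "Z \<in> S" "f \<in> mor C W X" "g \<in> mor C X Y" "h \<in> mor C Y Z"
    then have "W \<in> obj C" "X \<in> obj C" "Y \<in> obj C" "Z \<in> obj C" using S by auto
    then show "h \<cdot> (g \<cdot> f) = (h \<cdot> g) \<cdot> f" using a(5-7) by (rule cmp_assoc)
  next
    fix X Y f
    assume a: "X \<in> S" "Y \<in> S" "f \<in> mor C X Y"
    then have "X \<in> obj C" "Y \<in> obj C" using S by auto
    then show "idm C Y \<cdot> f = f" "f \<cdot> idm C X = f" using a(3) by (rule idm_left, rule idm_right)
  qed (use S in \<open>simp_all add: field_K Hom_vectorspace idm_closed cmp_linear_right cmp_linear_left subset_iff\<close>)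
qed

text \<open>Being zero is a condition on the endomorphisms of the object alone, so the ambient
  category does not matter.\<close>

lemma zero_object_full_iff:
  "S \<subseteq> obj C \<Longrightarrow> zero_object (full C S) X \<longleftrightarrow> zero_object C X \<and> X \<in> S"
  using linear_category.zero_object_iff_orth[OF linear_category_full, of S X]
    linear_category.zero_object_obj[OF linear_category_full, of S X]
    zero_object_iff_orth zero_object_obj by (auto simp: subset_iff)

lemma is_biproduct_pairI:
  assumes "X \<in> obj C" "Y \<in> obj C" "E \<in> obj C"
    and "i \<in> mor C X E" "j \<in> mor C Y E" "p \<in> mor C E X" "q \<in> mor C E Y"
    and "p \<cdot> i = idm C X" "q \<cdot> j = idm C Y" "p \<cdot> j = zmor C Y X" "q \<cdot> i = zmor C X Y"
    and "(i \<cdot> p) \<oplus>\<^bsub>Hom C E E\<^esub> (j \<cdot> q) = idm C E"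
  shows "is_biproduct C [X, Y] E"
proof -
  interpret E: abelian_group "Hom C E E" using assms Hom_group by blast
  let ?inj = "\<lambda>n. if n = 0 then i else j" and ?proj = "\<lambda>n. if n = 0 then p else q"
  have lt2: "n < length [X, Y] \<longleftrightarrow> n = 0 \<or> n = 1" for n by auto
  have s: "{..<length [X, Y]} = insert 0 {1}" by auto
  have c: "i \<cdot> p \<in> mor C E E" "j \<cdot> q \<in> mor C E E" using assms cmp_closed by auto
  have "(\<Oplus>\<^bsub>Hom C E E\<^esub>n\<in>{..<length [X, Y]}. ?inj n \<cdot> ?proj n) = idm C E"
    unfolding s using assms(12) c by (subst E.finsum_insert) (auto simp: E.r_zero)
  then show ?thesis unfolding is_biproduct_def
    using assms(1-11) by (intro conjI exI[of _ ?inj] exI[of _ ?proj]) (auto simp: lt2 nth_Cons')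
qed

lemma is_biproduct_pairE:
  assumes "is_biproduct C [X, Y] E"
  obtains i j p q where "X \<in> obj C" "Y \<in> obj C" "E \<in> obj C"
    "i \<in> mor C X E" "j \<in> mor C Y E" "p \<in> mor C E X" "q \<in> mor C E Y"
    "p \<cdot> i = idm C X" "q \<cdot> j = idm C Y" "p \<cdot> j = zmor C Y X" "q \<cdot> i = zmor C X Y"
    "(i \<cdot> p) \<oplus>\<^bsub>Hom C E E\<^esub> (j \<cdot> q) = idm C E"
proof -
  have o: "X \<in> obj C" "Y \<in> obj C" "E \<in> obj C" using assms unfolding is_biproduct_def by auto
  interpret E: abelian_group "Hom C E E" using o Hom_group by blast
  obtain inj proj where 1: "\<And>i. i < 2 \<Longrightarrow> inj i \<in> mor C ([X, Y] ! i) E \<and> proj i \<in> mor C E ([X, Y] ! i)"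
    and 2: "\<And>i j. i < 2 \<Longrightarrow> j < 2 \<Longrightarrow> proj i \<cdot> inj j =
      (if i = j then idm C ([X, Y] ! i) else zmor C ([X, Y] ! j) ([X, Y] ! i))"
    and 3: "(\<Oplus>\<^bsub>Hom C E E\<^esub>i\<in>{..<2}. inj i \<cdot> proj i) = idm C E"
  proof -
    obtain inj proj where "\<forall>i<2. inj i \<in> mor C ([X, Y] ! i) E \<and> proj i \<in> mor C E ([X, Y] ! i)"
      "\<forall>i<2. \<forall>j<2. proj i \<cdot> inj j =
        (if i = j then idm C ([X, Y] ! i) else zmor C ([X, Y] ! j) ([X, Y] ! i))"
      "(\<Oplus>\<^bsub>Hom C E E\<^esub>i\<in>{..<2}. inj i \<cdot> proj i) = idm C E"
      using assms unfolding is_biproduct_def by (auto simp flip: numeral_2_eq_2)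
    then show thesis by (intro that[of inj proj]) blast+
  qed
  have s: "{..<2::nat} = insert 0 {1}" by auto
  have m: "inj 0 \<in> mor C X E" "inj 1 \<in> mor C Y E" "proj 0 \<in> mor C E X" "proj 1 \<in> mor C E Y"
    using 1[of 0] 1[of 1] by auto
  have c: "inj 0 \<cdot> proj 0 \<in> mor C E E" "inj 1 \<cdot> proj 1 \<in> mor C E E"
    using m o cmp_closed by auto
  have "(inj 0 \<cdot> proj 0) \<oplus>\<^bsub>Hom C E E\<^esub> (inj 1 \<cdot> proj 1) = idm C E"
    using 3 c unfolding s by (subst (asm) E.finsum_insert) (auto simp: E.r_zero)
  then show thesis
    using that[OF o m] 2[of 0 0] 2[of 1 1] 2[of 0 1] 2[of 1 0] by auto
qed

lemma is_biproduct_zeroI: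
  assumes X: "X \<in> obj C" and Z: "zero_object C Z"
  shows "is_biproduct C [X, Z] X"
proof -
  note z = zero_object_obj[OF Z]
  interpret E: abelian_group "Hom C X X" using X Hom_group by blast
  show ?thesis
    by (rule is_biproduct_pairI[of _ _ _ "idm C X" "zmor C Z X" "idm C X" "zmor C X Z"])
      (use X z idm_closed[OF X] zero_object_idm[OF Z] in
        \<open>auto simp: idm_left[of X X] cmp_zmor_left cmp_zmor_right idm_left idm_right E.r_zero\<close>)
qed

lemma direct_summand_retract: "direct_summand C X Y \<Longrightarrow> retract C X Y"
  unfolding direct_summand_def by (auto elim!: is_biproduct_pairE intro: retractI)

lemma is_biproduct_pair_retract:
  assumes "is_biproduct C [X, Y] E" shows "retract C X E" "retract C Y E"
  using assms by (auto elim!: is_biproduct_pairE intro: retractI)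

text \<open>The idempotent \<open>e = 1 - s r\<close> splits, and its image is the complement. The
  mixed composites vanish because \<open>r e = 0\<close> and \<open>e s = 0\<close>, while the
  splitting maps satisfy \<open>s' = e s'\<close> and \<open>r' = r' e\<close>.\<close>

lemma retract_complement:
  assumes "idempotent_complete C" "retract C X Y"
  shows "\<exists>Z. is_biproduct C [X, Z] Y"
proof -
  obtain s r where 1: "X \<in> obj C" "Y \<in> obj C" "s \<in> mor C X Y" "r \<in> mor C Y X" "r \<cdot> s = idm C X"
    using assms(2) by (rule retractE)
  interpret E: abelian_group "Hom C Y Y" using 1 Hom_group by blast
  define e where "e = idm C Y \<ominus>\<^bsub>Hom C Y Y\<^esub> (s \<cdot> r)"
  have sr: "s \<cdot> r \<in> mor C Y Y" using 1 cmp_closed by auto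
  have idY: "idm C Y \<in> mor C Y Y" using 1 idm_closed by auto
  have e: "e \<in> mor C Y Y" unfolding e_def using idY sr 1 minus_closed by auto
  have "r \<cdot> e = r \<ominus>\<^bsub>Hom C Y X\<^esub> (r \<cdot> (s \<cdot> r))"
    unfolding e_def using 1 idY sr cmp_minus_right[of Y Y X r] idm_right by simp
  also have "r \<cdot> (s \<cdot> r) = r" using 1 cmp_assoc[of Y X Y X r s r] idm_left by simp
  finally have re: "r \<cdot> e = zmor C Y X" using 1 minus_eq_zmor_iff by simp
  have "e \<cdot> s = s \<ominus>\<^bsub>Hom C X Y\<^esub> ((s \<cdot> r) \<cdot> s)"
    unfolding e_def using 1 idY sr cmp_minus_left[of X Y Y _ _ s] idm_left by simp
  also have "(s \<cdot> r) \<cdot> s = s" using 1 cmp_assoc[of X Y X Y s r s] idm_right by simp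
  finally have es: "e \<cdot> s = zmor C X Y" using 1 minus_eq_zmor_iff by simp
  have "e \<cdot> e = e \<ominus>\<^bsub>Hom C Y Y\<^esub> (e \<cdot> (s \<cdot> r))"
    using 1 e idY sr cmp_minus_right[of Y Y Y e "idm C Y" "s \<cdot> r"] idm_right[of Y Y e]
    by (simp flip: e_def)
  also have "e \<cdot> (s \<cdot> r) = zmor C Y Y"
    using 1 e cmp_assoc[of Y X Y Y r s e] es cmp_zmor_left[of Y X Y r] by simp
  finally have "e \<cdot> e = e" using 1 e minus_zmor by simp
  then obtain Z r' s' where 2: "Z \<in> obj C" "r' \<in> mor C Y Z" "s' \<in> mor C Z Y"
    "r' \<cdot> s' = idm C Z" "s' \<cdot> r' = e"
    using assms(1) 1 e unfolding idempotent_complete_def by blast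
  have es': "e \<cdot> s' = s'" using 1 2 cmp_assoc[of Z Y Z Y s' r' s'] idm_right by simp
  have re': "r' \<cdot> e = r'" using 1 2 cmp_assoc[of Y Z Y Z r' s' r'] idm_left by simp
  have "r \<cdot> s' = (r \<cdot> e) \<cdot> s'" using 1 2 e es' cmp_assoc[of Z Y Y X s' e r] by simp
  then have rs': "r \<cdot> s' = zmor C Z X" using re 1 2 cmp_zmor_left[of Z Y X] by simp
  have "r' \<cdot> s = r' \<cdot> (e \<cdot> s)" using 1 2 e re' cmp_assoc[of X Y Y Z s e r'] by simp
  then have r's: "r' \<cdot> s = zmor C X Z" using es 1 2 cmp_zmor_right[of X Y Z] by simp
  have "(s \<cdot> r) \<oplus>\<^bsub>Hom C Y Y\<^esub> e = idm C Y"
    unfolding e_def using sr idY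
    by (simp add: E.minus_eq E.a_comm[of "idm C Y"] E.a_assoc[symmetric] E.r_neg E.l_zero)
  then have "is_biproduct C [X, Z] Y"
    using 1 2 rs' r's by (intro is_biproduct_pairI[of X Z Y s s' r r']) auto
  then show ?thesis by blast
qed

lemma retract_direct_summand: "idempotent_complete C \<Longrightarrow> retract C X Y \<Longrightarrow> direct_summand C X Y"
  unfolding direct_summand_def by (rule retract_complement)

lemma biproduct_zero_isomorphic:
  assumes "is_biproduct C [X, Z] Y" "zero_object C Z"
  shows "isomorphic C X Y"
proof -
  obtain i j p q where 1: "X \<in> obj C" "Z \<in> obj C" "Y \<in> obj C"
    "i \<in> mor C X Y" "j \<in> mor C Z Y" "p \<in> mor C Y X" "q \<in> mor C Y Z"
    "p \<cdot> i = idm C X" "(i \<cdot> p) \<oplus>\<^bsub>Hom C Y Y\<^esub> (j \<cdot> q) = idm C Y"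
    using assms(1) by (rule is_biproduct_pairE) blast
  interpret E: abelian_group "Hom C Y Y" using 1 Hom_group by blast
  have "j = zmor C Z Y" using assms(2) 1 zero_object_orth orthD by blast
  then have "j \<cdot> q = zmor C Y Y" using 1 cmp_zmor_left by simp
  then have "i \<cdot> p = idm C Y" using 1 cmp_closed[of Y X Y i p] by (simp add: E.r_zero)
  then show ?thesis unfolding isomorphic_def is_isomorphism_def using 1 by blast
qed

text \<open>The complement of a non-zero retract must be zero, and a biproduct with a zero object
  changes nothing up to isomorphism.\<close>

lemma indecomposable_retract:
  assumes "idempotent_complete C" "indecomposable C Y" "retract C X Y" "\<not> zero_object C X"
  shows "isomorphic C X Y"
  using retract_complement[OF assms(1,3)] assms(2,4) biproduct_zero_isomorphic
  unfolding indecomposable_def by blast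

lemma biproduct_obj: "is_biproduct C Xs Q \<Longrightarrow> Q \<in> obj C" "is_biproduct C Xs Q \<Longrightarrow> set Xs \<subseteq> obj C"
  unfolding is_biproduct_def by auto

lemma is_biproductE:
  assumes "is_biproduct C Xs Q"
  obtains inj proj where "\<And>i. i < length Xs \<Longrightarrow> inj i \<in> mor C (Xs ! i) Q"
    "\<And>i. i < length Xs \<Longrightarrow> proj i \<in> mor C Q (Xs ! i)"
    "\<And>i. i < length Xs \<Longrightarrow> proj i \<cdot> inj i = idm C (Xs ! i)"
    "\<And>i j. \<lbrakk>i < length Xs; j < length Xs; i \<noteq> j\<rbrakk> \<Longrightarrow> proj i \<cdot> inj j = zmor C (Xs ! j) (Xs ! i)"
    "(\<Oplus>\<^bsub>Hom C Q Q\<^esub>i\<in>{..<length Xs}. inj i \<cdot> proj i) = idm C Q"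
proof -
  obtain inj proj where 1: "\<forall>i<length Xs. inj i \<in> mor C (Xs ! i) Q \<and> proj i \<in> mor C Q (Xs ! i)"
    and 2: "\<forall>i<length Xs. \<forall>j<length Xs. proj i \<cdot> inj j =
      (if i = j then idm C (Xs ! i) else zmor C (Xs ! j) (Xs ! i))"
    and 3: "(\<Oplus>\<^bsub>Hom C Q Q\<^esub>i\<in>{..<length Xs}. inj i \<cdot> proj i) = idm C Q"
    using assms unfolding is_biproduct_def by blast
  show thesis
  proof (rule that[of inj proj])
    show "proj i \<cdot> inj i = idm C (Xs ! i)" if "i < length Xs" for i using 2 that by simp
    show "proj i \<cdot> inj j = zmor C (Xs ! j) (Xs ! i)" if "i < length Xs" "j < length Xs" "i \<noteq> j" for i j
      using 2 that by simp
  qed (use 1 3 in auto)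
qed

lemma biproduct_retract:
  assumes "is_biproduct C Xs Q" "i < length Xs" shows "retract C (Xs ! i) Q"
proof -
  obtain inj proj where 1: "\<And>i. i < length Xs \<Longrightarrow> inj i \<in> mor C (Xs ! i) Q"
    "\<And>i. i < length Xs \<Longrightarrow> proj i \<in> mor C Q (Xs ! i)"
    "\<And>i. i < length Xs \<Longrightarrow> proj i \<cdot> inj i = idm C (Xs ! i)"
    using assms(1) by (rule is_biproductE) blast
  show ?thesis using biproduct_obj[OF assms(1)] assms(2) 1[OF assms(2)]
    by (intro retractI[of _ _ "inj i" "proj i"]) auto
qed

text \<open>Every map out of \<open>Q\<close> is the sum of its composites with the
  \<open>inj i \<cdot> proj i\<close>, each of which passes through one component.\<close>

lemma biproduct_orth_left:
  assumes b: "is_biproduct C Xs Q" and W: "W \<in> obj C" and o: "\<And>X. X \<in> set Xs \<Longrightarrow> orth X W"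
  shows "orth Q W"
proof -
  obtain inj proj where 1: "\<And>i. i < length Xs \<Longrightarrow> inj i \<in> mor C (Xs ! i) Q"
    "\<And>i. i < length Xs \<Longrightarrow> proj i \<in> mor C Q (Xs ! i)"
    "(\<Oplus>\<^bsub>Hom C Q Q\<^esub>i\<in>{..<length Xs}. inj i \<cdot> proj i) = idm C Q"
    using b by (rule is_biproductE) blast
  note Q = biproduct_obj(1)[OF b]
  have ob: "Xs ! i \<in> obj C" if "i < length Xs" for i using biproduct_obj(2)[OF b] that by auto
  interpret H: abelian_group "Hom C Q W" using Q W Hom_group by blast
  show ?thesis
  proof (rule orthI[OF Q W])
    fix f assume f: "f \<in> mor C Q W"
    have z: "f \<cdot> (inj i \<cdot> proj i) = zmor C Q W" if i: "i < length Xs" for i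
    proof -
      have "f \<cdot> inj i = zmor C (Xs ! i) W"
        using orthD[OF o] i 1 f ob Q W cmp_closed[of "Xs ! i" Q W] by auto
      then show ?thesis
        using cmp_assoc[of Q "Xs ! i" Q W "proj i" "inj i" f] i 1 f ob Q W cmp_zmor_left[of Q "Xs ! i" W]
        by simp
    qed
    have "f = f \<cdot> (\<Oplus>\<^bsub>Hom C Q Q\<^esub>i\<in>{..<length Xs}. inj i \<cdot> proj i)" using 1 f Q W idm_right by simp
    also have "\<dots> = (\<Oplus>\<^bsub>Hom C Q W\<^esub>i\<in>{..<length Xs}. f \<cdot> (inj i \<cdot> proj i))"
      using f Q W 1 ob by (intro cmp_finsum_right) (auto intro: cmp_closed[of Q "Xs ! _" Q])
    also have "\<dots> = (\<Oplus>\<^bsub>Hom C Q W\<^esub>i\<in>{..<length Xs}. zmor C Q W)"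
      using z Q W by (intro H.finsum_cong') auto
    also have "\<dots> = zmor C Q W" by simp
    finally show "f = zmor C Q W" .
  qed
qed

text \<open>The map is the sum of the \<open>f i \<cdot> proj i\<close>. The conclusion only records
  that each \<open>f i\<close> lifts through it, which is what an approximation has to
  provide.\<close>

lemma biproduct_copair:
  assumes b: "is_biproduct C Xs Q" and W: "W \<in> obj C"
    and f: "\<And>i. i < length Xs \<Longrightarrow> f i \<in> mor C (Xs ! i) W"
  shows "\<exists>u\<in>mor C Q W. \<forall>i<length Xs. \<exists>v\<in>mor C (Xs ! i) Q. u \<cdot> v = f i"
proof -
  obtain inj proj where 1: "\<And>i. i < length Xs \<Longrightarrow> inj i \<in> mor C (Xs ! i) Q"
    "\<And>i. i < length Xs \<Longrightarrow> proj i \<in> mor C Q (Xs ! i)"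
    "\<And>i. i < length Xs \<Longrightarrow> proj i \<cdot> inj i = idm C (Xs ! i)"
    "\<And>i j. \<lbrakk>i < length Xs; j < length Xs; i \<noteq> j\<rbrakk> \<Longrightarrow> proj i \<cdot> inj j = zmor C (Xs ! j) (Xs ! i)"
    using b by (rule is_biproductE) blast
  note Q = biproduct_obj(1)[OF b]
  have ob: "Xs ! i \<in> obj C" if "i < length Xs" for i using biproduct_obj(2)[OF b] that by auto
  interpret H: abelian_group "Hom C Q W" using Q W Hom_group by blast
  have fp: "f i \<cdot> proj i \<in> mor C Q W" if "i < length Xs" for i
    using that 1 f ob Q W cmp_closed[of Q "Xs ! i" W] by blast
  let ?u = "\<Oplus>\<^bsub>Hom C Q W\<^esub>i\<in>{..<length Xs}. f i \<cdot> proj i"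
  have u: "?u \<in> mor C Q W" using fp by (intro H.finsum_closed) auto
  have "?u \<cdot> inj j = f j" if j: "j < length Xs" for j
  proof -
    interpret J: abelian_group "Hom C (Xs ! j) W" using ob[OF j] W Hom_group by blast
    have t: "(f i \<cdot> proj i) \<cdot> inj j = (if j = i then f j else zmor C (Xs ! j) W)"
      if i: "i < length Xs" for i
    proof -
      have "(f i \<cdot> proj i) \<cdot> inj j = f i \<cdot> (proj i \<cdot> inj j)"
        using cmp_assoc[of "Xs ! j" Q "Xs ! i" W "inj j" "proj i" "f i"] i j 1 f ob Q W by simp
      then show ?thesis using i j 1 f ob W idm_right cmp_zmor_right[of "Xs ! j" "Xs ! i" W] by auto
    qed
    have "?u \<cdot> inj j = (\<Oplus>\<^bsub>Hom C (Xs ! j) W\<^esub>i\<in>{..<length Xs}. (f i \<cdot> proj i) \<cdot> inj j)"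
      using fp j 1 ob Q W by (intro cmp_finsum_left) auto
    also have "\<dots> = (\<Oplus>\<^bsub>Hom C (Xs ! j) W\<^esub>i\<in>{..<length Xs}. if j = i then f j else zmor C (Xs ! j) W)"
      using t f[OF j] ob[OF j] W by (intro J.finsum_cong') auto
    also have "\<dots> = f j" using j f[OF j] J.finsum_singleton[of j "{..<length Xs}" "\<lambda>_. f j"] by auto
    finally show ?thesis .
  qed
  then show ?thesis using u 1 by blast
qed

text \<open>Serves to replace the indecomposable summands of an object by chosen representatives
  while keeping the object itself.\<close>

lemma biproduct_isomorphic:
  assumes b: "is_biproduct C Xs Q" and l: "length Ys = length Xs"
    and iso: "\<And>i. i < length Xs \<Longrightarrow> isomorphic C (Xs ! i) (Ys ! i)"
  shows "is_biproduct C Ys Q"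
proof -
  obtain inj proj where 1: "\<And>i. i < length Xs \<Longrightarrow> inj i \<in> mor C (Xs ! i) Q"
    "\<And>i. i < length Xs \<Longrightarrow> proj i \<in> mor C Q (Xs ! i)"
    "\<And>i. i < length Xs \<Longrightarrow> proj i \<cdot> inj i = idm C (Xs ! i)"
    "\<And>i j. \<lbrakk>i < length Xs; j < length Xs; i \<noteq> j\<rbrakk> \<Longrightarrow> proj i \<cdot> inj j = zmor C (Xs ! j) (Xs ! i)"
    "(\<Oplus>\<^bsub>Hom C Q Q\<^esub>i\<in>{..<length Xs}. inj i \<cdot> proj i) = idm C Q"
    using b by (rule is_biproductE) blast
  note Q = biproduct_obj(1)[OF b]
  have ob: "Xs ! i \<in> obj C" if "i < length Xs" for i using biproduct_obj(2)[OF b] that by auto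
  have ob': "Ys ! i \<in> obj C" if "i < length Xs" for i
    using iso[OF that] unfolding isomorphic_def is_isomorphism_def by blast
  have "\<forall>i. \<exists>a a'. i < length Xs \<longrightarrow> a \<in> mor C (Xs ! i) (Ys ! i) \<and> a' \<in> mor C (Ys ! i) (Xs ! i) \<and>
      a' \<cdot> a = idm C (Xs ! i) \<and> a \<cdot> a' = idm C (Ys ! i)"
    using iso unfolding isomorphic_def is_isomorphism_def by blast
  then obtain a a' where a: "\<And>i. i < length Xs \<Longrightarrow> a i \<in> mor C (Xs ! i) (Ys ! i)"
    "\<And>i. i < length Xs \<Longrightarrow> a' i \<in> mor C (Ys ! i) (Xs ! i)"
    "\<And>i. i < length Xs \<Longrightarrow> a' i \<cdot> a i = idm C (Xs ! i)"
    "\<And>i. i < length Xs \<Longrightarrow> a i \<cdot> a' i = idm C (Ys ! i)"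
    by metis
  define inj' where "inj' i = inj i \<cdot> a' i" for i
  define proj' where "proj' i = a i \<cdot> proj i" for i
  have c1: "inj' i \<in> mor C (Ys ! i) Q" if "i < length Xs" for i
    unfolding inj'_def by (rule cmp_closed[OF ob'[OF that] ob[OF that] Q 1(1)[OF that] a(2)[OF that]])
  have c2: "proj' i \<in> mor C Q (Ys ! i)" if "i < length Xs" for i
    unfolding proj'_def by (rule cmp_closed[OF Q ob[OF that] ob'[OF that] a(1)[OF that] 1(2)[OF that]])
  have comp: "proj' i \<cdot> inj' j = a i \<cdot> ((proj i \<cdot> inj j) \<cdot> a' j)"
    if ij: "i < length Xs" "j < length Xs" for i j
    using cmp_assoc[OF ob'[OF ij(2)] Q ob[OF ij(1)] ob'[OF ij(1)] c1[OF ij(2)] 1(2)[OF ij(1)] a(1)[OF ij(1)]]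
      cmp_assoc[OF ob'[OF ij(2)] ob[OF ij(2)] Q ob[OF ij(1)] a(2)[OF ij(2)] 1(1)[OF ij(2)] 1(2)[OF ij(1)]]
    unfolding proj'_def inj'_def by simp
  have 2: "proj' i \<cdot> inj' j = (if i = j then idm C (Ys ! i) else zmor C (Ys ! j) (Ys ! i))"
    if ij: "i < length Xs" "j < length Xs" for i j
  proof (cases "i = j")
    case True
    then show ?thesis
      unfolding comp[OF ij] using 1(3)[OF ij(1)] a(4)[OF ij(1)]
        idm_left[OF ob'[OF ij(1)] ob[OF ij(1)] a(2)[OF ij(1)]] by simp
  next
    case False
    then show ?thesis
      unfolding comp[OF ij] 1(4)[OF ij False]
      using cmp_zmor_left[OF ob'[OF ij(2)] ob[OF ij(2)] ob[OF ij(1)] a(2)[OF ij(2)]]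
        cmp_zmor_right[OF ob'[OF ij(2)] ob[OF ij(1)] ob'[OF ij(1)] a(1)[OF ij(1)]] by simp
  qed
  have 3: "inj' i \<cdot> proj' i = inj i \<cdot> proj i" if i: "i < length Xs" for i
    using cmp_assoc[OF Q ob'[OF i] ob[OF i] Q c2[OF i] a(2)[OF i] 1(1)[OF i]]
      cmp_assoc[OF Q ob[OF i] ob'[OF i] ob[OF i] 1(2)[OF i] a(1)[OF i] a(2)[OF i]]
      a(3)[OF i] idm_left[OF Q ob[OF i] 1(2)[OF i]]
    unfolding proj'_def inj'_def by simp
  interpret E: abelian_group "Hom C Q Q" using Q Hom_group by blast
  have ip: "inj i \<cdot> proj i \<in> mor C Q Q" if "i < length Xs" for i
    by (rule cmp_closed[OF Q ob[OF that] Q 1(1)[OF that] 1(2)[OF that]])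
  have "(\<Oplus>\<^bsub>Hom C Q Q\<^esub>i\<in>{..<length Ys}. inj' i \<cdot> proj' i) = (\<Oplus>\<^bsub>Hom C Q Q\<^esub>i\<in>{..<length Xs}. inj i \<cdot> proj i)"
    unfolding l using 3 ip by (intro E.finsum_cong') auto
  then have 4: "(\<Oplus>\<^bsub>Hom C Q Q\<^esub>i\<in>{..<length Ys}. inj' i \<cdot> proj' i) = idm C Q" using 1 by simp
  have "set Ys \<subseteq> obj C" using ob' l by (auto simp: in_set_conv_nth)
  then show ?thesis unfolding is_biproduct_def l
    using Q c1 c2 2 4 unfolding l by (intro conjI exI[of _ inj'] exI[of _ proj']) auto
qed

text \<open>Finite spanning sets of the spaces \<open>Hom(Xs ! i, W)\<close>, composed with the
  projections, together span \<open>Hom(Q, W)\<close>.\<close>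

lemma biproduct_fin_dim:
  assumes b: "is_biproduct C Xs Q" and W: "W \<in> obj C"
    and fd: "\<And>X. X \<in> set Xs \<Longrightarrow> vectorspace.fin_dim K (Hom C X W)"
  shows "vectorspace.fin_dim K (Hom C Q W)"
proof -
  obtain inj proj where 1: "\<And>i. i < length Xs \<Longrightarrow> inj i \<in> mor C (Xs ! i) Q"
    "\<And>i. i < length Xs \<Longrightarrow> proj i \<in> mor C Q (Xs ! i)"
    "(\<Oplus>\<^bsub>Hom C Q Q\<^esub>i\<in>{..<length Xs}. inj i \<cdot> proj i) = idm C Q"
    using b by (rule is_biproductE) blast
  note Q = biproduct_obj(1)[OF b]
  have ob: "Xs ! i \<in> obj C" if "i < length Xs" for i using biproduct_obj(2)[OF b] that by auto
  interpret H: vectorspace K "Hom C Q W" using Q W Hom_vectorspace by blast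
  have "\<exists>B. finite B \<and> B \<subseteq> mor C (Xs ! i) W \<and> module.span K (Hom C (Xs ! i) W) B = mor C (Xs ! i) W"
    if "i < length Xs" for i
    using fd[of "Xs ! i"] that vectorspace.fin_dim_def[OF Hom_vectorspace[OF ob[OF that] W]] by auto
  then obtain B where B: "\<And>i. i < length Xs \<Longrightarrow> finite (B i)"
    "\<And>i. i < length Xs \<Longrightarrow> B i \<subseteq> mor C (Xs ! i) W"
    "\<And>i. i < length Xs \<Longrightarrow> module.span K (Hom C (Xs ! i) W) (B i) = mor C (Xs ! i) W"
    by metis
  define G where "G = (\<Union>i\<in>{..<length Xs}. (\<lambda>g. g \<cdot> proj i) ` B i)"
  have G: "finite G" "G \<subseteq> mor C Q W"
    unfolding G_def using B 1 ob Q W by (auto intro!: cmp_closed[of Q "Xs ! _" W])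
  have sub: "submodule K (H.span G) (Hom C Q W)" using G H.span_is_subspace H.is_module by blast
  have "f \<in> H.span G" if f: "f \<in> mor C Q W" for f
  proof -
    have s: "f \<cdot> (inj i \<cdot> proj i) \<in> H.span G" if i: "i < length Xs" for i
    proof -
      interpret L: linear_map K "Hom C (Xs ! i) W" "Hom C Q W" "\<lambda>g. g \<cdot> proj i"
        using cmp_linear_left i ob Q W 1 by blast
      have fi: "f \<cdot> inj i \<in> mor C (Xs ! i) W" using cmp_closed f i ob Q W 1 by blast
      have "(f \<cdot> inj i) \<cdot> proj i \<in> H.span ((\<lambda>g. g \<cdot> proj i) ` B i)"
        using L.map_span[OF B(2)[OF i]] fi B(3)[OF i] by simp
      moreover have "H.span ((\<lambda>g. g \<cdot> proj i) ` B i) \<subseteq> H.span G"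
        using i G by (intro H.span_is_monotone) (auto simp: G_def)
      ultimately show ?thesis
        using cmp_assoc[of Q "Xs ! i" Q W "proj i" "inj i" f] i ob Q W 1 f by auto
    qed
    have fs: "finsum (Hom C Q W) h A \<in> H.span G"
      if "finite A" "h \<in> A \<rightarrow> H.span G" for A :: "nat set" and h
      using that
    proof (induction A rule: finite_induct)
      case empty then show ?case using submodule.zero_closed[OF sub] by simp
    next
      case (insert x A)
      have "H.span G \<subseteq> mor C Q W" using sub by (rule submodule.subset)
      then show ?case using insert submodule.m_closed[OF sub]
        by (subst H.finsum_insert) (auto simp: Pi_iff)
    qed
    have "f = f \<cdot> (\<Oplus>\<^bsub>Hom C Q Q\<^esub>i\<in>{..<length Xs}. inj i \<cdot> proj i)" using 1 f Q W idm_right by simp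
    also have "\<dots> = (\<Oplus>\<^bsub>Hom C Q W\<^esub>i\<in>{..<length Xs}. f \<cdot> (inj i \<cdot> proj i))"
      using f Q W 1 ob by (intro cmp_finsum_right) (auto intro: cmp_closed[of Q "Xs ! _" Q])
    also have "\<dots> \<in> H.span G" using s by (intro fs) auto
    finally show ?thesis .
  qed
  then have "H.span G = mor C Q W" using submodule.subset[OF sub] by auto
  then show ?thesis unfolding H.fin_dim_def using G by auto
qed

text \<open>The two idempotents of a decomposition add up to the identity, so one of them is a unit.
  A unit idempotent is the identity, and then the other summand is zero.\<close>

lemma local_indecomposable:
  assumes X: "X \<in> obj C" and l: "local_ring (End_ring C X)"
  shows "indecomposable C X"
proof -
  have id0: "idm C X \<noteq> zmor C X X" using l unfolding local_ring_def by simp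
  \<comment> \<open>Phrased with all the structure maps as parameters so that it applies again with
    the two summands interchanged.\<close>
  have sym: "zero_object C Z" if b: "is_biproduct C [Y, Z] X" "i \<in> mor C Y X" "p \<in> mor C X Y"
      "j \<in> mor C Z X" "q \<in> mor C X Z" "p \<cdot> i = idm C Y" "q \<cdot> j = idm C Z"
      "p \<cdot> j = zmor C Z Y" "q \<cdot> i = zmor C Y Z" "Y \<in> obj C" "Z \<in> obj C"
      and u: "i \<cdot> p \<in> Units (End_ring C X)" for Y Z i j p q
  proof -
    obtain v where v: "v \<in> mor C X X" "v \<cdot> (i \<cdot> p) = idm C X"
      using u unfolding Units_def by auto
    have ip: "i \<cdot> p \<in> mor C X X" using b X cmp_closed by blast
    have "(i \<cdot> p) \<cdot> (i \<cdot> p) = i \<cdot> (p \<cdot> (i \<cdot> p))"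
      using cmp_assoc[of X X Y X "i \<cdot> p" p i] b X ip by simp
    also have "p \<cdot> (i \<cdot> p) = p" using cmp_assoc[of X Y X Y p i p] b X idm_left by simp
    finally have ee: "(i \<cdot> p) \<cdot> (i \<cdot> p) = i \<cdot> p" .
    have "i \<cdot> p = (v \<cdot> (i \<cdot> p)) \<cdot> (i \<cdot> p)" using v ip X idm_left by simp
    also have "\<dots> = v \<cdot> ((i \<cdot> p) \<cdot> (i \<cdot> p))" using cmp_assoc[of X X X X] v ip X by simp
    finally have "i \<cdot> p = idm C X" using ee v by simp
    then have "j = (i \<cdot> p) \<cdot> j" using b X idm_left by simp
    also have "\<dots> = i \<cdot> (p \<cdot> j)" using cmp_assoc[of Z X Y X j p i] b X by simp
    also have "\<dots> = zmor C Z X" using b X cmp_zmor_right by simp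
    finally have "idm C Z = zmor C Z Z" using b X cmp_zmor_right[of Z X Z q] by simp
    then show ?thesis using zero_objectI b by blast
  qed
  have "zero_object C Y \<or> zero_object C Z" if b: "is_biproduct C [Y, Z] X" for Y Z
  proof -
    obtain i j p q where 1: "Y \<in> obj C" "Z \<in> obj C" "X \<in> obj C"
      "i \<in> mor C Y X" "j \<in> mor C Z X" "p \<in> mor C X Y" "q \<in> mor C X Z"
      "p \<cdot> i = idm C Y" "q \<cdot> j = idm C Z" "p \<cdot> j = zmor C Z Y" "q \<cdot> i = zmor C Y Z"
      "(i \<cdot> p) \<oplus>\<^bsub>Hom C X X\<^esub> (j \<cdot> q) = idm C X"
      using b by (rule is_biproduct_pairE)
    interpret H: abelian_group "Hom C X X" using X Hom_group by blast
    have c: "i \<cdot> p \<in> mor C X X" "j \<cdot> q \<in> mor C X X" using 1 cmp_closed by blast+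
    have b': "is_biproduct C [Z, Y] X"
      using 1 c by (intro is_biproduct_pairI[of Z Y X j i q p]) (auto simp: H.a_comm)
    have "idm C X \<in> Units (End_ring C X)"
      unfolding Units_def using X idm_closed idm_left[of X X "idm C X"] by auto
    then have "i \<cdot> p \<in> Units (End_ring C X) \<or> j \<cdot> q \<in> Units (End_ring C X)"
      using l c 1(12) unfolding local_ring_def by (metis DiffI End_ring_simps(1,3))
    then show ?thesis using sym[OF b] sym[OF b'] 1 by blast
  qed
  then show ?thesis unfolding indecomposable_def using X id0 zero_object_idm by blast
qed

text \<open>The identity of \<open>Y\<close> is a sum of endomorphisms, one through each component
  of \<open>Q\<close>. Locality makes one of them a unit, and its inverse turns the passage through
  that component into a splitting.\<close>

lemma local_retract_biproduct:
  assumes l: "local_ring (End_ring C Y)" and r: "retract C Y Q" and b: "is_biproduct C Xs Q"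
  shows "\<exists>X\<in>set Xs. retract C Y X"
proof -
  obtain s r where 1: "Y \<in> obj C" "Q \<in> obj C" "s \<in> mor C Y Q" "r \<in> mor C Q Y" "r \<cdot> s = idm C Y"
    using r by (rule retractE)
  obtain inj proj where 2: "\<And>i. i < length Xs \<Longrightarrow> inj i \<in> mor C (Xs ! i) Q"
    "\<And>i. i < length Xs \<Longrightarrow> proj i \<in> mor C Q (Xs ! i)"
    "(\<Oplus>\<^bsub>Hom C Q Q\<^esub>i\<in>{..<length Xs}. inj i \<cdot> proj i) = idm C Q"
    using b by (rule is_biproductE) blast
  have ob: "Xs ! i \<in> obj C" if "i < length Xs" for i using biproduct_obj(2)[OF b] that by auto
  have c: "inj i \<cdot> proj i \<in> mor C Q Q" "r \<cdot> (inj i \<cdot> proj i) \<in> mor C Q Y"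
    "(r \<cdot> (inj i \<cdot> proj i)) \<cdot> s \<in> mor C Y Y" if "i < length Xs" for i
    using that 1 2 ob cmp_closed[of Q "Xs ! i" Q] cmp_closed[of Q Q Y] cmp_closed[of Y Q Y] by auto
  have "idm C Y = (r \<cdot> (\<Oplus>\<^bsub>Hom C Q Q\<^esub>i\<in>{..<length Xs}. inj i \<cdot> proj i)) \<cdot> s"
    using 1 2 idm_right by simp
  also have "r \<cdot> (\<Oplus>\<^bsub>Hom C Q Q\<^esub>i\<in>{..<length Xs}. inj i \<cdot> proj i)
      = (\<Oplus>\<^bsub>Hom C Q Y\<^esub>i\<in>{..<length Xs}. r \<cdot> (inj i \<cdot> proj i))"
    using 1 c by (intro cmp_finsum_right) auto
  also have "\<dots> \<cdot> s = (\<Oplus>\<^bsub>Hom C Y Y\<^esub>i\<in>{..<length Xs}. (r \<cdot> (inj i \<cdot> proj i)) \<cdot> s)"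
    using 1 c by (intro cmp_finsum_left) auto
  finally have "finsum (End_ring C Y) (\<lambda>i. (r \<cdot> (inj i \<cdot> proj i)) \<cdot> s) {..<length Xs} = idm C Y"
    by (simp add: finsum_End_ring)
  moreover have "idm C Y \<in> Units (End_ring C Y)"
    unfolding Units_def using 1 idm_closed idm_left[of Y Y "idm C Y"] by auto
  ultimately obtain i where i: "i < length Xs" "(r \<cdot> (inj i \<cdot> proj i)) \<cdot> s \<in> Units (End_ring C Y)"
    using local_ring_finsum_Units[OF l, of "{..<length Xs}" "\<lambda>i. (r \<cdot> (inj i \<cdot> proj i)) \<cdot> s"] c by auto
  then obtain v where v: "v \<in> mor C Y Y" "v \<cdot> ((r \<cdot> (inj i \<cdot> proj i)) \<cdot> s) = idm C Y"
    unfolding Units_def by auto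
  note I = i(1) 2(1)[OF i(1)] 2(2)[OF i(1)] ob[OF i(1)]
  have ri: "r \<cdot> inj i \<in> mor C (Xs ! i) Y" "proj i \<cdot> s \<in> mor C Y (Xs ! i)"
    using I 1 cmp_closed by blast+
  have "(r \<cdot> (inj i \<cdot> proj i)) \<cdot> s = ((r \<cdot> inj i) \<cdot> proj i) \<cdot> s"
    using cmp_assoc[of Q "Xs ! i" Q Y "proj i" "inj i" r] I 1 by simp
  also have "\<dots> = (r \<cdot> inj i) \<cdot> (proj i \<cdot> s)"
    using cmp_assoc[of Y Q "Xs ! i" Y s "proj i" "r \<cdot> inj i"] I 1 ri by simp
  finally have "(v \<cdot> (r \<cdot> inj i)) \<cdot> (proj i \<cdot> s) = idm C Y"
    using v cmp_assoc[of Y "Xs ! i" Y Y "proj i \<cdot> s" "r \<cdot> inj i" v] I 1 ri by simp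
  then have "retract C Y (Xs ! i)"
    using I 1 ri v by (intro retractI[of _ _ "proj i \<cdot> s" "v \<cdot> (r \<cdot> inj i)"] cmp_closed) auto
  then show ?thesis using i by auto
qed

end

section \<open>Triangulated categories\<close>

context triangulated_category
begin

lemma sh_obj: "X \<in> obj T \<Longrightarrow> sh T X \<in> obj T"
  using sh_bij by (rule bij_betw_apply)

lemma inv_sh:
  assumes "X \<in> obj T"
  shows "inv_into (obj T) (sh T) X \<in> obj T" "sh T (inv_into (obj T) (sh T) X) = X"
    "inv_into (obj T) (sh T) (sh T X) = X"
proof -
  have "X \<in> sh T ` obj T" using sh_bij assms by (simp add: bij_betw_def)
  then show "inv_into (obj T) (sh T) X \<in> obj T" "sh T (inv_into (obj T) (sh T) X) = X"
    by (rule inv_into_into, rule f_inv_into_f)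
  show "inv_into (obj T) (sh T) (sh T X) = X"
    using sh_bij assms by (simp add: bij_betw_def)
qed

lemma shift_0 [simp]: "shift T 0 X = X"
  by (simp add: shift_def)

lemma shift_1: "shift T 1 X = sh T X"
  by (simp add: shift_def)

lemma shift_obj [simp]:
  assumes "X \<in> obj T" shows "shift T n X \<in> obj T"
proof -
  have "(sh T ^^ k) X \<in> obj T" "(inv_into (obj T) (sh T) ^^ k) X \<in> obj T" for k
    by (induction k) (use assms in \<open>auto intro: sh_obj inv_sh\<close>)
  then show ?thesis by (simp add: shift_def)
qed

lemma sh_shift:
  assumes X: "X \<in> obj T" shows "sh T (shift T n X) = shift T (n + 1) X"
proof (cases "0 \<le> n")
  case True
  then have "nat (n + 1) = Suc (nat n)" by simp
  then show ?thesis using True by (simp add: shift_def)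
next
  case False
  define k where "k = nat (- n) - 1"
  have k: "nat (- n) = Suc k" "nat (- (n + 1)) = k" using False by (auto simp: k_def)
  have "(inv_into (obj T) (sh T) ^^ k) X \<in> obj T"
    by (induction k) (use X in \<open>auto intro: inv_sh\<close>)
  then have "sh T (shift T n X) = (inv_into (obj T) (sh T) ^^ k) X"
    using False k by (simp add: shift_def inv_sh)
  also have "\<dots> = shift T (n + 1) X"
    using False k by (cases "n = -1") (auto simp: shift_def k_def)
  finally show ?thesis .
qed

lemma shift_diff_1:
  assumes "X \<in> obj T" shows "shift T (n - 1) X = inv_into (obj T) (sh T) (shift T n X)"
  using sh_shift[OF assms, of "n - 1"] inv_sh(3)[OF shift_obj[OF assms], of "n - 1"] by simp

lemma shift_shift [simp]:
  assumes X: "X \<in> obj T" shows "shift T m (shift T n X) = shift T (m + n) X"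
proof (induction m rule: int_induct[where k = 0])
  case base then show ?case by simp
next
  case (step1 i)
  then show ?case using sh_shift[OF shift_obj[OF X], of i n] sh_shift[OF X, of "i + n"]
    by (simp add: ac_simps)
next
  case (step2 i)
  then show ?case using shift_diff_1[OF shift_obj[OF X], of i n] shift_diff_1[OF X, of "i + n"]
    by (simp add: algebra_simps)
qed

text \<open>Turns images under the shift into conditions on the object shifted back, so that the
  classes \<open>t_le\<close> and \<open>t_ge\<close> can be handled by index arithmetic.\<close>

lemma shift_set_iff:
  assumes "S \<subseteq> obj T" shows "X \<in> shift_set T n S \<longleftrightarrow> X \<in> obj T \<and> shift T (- n) X \<in> S"
proof
  assume "X \<in> shift_set T n S"
  then obtain Y where "Y \<in> S" "X = shift T n Y" by auto
  then show "X \<in> obj T \<and> shift T (- n) X \<in> S" using assms by auto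
next
  assume "X \<in> obj T \<and> shift T (- n) X \<in> S"
  then have "X = shift T n (shift T (- n) X)" "shift T (- n) X \<in> S" by auto
  then show "X \<in> shift_set T n S" by blast
qed

lemma shm_zmor: "\<lbrakk>X \<in> obj T; Y \<in> obj T\<rbrakk> \<Longrightarrow> shm T (zmor T X Y) = zmor T (sh T X) (sh T Y)"
proof -
  assume "X \<in> obj T" "Y \<in> obj T"
  then interpret linear_map K "Hom T X Y" "Hom T (sh T X) (sh T Y)" "shm T" by (rule shm_linear)
  show ?thesis by simp
qed

lemma shm_closed: "\<lbrakk>X \<in> obj T; Y \<in> obj T; f \<in> mor T X Y\<rbrakk> \<Longrightarrow> shm T f \<in> mor T (sh T X) (sh T Y)"
  using bij_betw_apply[OF shm_bij] by blast

lemma shm_eq_iff: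
  "\<lbrakk>X \<in> obj T; Y \<in> obj T; f \<in> mor T X Y; g \<in> mor T X Y\<rbrakk> \<Longrightarrow> shm T f = shm T g \<longleftrightarrow> f = g"
  using shm_bij[of X Y] by (auto simp: bij_betw_def inj_on_def)

lemma shm_surj:
  "\<lbrakk>X \<in> obj T; Y \<in> obj T; f \<in> mor T (sh T X) (sh T Y)\<rbrakk> \<Longrightarrow> \<exists>g\<in>mor T X Y. shm T g = f"
  using shm_bij[of X Y] unfolding bij_betw_def by (metis imageE)

lemma orth_sh_iff:
  assumes "X \<in> obj T" "Y \<in> obj T" shows "orth (sh T X) (sh T Y) \<longleftrightarrow> orth X Y"
proof
  assume a: "orth (sh T X) (sh T Y)"
  show "orth X Y"
  proof (rule orthI[OF assms])
    fix f assume f: "f \<in> mor T X Y"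
    then have "shm T f = shm T (zmor T X Y)"
      using orthD[OF a shm_closed[OF assms f]] shm_zmor assms by simp
    then show "f = zmor T X Y" using shm_eq_iff f assms by simp
  qed
next
  assume a: "orth X Y"
  show "orth (sh T X) (sh T Y)"
  proof (rule orthI)
    fix f assume "f \<in> mor T (sh T X) (sh T Y)"
    then obtain g where "g \<in> mor T X Y" "shm T g = f" using shm_surj assms by blast
    then show "f = zmor T (sh T X) (sh T Y)" using orthD[OF a] shm_zmor assms by auto
  qed (use assms sh_obj in auto)
qed

lemma orth_shift_iff:
  assumes "X \<in> obj T" "Y \<in> obj T" shows "orth (shift T n X) (shift T n Y) \<longleftrightarrow> orth X Y"
proof (induction n rule: int_induct[where k = 0])
  case base then show ?case by simp
next
  case (step1 i)
  then show ?case using orth_sh_iff[of "shift T i X" "shift T i Y"] assms by (simp add: sh_shift)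
next
  case (step2 i)
  then show ?case using orth_sh_iff[of "shift T (i - 1) X" "shift T (i - 1) Y"] assms
    by (simp add: sh_shift)
qed

lemma orth_shift_left:
  assumes "X \<in> obj T" "Y \<in> obj T" shows "orth (shift T n X) Y \<longleftrightarrow> orth X (shift T (- n) Y)"
  using orth_shift_iff[of X "shift T (- n) Y" n] assms by simp

lemma zero_object_shift: "zero_object T X \<Longrightarrow> zero_object T (shift T n X)"
  using zero_object_iff_orth orth_shift_iff zero_object_obj shift_obj by blast

lemma zero_exists: "\<exists>Z. zero_object T Z"
proof -
  obtain Z where Z: "is_biproduct T [] Z"
    using additive unfolding additive_category_def by (metis empty_subsetI list.set(1))
  then have z: "Z \<in> obj T" unfolding is_biproduct_def by auto
  then interpret H: abelian_group "Hom T Z Z" using Hom_group by blast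
  have "idm T Z = zmor T Z Z" using Z unfolding is_biproduct_def by simp
  then show ?thesis using zero_objectI z by blast
qed

text \<open>Most arguments only need that three objects fit into a triangle. Hiding the maps allows
  rotating and shifting without any bookkeeping of signs.\<close>

definition triangle
  where "triangle X Y Z \<longleftrightarrow> (\<exists>f g h. (X, Y, Z, f, g, h) \<in> tri T)"

lemma tri_rotate_fwd:
  "(X, Y, Z, f, g, h) \<in> tri T
    \<Longrightarrow> (Y, Z, sh T X, g, h, \<ominus>\<^bsub>Hom T (sh T X) (sh T Y)\<^esub> shm T f) \<in> tri T"
  using tri_typed tri_rotate by blast

text \<open>The new first map is the preimage of \<open>- h\<close> under the shift: rotating
  forward negates it again, so \<open>f\<close> and \<open>g\<close> keep their signs.\<close>

lemma tri_rotate_back: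
  assumes "(X, Y, Z, f, g, h) \<in> tri T"
  shows "\<exists>k. (shift T (- 1) Z, X, Y, k, f, g) \<in> tri T"
proof -
  define W where "W = shift T (- 1) Z"
  note t = tri_typed[OF assms]
  have W: "W \<in> obj T" "sh T W = Z" using t sh_shift[of Z "- 1"] by (simp_all add: W_def)
  have sX: "sh T X \<in> obj T" using t sh_obj by blast
  interpret H: abelian_group "Hom T Z (sh T X)" using t sX Hom_group by blast
  have "\<ominus>\<^bsub>Hom T Z (sh T X)\<^esub> h \<in> mor T (sh T W) (sh T X)" using t W by simp
  then obtain k where k: "k \<in> mor T W X" "shm T k = \<ominus>\<^bsub>Hom T Z (sh T X)\<^esub> h"
    using shm_surj W t by blast
  then have "\<ominus>\<^bsub>Hom T (sh T W) (sh T X)\<^esub> shm T k = h" using W t by simp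
  then have "(W, X, Y, k, f, g) \<in> tri T"
    using tri_rotate[of W X Y k f g] W t k assms by simp
  then show ?thesis unfolding W_def by blast
qed

lemma tri_zero_id:
  assumes W: "W \<in> obj T" and Z: "zero_object T Z"
  shows "(Z, W, W, zmor T Z W, idm T W, zmor T W (sh T Z)) \<in> tri T"
proof -
  have z: "Z \<in> obj T" "sh T Z \<in> obj T" using zero_object_obj[OF Z] sh_obj by auto
  have sz: "zero_object T (sh T Z)" using zero_object_shift[OF Z, of 1] by (simp add: shift_1)
  interpret H: abelian_group "Hom T (sh T Z) (sh T W)" using z W sh_obj Hom_group by blast
  have "(W, W, sh T Z, idm T W, zmor T W (sh T Z), zmor T (sh T Z) (sh T W)) \<in> tri T"
    using tri_idm[OF W sz] .
  moreover have "\<ominus>\<^bsub>Hom T (sh T Z) (sh T W)\<^esub> shm T (zmor T Z W) = zmor T (sh T Z) (sh T W)"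
    using shm_zmor z W by simp
  ultimately show ?thesis
    using tri_rotate[of Z W W "zmor T Z W" "idm T W" "zmor T W (sh T Z)"] z W idm_closed by simp
qed

text \<open>Comparison with the identity triangle of \<open>X\<close> makes
  \<open>g \<cdot> f\<close> factor through a zero object.\<close>

lemma tri_comp_zero:
  assumes "(X, Y, Z, f, g, h) \<in> tri T" shows "g \<cdot> f = zmor T X Z"
proof -
  note t = tri_typed[OF assms]
  obtain N where N: "zero_object T N" using zero_exists by blast
  note n = zero_object_obj[OF N]
  have "(X, X, N, idm T X, zmor T X N, zmor T N (sh T X)) \<in> tri T" using tri_idm t N by blast
  then obtain c where c: "c \<in> mor T N Z" "c \<cdot> zmor T X N = g \<cdot> f"
    using tri_morphism[OF _ assms, of X X N "idm T X" "zmor T X N" "zmor T N (sh T X)" "idm T X" f]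
      t idm_closed by auto
  then show ?thesis using cmp_zmor_right[of X N Z c] t n by simp
qed

text \<open>Exactness of \<open>Hom(-, W)\<close> at \<open>Y\<close>: the map \<open>u\<close>
  extends to a morphism into the triangle \<open>0 -> W -> W\<close>, and the third component is the
  factor.\<close>

lemma tri_factor_right:
  assumes "(X, Y, Z, f, g, h) \<in> tri T" and W: "W \<in> obj T" and u: "u \<in> mor T Y W" "u \<cdot> f = zmor T X W"
  shows "\<exists>v\<in>mor T Z W. v \<cdot> g = u"
proof -
  note t = tri_typed[OF assms(1)]
  obtain N where N: "zero_object T N" using zero_exists by blast
  note n = zero_object_obj[OF N]
  have "u \<cdot> f = zmor T N W \<cdot> zmor T X N" using u t n W cmp_zmor_right by simp
  then obtain c where "c \<in> mor T Z W" "c \<cdot> g = idm T W \<cdot> u"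
    using tri_morphism[OF assms(1) tri_zero_id[OF W N], of "zmor T X N" u] t n u zmor_closed by blast
  then show ?thesis using idm_left t W u by auto
qed

text \<open>Exactness of \<open>Hom(W, -)\<close> at \<open>Y\<close>. The morphism axiom is applied
  from \<open>W -> 0 -> W[1]\<close> to the rotated triangle \<open>Y -> Z -> X[1]\<close>; its
  third component is the shift of the wanted map, and the signs of the two rotations cancel.\<close>

lemma tri_factor_left:
  assumes tr: "(X, Y, Z, f, g, h) \<in> tri T" and W: "W \<in> obj T" and u: "u \<in> mor T W Y" "g \<cdot> u = zmor T W Z"
  shows "\<exists>v\<in>mor T W X. f \<cdot> v = u"
proof -
  note t = tri_typed[OF tr]
  obtain N where N: "zero_object T N" using zero_exists by blast
  note n = zero_object_obj[OF N]
  have so: "sh T W \<in> obj T" "sh T X \<in> obj T" "sh T Y \<in> obj T" using t W sh_obj by auto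
  have 1: "(W, N, sh T W, zmor T W N, zmor T N (sh T W),
      \<ominus>\<^bsub>Hom T (sh T W) (sh T W)\<^esub> shm T (idm T W)) \<in> tri T"
    using tri_rotate_fwd[OF tri_idm[OF W N]] .
  have "zmor T N Z \<cdot> zmor T W N = g \<cdot> u" using u t n W cmp_zmor_right[of W N Z] by simp
  then obtain c where c: "c \<in> mor T (sh T W) (sh T X)"
    and eq: "shm T u \<cdot> (\<ominus>\<^bsub>Hom T (sh T W) (sh T W)\<^esub> shm T (idm T W))
      = (\<ominus>\<^bsub>Hom T (sh T X) (sh T Y)\<^esub> shm T f) \<cdot> c"
    using tri_morphism[OF 1 tri_rotate_fwd[OF tr], of u "zmor T N Z"] t n u zmor_closed by blast
  obtain v where v: "v \<in> mor T W X" "shm T v = c" using shm_surj c W t by blast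
  have su: "shm T u \<in> mor T (sh T W) (sh T Y)" "shm T f \<in> mor T (sh T X) (sh T Y)"
    using shm_closed u W t by auto
  interpret H: abelian_group "Hom T (sh T W) (sh T Y)" using so Hom_group by blast
  have "\<ominus>\<^bsub>Hom T (sh T W) (sh T Y)\<^esub> shm T u = \<ominus>\<^bsub>Hom T (sh T W) (sh T Y)\<^esub> (shm T f \<cdot> c)"
    using eq W t u so su c
    by (simp add: shm_idm cmp_neg_right[of _ "sh T W"] cmp_neg_left[of _ "sh T X"] idm_closed idm_right)
  then have "shm T u = shm T f \<cdot> c"
    using su c so cmp_closed[of "sh T W" "sh T X" "sh T Y"] H.minus_minus by metis
  then have "shm T u = shm T (f \<cdot> v)" using v W t shm_cmp[of W X Y v f] by simp
  then have "u = f \<cdot> v" using shm_eq_iff W t u v cmp_closed[of W X Y] by blast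
  then show ?thesis using v by blast
qed

lemma triangleE:
  assumes "triangle X Y Z"
  obtains f g h where "(X, Y, Z, f, g, h) \<in> tri T"
    "X \<in> obj T" "Y \<in> obj T" "Z \<in> obj T" "f \<in> mor T X Y" "g \<in> mor T Y Z" "h \<in> mor T Z (sh T X)"
  using assms tri_typed unfolding triangle_def by blast

lemma triangle_obj: "triangle X Y Z \<Longrightarrow> X \<in> obj T \<and> Y \<in> obj T \<and> Z \<in> obj T"
  using tri_typed unfolding triangle_def by blast

lemma triangleI: "(X, Y, Z, f, g, h) \<in> tri T \<Longrightarrow> triangle X Y Z"
  unfolding triangle_def by blast

lemma triangle_rotate: "triangle X Y Z \<Longrightarrow> triangle Y Z (shift T 1 X)"
  unfolding triangle_def shift_1 using tri_rotate_fwd by blast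

lemma triangle_rotate_back: "triangle X Y Z \<Longrightarrow> triangle (shift T (- 1) Z) X Y"
  unfolding triangle_def using tri_rotate_back by blast

text \<open>Three rotations shift a triangle by one, up to signs that \<open>triangle\<close> does
  not see.\<close>

lemma triangle_shift:
  assumes "triangle X Y Z" shows "triangle (shift T n X) (shift T n Y) (shift T n Z)"
proof -
  have o: "X \<in> obj T" "Y \<in> obj T" "Z \<in> obj T" using triangle_obj[OF assms] by auto
  show ?thesis
  proof (induction n rule: int_induct[where k = 0])
    case base then show ?case using assms by simp
  next
    case (step1 i)
    then show ?case
      using triangle_rotate[OF triangle_rotate[OF triangle_rotate[OF step1(2)]]] o
      by (simp add: add.commute)
  next
    case (step2 i)
    then show ?case
      using triangle_rotate_back[OF triangle_rotate_back[OF triangle_rotate_back[OF step2(2)]]] o by simp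
  qed
qed

lemma triangle_orth_left:
  assumes "triangle X Y Z" "orth X W" "orth Z W" "W \<in> obj T" shows "orth Y W"
proof -
  obtain f g h where t: "(X, Y, Z, f, g, h) \<in> tri T" "X \<in> obj T" "Y \<in> obj T" "Z \<in> obj T"
    "f \<in> mor T X Y" "g \<in> mor T Y Z" using assms(1) by (rule triangleE)
  show ?thesis
  proof (rule orthI[OF t(3) assms(4)])
    fix u assume u: "u \<in> mor T Y W"
    then have "u \<cdot> f = zmor T X W" using orthD[OF assms(2)] t assms(4) cmp_closed[of X Y W] by blast
    then obtain v where v: "v \<in> mor T Z W" "v \<cdot> g = u" using tri_factor_right t(1) u assms(4) by blast
    then show "u = zmor T Y W" using orthD[OF assms(3) v(1)] t assms(4) cmp_zmor_left[of Y Z W g] by simp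
  qed
qed

lemma triangle_orth_right:
  assumes "triangle X Y Z" "orth W X" "orth W Z" "W \<in> obj T" shows "orth W Y"
proof -
  obtain f g h where t: "(X, Y, Z, f, g, h) \<in> tri T" "X \<in> obj T" "Y \<in> obj T" "Z \<in> obj T"
    "f \<in> mor T X Y" "g \<in> mor T Y Z" using assms(1) by (rule triangleE)
  show ?thesis
  proof (rule orthI[OF assms(4) t(3)])
    fix u assume u: "u \<in> mor T W Y"
    then have "g \<cdot> u = zmor T W Z" using orthD[OF assms(3)] t assms(4) cmp_closed[of W Y Z] by blast
    then obtain v where v: "v \<in> mor T W X" "f \<cdot> v = u" using tri_factor_left t(1) u assms(4) by blast
    then show "u = zmor T W Y" using orthD[OF assms(2) v(1)] t assms(4) cmp_zmor_right[of W X Y f] by simp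
  qed
qed

lemma tri_retract:
  assumes "(X, Y, Z, f, g, h) \<in> tri T"
  shows "g = zmor T Y Z \<Longrightarrow> retract T Y X" and "f = zmor T X Y \<Longrightarrow> retract T Y Z"
proof -
  note t = tri_typed[OF assms]
  { assume "g = zmor T Y Z"
    then have "g \<cdot> idm T Y = zmor T Y Z" using t idm_closed cmp_zmor_left by simp
    then obtain v where "v \<in> mor T Y X" "f \<cdot> v = idm T Y" using tri_factor_left[OF assms] t idm_closed by blast
    then show "retract T Y X" using t retractI by blast }
  { assume "f = zmor T X Y"
    then have "idm T Y \<cdot> f = zmor T X Y" using t idm_closed cmp_zmor_right by simp
    then obtain v where "v \<in> mor T Z Y" "v \<cdot> g = idm T Y" using tri_factor_right[OF assms] t idm_closed by blast
    then show "retract T Y Z" using t retractI by blast }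
qed

text \<open>The identity of \<open>Y\<close> factors through the other end of the triangle. This is
  the source of all retracts produced by weight decompositions and approximations.\<close>

lemma triangle_retract:
  assumes "triangle X Y Z"
  shows "orth Y Z \<Longrightarrow> retract T Y X" and "orth X Y \<Longrightarrow> retract T Y Z"
proof -
  obtain f g h where t: "(X, Y, Z, f, g, h) \<in> tri T" using assms unfolding triangle_def by blast
  note tt = tri_typed[OF t]
  show "orth Y Z \<Longrightarrow> retract T Y X" using tri_retract(1)[OF t] orthD tt by blast
  show "orth X Y \<Longrightarrow> retract T Y Z" using tri_retract(2)[OF t] orthD tt by blast
qed

text \<open>After rotating back, a map \<open>W -> X\<close> killed by \<open>f\<close> comes from
  \<open>Z[-1]\<close>, which receives nothing from \<open>W\<close>.\<close>

lemma tri_mono: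
  assumes tr: "(X, Y, Z, f, g, h) \<in> tri T" and W: "W \<in> obj T" and o: "orth W (shift T (- 1) Z)"
    and u: "u \<in> mor T W X" "f \<cdot> u = zmor T W Y"
  shows "u = zmor T W X"
proof -
  note t = tri_typed[OF tr]
  obtain k where k: "(shift T (- 1) Z, X, Y, k, f, g) \<in> tri T" using tri_rotate_back[OF tr] by blast
  obtain v where v: "v \<in> mor T W (shift T (- 1) Z)" "k \<cdot> v = u"
    using tri_factor_left[OF k W u] by blast
  show ?thesis using orthD[OF o v(1)] v(2) tri_typed[OF k] W cmp_zmor_right by metis
qed

text \<open>Dually, a map out of \<open>Z\<close> killed by \<open>g\<close> factors through
  \<open>X[1]\<close>.\<close>

lemma tri_epi:
  assumes tr: "(X, Y, Z, f, g, h) \<in> tri T" and W: "W \<in> obj T" and o: "orth (shift T 1 X) W"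
    and u: "u \<in> mor T Z W" "u \<cdot> g = zmor T Y W"
  shows "u = zmor T Z W"
proof -
  note t = tri_typed[OF tr]
  note r = tri_rotate_fwd[OF tr]
  obtain v where v: "v \<in> mor T (sh T X) W" "v \<cdot> h = u"
    using tri_factor_right[OF r W u] by blast
  then show ?thesis using orthD[OF o[unfolded shift_1] v(1)] v(2) tri_typed[OF r] W cmp_zmor_left t by metis
qed

text \<open>The identity of \<open>Y\<close> lifts to a right inverse \<open>v\<close> of
  \<open>f\<close>. Then \<open>f\<close> kills \<open>v \<cdot> f - 1\<close>, and \<open>f\<close>
  is cancellable because \<open>Z[-1]\<close> is zero.\<close>

lemma tri_zero_iso:
  assumes tr: "(X, Y, Z, f, g, h) \<in> tri T" and Z: "zero_object T Z"
  shows "is_isomorphism T X Y f"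
proof -
  note t = tri_typed[OF tr]
  have z: "orth X (shift T (- 1) Z)" using zero_object_shift[OF Z] zero_object_orth t by blast
  have "g = zmor T Y Z" using zero_object_orth[OF Z] orthD t by blast
  then have "g \<cdot> idm T Y = zmor T Y Z" using t idm_closed cmp_zmor_left by simp
  then obtain v where v: "v \<in> mor T Y X" "f \<cdot> v = idm T Y"
    using tri_factor_left[OF tr] t idm_closed by blast
  have vf: "v \<cdot> f \<in> mor T X X" "idm T X \<in> mor T X X" using v t cmp_closed idm_closed by auto
  have "f \<cdot> (v \<cdot> f) = f"
    using cmp_assoc[of X Y X Y f v f] v t idm_left[of X Y f] by simp
  then have "f \<cdot> ((v \<cdot> f) \<ominus>\<^bsub>Hom T X X\<^esub> idm T X) = zmor T X Y"
    using cmp_minus_right[of X X Y f "v \<cdot> f" "idm T X"] vf t minus_eq_zmor_iff[of X Y f f]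
      idm_right[of X Y f] by simp
  then have "(v \<cdot> f) \<ominus>\<^bsub>Hom T X X\<^esub> idm T X = zmor T X X"
    using tri_mono[OF tr _ z] vf t minus_closed by blast
  then have "v \<cdot> f = idm T X" using minus_eq_zmor_iff vf t by blast
  then show ?thesis unfolding is_isomorphism_def using t v by blast
qed

lemma triangle_zero_iso: "triangle X Y Z \<Longrightarrow> zero_object T Z \<Longrightarrow> isomorphic T X Y"
  unfolding triangle_def isomorphic_def using tri_zero_iso by blast

lemma triangle_zero_left_iso: "triangle X Y Z \<Longrightarrow> zero_object T X \<Longrightarrow> isomorphic T Y Z"
  by (rule triangle_zero_iso[OF triangle_rotate zero_object_shift])

text \<open>After rotation the last map is zero, so the identity of \<open>Y[1]\<close> lifts to a
  section \<open>s\<close> of \<open>g\<close>. The difference \<open>1 - s g\<close> is killed by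
  \<open>g\<close> and hence factors as \<open>f r\<close>. That \<open>r\<close> is the remaining
  projection follows by cancelling \<open>f\<close>, which is possible since the map into
  \<open>X\<close> is zero.\<close>

lemma split_triangle:
  assumes tr: "(Y, X, E, zmor T Y X, f, g) \<in> tri T"
  shows "is_biproduct T [X, sh T Y] E"
proof -
  note t = tri_typed[OF tr]
  have sY: "sh T Y \<in> obj T" using t sh_obj by blast
  interpret H: abelian_group "Hom T E E" using t Hom_group by blast
  interpret H': abelian_group "Hom T (sh T Y) (sh T X)" using t sh_obj Hom_group by blast
  have "\<ominus>\<^bsub>Hom T (sh T Y) (sh T X)\<^esub> shm T (zmor T Y X) = zmor T (sh T Y) (sh T X)"
    using shm_zmor[of Y X] t by simp
  then have tr2: "(X, E, sh T Y, f, g, zmor T (sh T Y) (sh T X)) \<in> tri T"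
    using tri_rotate_fwd[OF tr] by simp
  have f_mono: "u = zmor T W X" if u: "W \<in> obj T" "u \<in> mor T W X" "f \<cdot> u = zmor T W E" for u W
  proof -
    obtain v where v: "v \<in> mor T W Y" "zmor T Y X \<cdot> v = u"
      using tri_factor_left[OF tr u] by blast
    then show ?thesis using cmp_zmor_left[of W Y X v] u(1) t by simp
  qed
  have "zmor T (sh T Y) (sh T X) \<cdot> idm T (sh T Y) = zmor T (sh T Y) (sh T X)"
    using idm_right[of "sh T Y" "sh T X"] sY t sh_obj by simp
  then obtain s where s: "s \<in> mor T (sh T Y) E" "g \<cdot> s = idm T (sh T Y)"
    using tri_factor_left[OF tri_rotate_fwd[OF tr2] sY] idm_closed[OF sY] by blast
  have c: "s \<cdot> g \<in> mor T E E" "idm T E \<in> mor T E E" using cmp_closed s t sY idm_closed by auto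
  have "g \<cdot> (s \<cdot> g) = g" using cmp_assoc[of E "sh T Y" E "sh T Y" g s g] s t sY idm_left[of E "sh T Y" g] by simp
  then have "g \<cdot> (idm T E \<ominus>\<^bsub>Hom T E E\<^esub> (s \<cdot> g)) = zmor T E (sh T Y)"
    using cmp_minus_right[of E E "sh T Y" g] c t sY idm_right[of E "sh T Y" g]
      minus_eq_zmor_iff[of E "sh T Y" g g] by simp
  then obtain r where r: "r \<in> mor T E X" "f \<cdot> r = idm T E \<ominus>\<^bsub>Hom T E E\<^esub> (s \<cdot> g)"
    using tri_factor_left[OF tr2] c t minus_closed by blast
  have gf: "g \<cdot> f = zmor T X (sh T Y)" using tri_comp_zero[OF tr2] .
  have fr: "f \<cdot> r \<in> mor T E E" using r t cmp_closed by blast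
  have frx: "(f \<cdot> r) \<cdot> x = x \<ominus>\<^bsub>Hom T W E\<^esub> (s \<cdot> (g \<cdot> x))" if "W \<in> obj T" "x \<in> mor T W E" for x W
    unfolding r using that c t sY s cmp_minus_left[of W E E _ _ x] idm_left[of W E x]
      cmp_assoc[of W E "sh T Y" E x g s] by simp
  have rf: "r \<cdot> f = idm T X"
  proof -
    have "f \<cdot> (r \<cdot> f) = f"
      using frx[of X f] gf t sY s cmp_assoc[of X E X E f r f] r cmp_zmor_right[of X "sh T Y" E s]
        minus_zmor[of X E f] by simp
    then have "f \<cdot> ((r \<cdot> f) \<ominus>\<^bsub>Hom T X X\<^esub> idm T X) = zmor T X E"
      using cmp_minus_right[of X X E f "r \<cdot> f" "idm T X"] r t minus_eq_zmor_iff[of X E f f]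
        idm_right[of X E f] cmp_closed[of X E X r f] idm_closed by simp
    then have "(r \<cdot> f) \<ominus>\<^bsub>Hom T X X\<^esub> idm T X = zmor T X X"
      using f_mono[of X] r t minus_closed cmp_closed[of X E X r f] idm_closed by blast
    then show ?thesis using minus_eq_zmor_iff[of X X "r \<cdot> f" "idm T X"] r t
        cmp_closed[of X E X r f] idm_closed by blast
  qed
  have rs: "r \<cdot> s = zmor T (sh T Y) X"
  proof (rule f_mono[OF sY])
    show "r \<cdot> s \<in> mor T (sh T Y) X" using cmp_closed r s t sY by blast
    have "f \<cdot> (r \<cdot> s) = (f \<cdot> r) \<cdot> s" using cmp_assoc[of "sh T Y" E X E s r f] r s t sY by simp
    also have "\<dots> = s \<ominus>\<^bsub>Hom T (sh T Y) E\<^esub> s"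
      using frx[OF sY s(1)] s(2) idm_right[of "sh T Y" E s] sY t s by simp
    finally show "f \<cdot> (r \<cdot> s) = zmor T (sh T Y) E" using minus_eq_zmor_iff[of "sh T Y" E s s] sY t s by simp
  qed
  have "(f \<cdot> r) \<oplus>\<^bsub>Hom T E E\<^esub> (s \<cdot> g) = idm T E"
    unfolding r using c by (simp add: H.minus_eq H.a_assoc H.l_neg H.r_zero)
  then show ?thesis using t sY r s rf rs gf by (intro is_biproduct_pairI[of _ _ _ f s r g]) auto
qed

text \<open>The cone of the zero map \<open>Y[-1] -> X\<close> is a direct sum, so closure under
  extensions yields closure under sums.\<close>

lemma split_extension:
  assumes "X \<in> obj T" "Y \<in> obj T"
  shows "\<exists>E. triangle X E Y \<and> is_biproduct T [X, Y] E"
proof -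
  define Y' where "Y' = shift T (- 1) Y"
  have Y': "Y' \<in> obj T" "sh T Y' = Y" using assms sh_shift[of Y "- 1"] by (auto simp: Y'_def)
  obtain E f g where tr: "(Y', X, E, zmor T Y' X, f, g) \<in> tri T"
    using tri_cone[of Y' X "zmor T Y' X"] Y' assms by auto
  have "is_biproduct T [X, Y] E" using split_triangle[OF tr] Y' by simp
  moreover have "triangle X E Y" using triangle_rotate[OF triangleI[OF tr]] Y' by (simp add: shift_1)
  ultimately show ?thesis by blast
qed

section \<open>Triangulated and thick subcategories\<close>

lemma triangulated_subcatD:
  assumes "triangulated_subcat T S"
  shows "S \<subseteq> obj T" "iso_closed T S" "zero_object T X \<Longrightarrow> X \<in> S"
    "X \<in> S \<Longrightarrow> shift T 1 X \<in> S" "X \<in> S \<Longrightarrow> shift T (- 1) X \<in> S"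
    "\<lbrakk>triangle X Y Z; X \<in> S; Y \<in> S\<rbrakk> \<Longrightarrow> Z \<in> S"
proof -
  note * = assms[unfolded triangulated_subcat_def]
  show "S \<subseteq> obj T" "iso_closed T S" using * by simp_all
  show "zero_object T X \<Longrightarrow> X \<in> S" using * by simp
  have "shift_set T 1 S \<subseteq> S" "shift_set T (- 1) S \<subseteq> S" using * by simp_all
  then show "X \<in> S \<Longrightarrow> shift T 1 X \<in> S" "X \<in> S \<Longrightarrow> shift T (- 1) X \<in> S" by auto
  have "(X, Y, Z, f, g, h) \<in> tri T \<Longrightarrow> X \<in> S \<Longrightarrow> Y \<in> S \<Longrightarrow> Z \<in> S" for f g h using * by blast
  then show "\<lbrakk>triangle X Y Z; X \<in> S; Y \<in> S\<rbrakk> \<Longrightarrow> Z \<in> S" unfolding triangle_def by blast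
qed

lemma triangulated_subcat_shift:
  assumes "triangulated_subcat T S" "X \<in> S" shows "shift T n X \<in> S"
proof -
  have X: "X \<in> obj T" using triangulated_subcatD(1)[OF assms(1)] assms(2) by blast
  show ?thesis
  proof (induction n rule: int_induct[where k = 0])
    case base then show ?case using assms by simp
  next
    case (step1 i) then show ?case
      using triangulated_subcatD(4)[OF assms(1) step1(2)] X by (simp add: add.commute)
  next
    case (step2 i) then show ?case
      using triangulated_subcatD(5)[OF assms(1) step2(2)] X by simp
  qed
qed

text \<open>The definition provides third terms of triangles; rotating back makes \<open>Y\<close>
  the third term over \<open>Z[-1]\<close> and \<open>X\<close>.\<close>

lemma triangulated_subcat_extension:
  assumes "triangulated_subcat T S" "triangle X Y Z" "X \<in> S" "Z \<in> S" shows "Y \<in> S"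
  by (rule triangulated_subcatD(6)[OF assms(1) triangle_rotate_back[OF assms(2)]
        triangulated_subcatD(5)[OF assms(1,4)] assms(3)])

lemma thick_subcat_obj: "thick_subcat T (obj T)"
proof -
  have "X \<in> obj T" if "direct_summand T X Y" for X Y
    using direct_summand_retract[OF that] by (rule retract_obj)
  then show ?thesis
    unfolding thick_subcat_def triangulated_subcat_def iso_closed_def isomorphic_def is_isomorphism_def
    using zero_object_obj tri_typed by auto
qed

text \<open>The family has to be non-empty because an empty intersection is the whole type rather
  than \<open>obj T\<close>.\<close>

lemma triangulated_subcat_Inter:
  assumes "F \<noteq> {}" "\<And>S. S \<in> F \<Longrightarrow> triangulated_subcat T S"
  shows "triangulated_subcat T (\<Inter>F)"
  unfolding triangulated_subcat_def
proof (intro conjI allI impI)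
  show "\<Inter>F \<subseteq> obj T" using assms triangulated_subcatD(1) by blast
  show "iso_closed T (\<Inter>F)" using assms(2) triangulated_subcatD(2) unfolding iso_closed_def by blast
  show "X \<in> \<Inter>F" if "zero_object T X" for X using assms(2) triangulated_subcatD(3) that by blast
  show "shift_set T 1 (\<Inter>F) \<subseteq> \<Inter>F" using assms(2) triangulated_subcatD(4) by blast
  show "shift_set T (- 1) (\<Inter>F) \<subseteq> \<Inter>F" using assms(2) triangulated_subcatD(5) by blast
  show "Z \<in> \<Inter>F" if "(X, Y, Z, f, g, h) \<in> tri T" "X \<in> \<Inter>F" "Y \<in> \<Inter>F" for X Y Z f g h
    using assms(2) triangulated_subcatD(6)[OF _ triangleI[OF that(1)]] that by blast
qed

lemma thick_subcat_hull:
  assumes "G \<subseteq> obj T" shows "thick_subcat T (thick_subcat T hull G)"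
proof -
  have "obj T \<in> {S. thick_subcat T S \<and> G \<subseteq> S}" using thick_subcat_obj assms by simp
  then have "triangulated_subcat T (thick_subcat T hull G)"
    unfolding hull_def by (intro triangulated_subcat_Inter) (auto simp: thick_subcat_def)
  then show ?thesis unfolding thick_subcat_def hull_def by blast
qed

text \<open>Iterated split extensions build an object of \<open>S\<close> of which \<open>Q\<close>
  is a retract, and by idempotent completeness a retract is a direct summand.\<close>

lemma thick_subcat_biproduct:
  assumes S: "thick_subcat T S" and ic: "idempotent_complete T"
    and b: "is_biproduct T Xs Q" and Xs: "set Xs \<subseteq> S"
  shows "Q \<in> S"
proof -
  have tS: "triangulated_subcat T S" using S unfolding thick_subcat_def by blast
  obtain inj proj where 1: "\<And>i. i < length Xs \<Longrightarrow> inj i \<in> mor T (Xs ! i) Q"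
    "\<And>i. i < length Xs \<Longrightarrow> proj i \<in> mor T Q (Xs ! i)"
    "(\<Oplus>\<^bsub>Hom T Q Q\<^esub>i\<in>{..<length Xs}. inj i \<cdot> proj i) = idm T Q"
    using b by (rule is_biproductE) blast
  note Q = biproduct_obj(1)[OF b]
  have ob: "Xs ! i \<in> obj T" if "i < length Xs" for i using biproduct_obj(2)[OF b] that by auto
  interpret H: abelian_group "Hom T Q Q" using Q Hom_group by blast
  have "\<exists>E\<in>S. \<exists>a\<in>mor T Q E. \<exists>b\<in>mor T E Q. b \<cdot> a = (\<Oplus>\<^bsub>Hom T Q Q\<^esub>i\<in>{..<n}. inj i \<cdot> proj i)"
    if "n \<le> length Xs" for n
    using that
  proof (induction n)
    case 0
    obtain N where N: "zero_object T N" using zero_exists by blast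
    note n = zero_object_obj[OF N]
    have "zmor T N Q \<cdot> zmor T Q N = zmor T Q Q" using cmp_zmor_left[of Q N Q "zmor T Q N"] n Q by simp
    then show ?case
      using triangulated_subcatD(3)[OF tS N] n Q
      by (intro bexI[of _ N] bexI[of _ "zmor T Q N"] bexI[of _ "zmor T N Q"]) auto
  next
    case (Suc n)
    then obtain E a b where E: "E \<in> S" and a: "a \<in> mor T Q E" and b: "b \<in> mor T E Q"
      and ba: "b \<cdot> a = (\<Oplus>\<^bsub>Hom T Q Q\<^esub>i\<in>{..<n}. inj i \<cdot> proj i)" by auto
    have n: "n < length Xs" using Suc by simp
    note I = 1(1)[OF n] 1(2)[OF n] ob[OF n]
    have Eo: "E \<in> obj T" using E triangulated_subcatD(1)[OF tS] by blast
    obtain E' where E': "triangle E E' (Xs ! n)" "is_biproduct T [E, Xs ! n] E'"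
      using split_extension[OF Eo I(3)] by blast
    have "Xs ! n \<in> S" using Xs n by (meson nth_mem subsetD)
    then have E'S: "E' \<in> S" by (rule triangulated_subcat_extension[OF tS E'(1) E])
    obtain i j p q where p: "E' \<in> obj T" "i \<in> mor T E E'" "j \<in> mor T (Xs ! n) E'" "p \<in> mor T E' E"
      "q \<in> mor T E' (Xs ! n)" "p \<cdot> i = idm T E" "q \<cdot> j = idm T (Xs ! n)" "p \<cdot> j = zmor T (Xs ! n) E"
      "q \<cdot> i = zmor T E (Xs ! n)"
      using E'(2) by (rule is_biproduct_pairE)
    interpret G: abelian_group "Hom T Q E'" using Q p Hom_group by blast
    interpret G': abelian_group "Hom T E' Q" using Q p Hom_group by blast
    interpret H1: abelian_group "Hom T E Q" using Q Eo Hom_group by blast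
    interpret H2: abelian_group "Hom T (Xs ! n) Q" using Q I Hom_group by blast
    define a' where "a' = (i \<cdot> a) \<oplus>\<^bsub>Hom T Q E'\<^esub> (j \<cdot> proj n)"
    define b' where "b' = (b \<cdot> p) \<oplus>\<^bsub>Hom T E' Q\<^esub> (inj n \<cdot> q)"
    have c: "i \<cdot> a \<in> mor T Q E'" "j \<cdot> proj n \<in> mor T Q E'" "b \<cdot> p \<in> mor T E' Q" "inj n \<cdot> q \<in> mor T E' Q"
      using cmp_closed[OF Q Eo p(1) p(2) a] cmp_closed[OF Q I(3) p(1) p(3) I(2)]
        cmp_closed[OF p(1) Eo Q b p(4)] cmp_closed[OF p(1) I(3) Q I(1) p(5)] by blast+
    have ab: "a' \<in> mor T Q E'" "b' \<in> mor T E' Q" using c by (auto simp: a'_def b'_def)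
    have bi: "b' \<cdot> i = b"
    proof -
      have "(b \<cdot> p) \<cdot> i = b"
        using cmp_assoc[OF Eo p(1) Eo Q p(2) p(4) b] p(6) idm_right[OF Eo Q b] by simp
      moreover have "(inj n \<cdot> q) \<cdot> i = zmor T E Q"
        using cmp_assoc[OF Eo p(1) I(3) Q p(2) p(5) I(1)] p(9) cmp_zmor_right[OF Eo I(3) Q I(1)] by simp
      ultimately show ?thesis
        unfolding b'_def cmp_add_left[OF Eo p(1) Q c(3,4) p(2)] using b by (simp add: H1.r_zero)
    qed
    have bj: "b' \<cdot> j = inj n"
    proof -
      have "(b \<cdot> p) \<cdot> j = zmor T (Xs ! n) Q"
        using cmp_assoc[OF I(3) p(1) Eo Q p(3) p(4) b] p(8) cmp_zmor_right[OF I(3) Eo Q b] by simp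
      moreover have "(inj n \<cdot> q) \<cdot> j = inj n"
        using cmp_assoc[OF I(3) p(1) I(3) Q p(3) p(5) I(1)] p(7) idm_right[OF I(3) Q I(1)] by simp
      ultimately show ?thesis
        unfolding b'_def cmp_add_left[OF I(3) p(1) Q c(3,4) p(3)] using I by (simp add: H2.l_zero)
    qed
    have "b' \<cdot> a' = (b \<cdot> a) \<oplus>\<^bsub>Hom T Q Q\<^esub> (inj n \<cdot> proj n)"
      unfolding a'_def cmp_add_right[OF Q p(1) Q ab(2) c(1,2)]
      using cmp_assoc[OF Q Eo p(1) Q a p(2) ab(2)] cmp_assoc[OF Q I(3) p(1) Q I(2) p(3) ab(2)] bi bj
      by simp
    also have "\<dots> = (\<Oplus>\<^bsub>Hom T Q Q\<^esub>i\<in>{..<Suc n}. inj i \<cdot> proj i)"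
    proof -
      have ip: "inj i \<cdot> proj i \<in> mor T Q Q" if "i < length Xs" for i
        by (rule cmp_closed[OF Q ob[OF that] Q 1(1)[OF that] 1(2)[OF that]])
      then have s: "(\<lambda>i. inj i \<cdot> proj i) \<in> {..<n} \<rightarrow> mor T Q Q" using n by auto
      have "(\<Oplus>\<^bsub>Hom T Q Q\<^esub>i\<in>insert n {..<n}. inj i \<cdot> proj i)
          = (inj n \<cdot> proj n) \<oplus>\<^bsub>Hom T Q Q\<^esub> (\<Oplus>\<^bsub>Hom T Q Q\<^esub>i\<in>{..<n}. inj i \<cdot> proj i)"
        using s ip[OF n] by (intro H.finsum_insert) auto
      then show ?thesis
        unfolding ba lessThan_Suc using H.a_comm[OF ip[OF n] H.finsum_closed[OF s]] by simp
    qed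
    finally show ?case using E'S ab by blast
  qed
  from this[of "length Xs"] obtain E x y where E: "E \<in> S" "x \<in> mor T Q E" "y \<in> mor T E Q" "y \<cdot> x = idm T Q"
    using 1(3) by auto
  have "E \<in> obj T" using E(1) triangulated_subcatD(1)[OF tS] by blast
  then have "direct_summand T Q E"
    using retract_direct_summand[OF ic] retractI[OF Q _ E(2-4)] by simp
  then show ?thesis
    using E(1) S unfolding thick_subcat_def by simp
qed

end

section \<open>t-structures and their hearts\<close>

text \<open>By linearity, cancelling \<open>f\<close> on the left amounts to having no non-zero map
  killed by \<open>f\<close>.\<close>

lemma (in linear_category) is_monoI:
  assumes "X \<in> obj C" "Y \<in> obj C" "f \<in> mor C X Y"
    and "\<And>W u. \<lbrakk>W \<in> obj C; u \<in> mor C W X; f \<cdot> u = zmor C W Y\<rbrakk> \<Longrightarrow> u = zmor C W X"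
  shows "is_mono C X Y f"
  unfolding is_mono_def
proof (intro conjI ballI impI)
  fix W u v assume W: "W \<in> obj C" and u: "u \<in> mor C W X" "v \<in> mor C W X" and eq: "f \<cdot> u = f \<cdot> v"
  have "f \<cdot> v \<in> mor C W Y" by (rule cmp_closed[OF W assms(1-3) u(2)])
  then have "f \<cdot> (u \<ominus>\<^bsub>Hom C W X\<^esub> v) = zmor C W Y"
    using cmp_minus_right[OF W assms(1-3) u] eq minus_eq_zmor_iff[OF W assms(2), of "f \<cdot> v" "f \<cdot> v"]
    by simp
  then have "u \<ominus>\<^bsub>Hom C W X\<^esub> v = zmor C W X"
    using assms(4)[OF W] minus_closed[OF W assms(1) u] by blast
  then show "u = v" using minus_eq_zmor_iff[OF W assms(1) u] by blast
qed (use assms in auto)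

locale t_category = triangulated_category K T
  for K :: "('k, 'r) ring_scheme" and T :: "('o, 'm, 'k, 'z) tri_cat_scheme" (structure) +
  fixes t :: "'o set \<times> 'o set"
  assumes t_str: "t_structure T t"
begin

lemma t_structure_rules:
  shows fst_obj: "fst t \<subseteq> obj T" and snd_obj: "snd t \<subseteq> obj T"
    and fst_iso_closed: "iso_closed T (fst t)" and snd_iso_closed: "iso_closed T (snd t)"
    and fst_shift: "X \<in> fst t \<Longrightarrow> shift T 1 X \<in> fst t"
    and snd_shift: "X \<in> snd t \<Longrightarrow> shift T (- 1) X \<in> snd t"
    and fst_orth: "\<lbrakk>A \<in> fst t; B \<in> t_ge T t 1\<rbrakk> \<Longrightarrow> orth A B"
    and fst_decomposition: "X \<in> obj T \<Longrightarrow> \<exists>A\<in>fst t. \<exists>B\<in>t_ge T t 1. triangle A X B"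
proof -
  note * = t_str[unfolded t_structure_def]
  show "fst t \<subseteq> obj T" "snd t \<subseteq> obj T" "iso_closed T (fst t)" "iso_closed T (snd t)"
    using * by simp_all
  have "shift_set T 1 (fst t) \<subseteq> fst t" "shift_set T (- 1) (snd t) \<subseteq> snd t" using * by simp_all
  then show "X \<in> fst t \<Longrightarrow> shift T 1 X \<in> fst t" "X \<in> snd t \<Longrightarrow> shift T (- 1) X \<in> snd t"
    by blast+
  have "hom_zero T (fst t) (t_ge T t 1)" using * by simp
  then show "\<lbrakk>A \<in> fst t; B \<in> t_ge T t 1\<rbrakk> \<Longrightarrow> orth A B" using hom_zero_iff by blast
  have "\<forall>X\<in>obj T. \<exists>A\<in>fst t. \<exists>B\<in>t_ge T t 1. \<exists>f g h. (A, X, B, f, g, h) \<in> tri T" using * by simp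
  then show "X \<in> obj T \<Longrightarrow> \<exists>A\<in>fst t. \<exists>B\<in>t_ge T t 1. triangle A X B" unfolding triangle_def by blast
qed

lemma t_le_iff: "X \<in> t_le T t n \<longleftrightarrow> X \<in> obj T \<and> shift T n X \<in> fst t"
  using shift_set_iff[OF fst_obj, of X "- n"] unfolding t_le_def by simp

lemma t_ge_iff: "X \<in> t_ge T t n \<longleftrightarrow> X \<in> obj T \<and> shift T n X \<in> snd t"
  using shift_set_iff[OF snd_obj, of X "- n"] unfolding t_ge_def by simp

lemma t_le_0: "t_le T t 0 = fst t" and t_ge_0: "t_ge T t 0 = snd t"
  by (simp_all add: t_le_def t_ge_def)

lemma t_le_obj: "X \<in> t_le T t n \<Longrightarrow> X \<in> obj T" and t_ge_obj: "X \<in> t_ge T t n \<Longrightarrow> X \<in> obj T"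
  by (simp_all add: t_le_iff t_ge_iff)

lemma shift_t_le_iff: "X \<in> obj T \<Longrightarrow> shift T k X \<in> t_le T t n \<longleftrightarrow> X \<in> t_le T t (n + k)"
  and shift_t_ge_iff: "X \<in> obj T \<Longrightarrow> shift T k X \<in> t_ge T t n \<longleftrightarrow> X \<in> t_ge T t (n + k)"
  by (simp_all add: t_le_iff t_ge_iff)

lemma t_le_mono:
  assumes "X \<in> t_le T t m" "m \<le> n" shows "X \<in> t_le T t n"
proof -
  have "X \<in> t_le T t (m + int k)" for k
  proof (induction k)
    case (Suc k)
    then have "shift T (1 + (m + int k)) X \<in> fst t" using fst_shift[of "shift T (m + int k) X"] by (simp add: t_le_iff)
    then show ?case using Suc by (simp add: t_le_iff ac_simps)
  qed (use assms in simp)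
  from this[of "nat (n - m)"] show ?thesis using assms by simp
qed

lemma t_ge_antimono:
  assumes "X \<in> t_ge T t n" "m \<le> n" shows "X \<in> t_ge T t m"
proof -
  have "X \<in> t_ge T t (n - int k)" for k
  proof (induction k)
    case (Suc k)
    then have "shift T (- 1 + (n - int k)) X \<in> snd t" using snd_shift[of "shift T (n - int k) X"] by (simp add: t_ge_iff)
    then show ?case using Suc by (simp add: t_ge_iff algebra_simps)
  qed (use assms in simp)
  from this[of "nat (n - m)"] show ?thesis using assms by simp
qed

lemma t_le_ge_orth:
  assumes A: "A \<in> t_le T t m" and B: "B \<in> t_ge T t n" and "m < n"
  shows "orth A B"
proof -
  have o: "A \<in> obj T" "B \<in> obj T" using A B t_le_obj t_ge_obj by auto
  have "shift T m B \<in> t_ge T t 1"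
    using B o \<open>m < n\<close> t_ge_antimono[of B n "1 + m"] by (simp add: shift_t_ge_iff)
  then have "orth (shift T m A) (shift T m B)"
    using A fst_orth unfolding t_le_iff by simp
  then show ?thesis using orth_shift_iff o by blast
qed

lemma truncation:
  assumes X: "X \<in> obj T"
  shows "\<exists>A\<in>t_le T t n. \<exists>B\<in>t_ge T t (n + 1). triangle A X B"
proof -
  obtain A B where A: "A \<in> fst t" and B: "B \<in> t_ge T t 1" and tr: "triangle A (shift T n X) B"
    using fst_decomposition[OF shift_obj[OF X, of n]] by blast
  have o: "A \<in> obj T" "B \<in> obj T" using triangle_obj[OF tr] by auto
  have "shift T (- n) A \<in> t_le T t n" "shift T (- n) B \<in> t_ge T t (n + 1)"
    using A B o by (simp_all add: shift_t_le_iff shift_t_ge_iff t_le_0)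
  moreover have "triangle (shift T (- n) A) X (shift T (- n) B)"
    using triangle_shift[OF tr, of "- n"] X by simp
  ultimately show ?thesis by blast
qed

text \<open>If \<open>X\<close> has no maps into degrees \<ge> 1, truncate it. The part
  \<open>B\<close> sits between \<open>X\<close> and \<open>A[1]\<close>, neither of which maps to
  \<open>B\<close>, so \<open>B\<close> has no endomorphisms and is zero.\<close>

lemma fst_iff_orth: "X \<in> fst t \<longleftrightarrow> X \<in> obj T \<and> (\<forall>B\<in>t_ge T t 1. orth X B)"
proof
  assume X: "X \<in> fst t"
  then show "X \<in> obj T \<and> (\<forall>B\<in>t_ge T t 1. orth X B)"
    using t_le_obj[of X 0] t_le_ge_orth[of X 0 _ 1] unfolding t_le_0 by auto
next
  assume X: "X \<in> obj T \<and> (\<forall>B\<in>t_ge T t 1. orth X B)"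
  then obtain A B where AB: "A \<in> t_le T t 0" "B \<in> t_ge T t 1" "triangle A X B"
    using truncation[of X 0] by auto
  have o: "A \<in> obj T" "B \<in> obj T" using AB t_le_obj t_ge_obj by auto
  have "shift T 1 A \<in> t_le T t 0" using AB o t_le_mono[of A 0 1] by (simp add: shift_t_le_iff)
  then have "orth (shift T 1 A) B" using AB t_le_ge_orth[of _ 0 _ 1] by auto
  then have "orth B B" using triangle_orth_left[OF triangle_rotate[OF AB(3)] _ _ o(2)] X AB by blast
  then have "isomorphic T A X" using triangle_zero_iso[OF AB(3)] zero_object_iff_orth o by blast
  then show "X \<in> fst t" using AB(1) fst_iso_closed unfolding t_le_0 iso_closed_def by blast
qed

lemma snd_iff_orth: "X \<in> snd t \<longleftrightarrow> X \<in> obj T \<and> (\<forall>A\<in>t_le T t (- 1). orth A X)"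
proof
  assume X: "X \<in> snd t"
  then show "X \<in> obj T \<and> (\<forall>A\<in>t_le T t (- 1). orth A X)"
    using t_ge_obj[of X 0] t_le_ge_orth[of _ "- 1" X 0] unfolding t_ge_0 by auto
next
  assume X: "X \<in> obj T \<and> (\<forall>A\<in>t_le T t (- 1). orth A X)"
  then obtain A B where AB: "A \<in> t_le T t (- 1)" "B \<in> t_ge T t 0" "triangle A X B"
    using truncation[of X "- 1"] by auto
  have o: "A \<in> obj T" "B \<in> obj T" using AB t_le_obj t_ge_obj by auto
  have "shift T (- 1) B \<in> t_ge T t 0" using AB o t_ge_antimono[of B 0 "- 1"] by (simp add: shift_t_ge_iff)
  then have "orth A (shift T (- 1) B)" using AB t_le_ge_orth[of _ "- 1" _ 0] by auto
  then have "orth A A"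
    using triangle_orth_right[OF triangle_rotate_back[OF AB(3)] _ _ o(1)] X AB by blast
  then have "isomorphic T B X"
    using triangle_zero_left_iso[OF AB(3)] zero_object_iff_orth o isomorphic_sym by blast
  then show "X \<in> snd t" using AB(2) snd_iso_closed unfolding t_ge_0 iso_closed_def by blast
qed

text \<open>Orthogonality conditions pass to retracts and extensions, so the closure properties of
  the classes follow from this description and its dual.\<close>

lemma t_le_iff_orth: "X \<in> t_le T t n \<longleftrightarrow> X \<in> obj T \<and> (\<forall>B\<in>t_ge T t (n + 1). orth X B)"
proof
  assume "X \<in> t_le T t n"
  then show "X \<in> obj T \<and> (\<forall>B\<in>t_ge T t (n + 1). orth X B)"
    using t_le_obj t_le_ge_orth by auto
next
  assume X: "X \<in> obj T \<and> (\<forall>B\<in>t_ge T t (n + 1). orth X B)"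
  have "orth (shift T n X) B" if B: "B \<in> t_ge T t 1" for B
    using X B t_ge_obj[OF B] by (simp add: orth_shift_left shift_t_ge_iff)
  then have "shift T n X \<in> fst t" using X fst_iff_orth by simp
  then show "X \<in> t_le T t n" using X t_le_iff by blast
qed

lemma t_ge_iff_orth: "X \<in> t_ge T t n \<longleftrightarrow> X \<in> obj T \<and> (\<forall>A\<in>t_le T t (n - 1). orth A X)"
proof
  assume "X \<in> t_ge T t n"
  then show "X \<in> obj T \<and> (\<forall>A\<in>t_le T t (n - 1). orth A X)"
    using t_ge_obj t_le_ge_orth by auto
next
  assume X: "X \<in> obj T \<and> (\<forall>A\<in>t_le T t (n - 1). orth A X)"
  have "orth A (shift T n X)" if A: "A \<in> t_le T t (- 1)" for A
    using X A t_le_obj[OF A] orth_shift_left[of A X "- n"] by (simp add: shift_t_le_iff)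
  then have "shift T n X \<in> snd t" using X snd_iff_orth by simp
  then show "X \<in> t_ge T t n" using X t_ge_iff by blast
qed

lemma t_le_retract:
  assumes r: "retract T X Y" and Y: "Y \<in> t_le T t n" shows "X \<in> t_le T t n"
proof -
  have "orth X B" if B: "B \<in> t_ge T t (n + 1)" for B
    using orth_retract_left[OF r _ t_ge_obj[OF B]] Y B t_le_iff_orth by blast
  then show ?thesis using retract_obj(1)[OF r] t_le_iff_orth by blast
qed

lemma t_ge_retract:
  assumes r: "retract T X Y" and Y: "Y \<in> t_ge T t n" shows "X \<in> t_ge T t n"
proof -
  have "orth A X" if A: "A \<in> t_le T t (n - 1)" for A
    using orth_retract_right[OF r _ t_le_obj[OF A]] Y A t_ge_iff_orth by blast
  then show ?thesis using retract_obj(1)[OF r] t_ge_iff_orth by blast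
qed

lemma t_le_extension:
  assumes tr: "triangle X Y Z" and XZ: "X \<in> t_le T t n" "Z \<in> t_le T t n" shows "Y \<in> t_le T t n"
proof -
  have "orth Y B" if B: "B \<in> t_ge T t (n + 1)" for B
    using triangle_orth_left[OF tr _ _ t_ge_obj[OF B]] XZ B t_le_iff_orth by blast
  then show ?thesis using triangle_obj[OF tr] t_le_iff_orth by blast
qed

lemma t_ge_extension:
  assumes tr: "triangle X Y Z" and XZ: "X \<in> t_ge T t n" "Z \<in> t_ge T t n" shows "Y \<in> t_ge T t n"
proof -
  have "orth A Y" if A: "A \<in> t_le T t (n - 1)" for A
    using triangle_orth_right[OF tr _ _ t_le_obj[OF A]] XZ A t_ge_iff_orth by blast
  then show ?thesis using triangle_obj[OF tr] t_ge_iff_orth by blast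
qed

text \<open>\<open>Z\<close> is an extension of \<open>X[1]\<close> by \<open>Y\<close>, so
  \<open>X\<close> may live one degree higher than \<open>Y\<close>. The offsets in the next three
  lemmas arise in the same way.\<close>

lemma t_le_cone:
  assumes tr: "triangle X Y Z" and "Y \<in> t_le T t n" "X \<in> t_le T t (n + 1)"
  shows "Z \<in> t_le T t n"
  using t_le_extension[OF triangle_rotate[OF tr] assms(2)] assms(3) triangle_obj[OF tr]
  by (simp add: shift_t_le_iff)

lemma t_ge_cone:
  assumes tr: "triangle X Y Z" and "Y \<in> t_ge T t n" "X \<in> t_ge T t (n + 1)"
  shows "Z \<in> t_ge T t n"
  using t_ge_extension[OF triangle_rotate[OF tr] assms(2)] assms(3) triangle_obj[OF tr]
  by (simp add: shift_t_ge_iff)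

lemma t_le_cocone:
  assumes tr: "triangle X Y Z" and "Y \<in> t_le T t n" "Z \<in> t_le T t (n - 1)"
  shows "X \<in> t_le T t n"
  using t_le_extension[OF triangle_rotate_back[OF tr] _ assms(2)] assms(3) triangle_obj[OF tr]
  by (simp add: shift_t_le_iff)

lemma t_ge_cocone:
  assumes tr: "triangle X Y Z" and "Y \<in> t_ge T t n" "Z \<in> t_ge T t (n - 1)"
  shows "X \<in> t_ge T t n"
  using t_ge_extension[OF triangle_rotate_back[OF tr] _ assms(2)] assms(3) triangle_obj[OF tr]
  by (simp add: shift_t_ge_iff)

lemma zero_object_t: "zero_object T X \<Longrightarrow> X \<in> t_le T t n" "zero_object T X \<Longrightarrow> X \<in> t_ge T t n"
  unfolding t_le_iff_orth t_ge_iff_orth using zero_object_orth zero_object_obj t_le_obj t_ge_obj by auto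

lemma t_le_ge_zero: "X \<in> t_le T t m \<Longrightarrow> X \<in> t_ge T t n \<Longrightarrow> m < n \<Longrightarrow> zero_object T X"
  using t_le_ge_orth zero_object_iff_orth t_le_obj by blast

lemma heart_iff: "X \<in> heart t \<longleftrightarrow> X \<in> t_le T t 0 \<and> X \<in> t_ge T t 0"
  unfolding heart_def t_le_0 t_ge_0 by blast

lemma heart_obj: "heart t \<subseteq> obj T"
  using heart_iff t_le_obj by blast

lemma heart_orth_shift:
  "X \<in> heart t \<Longrightarrow> Y \<in> heart t \<Longrightarrow> n < 0 \<Longrightarrow> orth X (shift T n Y)"
  using t_le_ge_orth[of X 0 "shift T n Y" "- n"] heart_iff shift_t_ge_iff[of Y n "- n"] t_ge_obj by auto

lemma triangulated_subcat_t_ge: "triangulated_subcat T (\<Union>n. t_ge T t n)"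
  unfolding triangulated_subcat_def
proof (intro conjI allI impI)
  show "(\<Union>n. t_ge T t n) \<subseteq> obj T" using t_ge_obj by blast
  show "iso_closed T (\<Union>n. t_ge T t n)"
    unfolding iso_closed_def using t_ge_retract[OF isomorphic_retract[OF isomorphic_sym]] by blast
  show "X \<in> (\<Union>n. t_ge T t n)" if "zero_object T X" for X using zero_object_t[OF that] by blast
  have sh: "shift T k X \<in> t_ge T t (n - k)" if "X \<in> t_ge T t n" for X k n
    using that t_ge_obj[OF that] by (simp add: shift_t_ge_iff)
  have "shift_set T k (\<Union>n. t_ge T t n) \<subseteq> (\<Union>n. t_ge T t n)" for k
  proof
    fix Y assume "Y \<in> shift_set T k (\<Union>n. t_ge T t n)"
    then obtain X n where "Y = shift T k X" "X \<in> t_ge T t n" by blast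
    then show "Y \<in> (\<Union>n. t_ge T t n)" using sh by blast
  qed
  then show "shift_set T 1 (\<Union>n. t_ge T t n) \<subseteq> (\<Union>n. t_ge T t n)"
    "shift_set T (- 1) (\<Union>n. t_ge T t n) \<subseteq> (\<Union>n. t_ge T t n)" by blast+
  fix X Y Z f g h
  assume tr: "(X, Y, Z, f, g, h) \<in> tri T" and "X \<in> (\<Union>n. t_ge T t n)" "Y \<in> (\<Union>n. t_ge T t n)"
  then obtain m n where "X \<in> t_ge T t m" "Y \<in> t_ge T t n" by blast
  \<comment> \<open>\<open>t_ge_cone\<close> wants \<open>X\<close> one degree above
    \<open>Y\<close>; lowering the common bound by one leaves room for that.\<close>
  then have "X \<in> t_ge T t (min m n - 1 + 1)" "Y \<in> t_ge T t (min m n - 1)"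
    using t_ge_antimono by auto
  then show "Z \<in> (\<Union>n. t_ge T t n)" using t_ge_cone[OF triangleI[OF tr]] by blast
qed

text \<open>Devissage on the number \<open>k\<close> of degrees \<open>n, ..., n + k - 1\<close> in
  which \<open>X\<close> may live: truncation splits off the top degree, a shift of an object of the
  heart. For \<open>k = 0\<close> the interval is empty and \<open>X\<close> is zero.\<close>

lemma t_bounded_in_triangulated_subcat:
  assumes S: "triangulated_subcat T S" "heart t \<subseteq> S"
  shows "X \<in> t_ge T t n \<Longrightarrow> X \<in> t_le T t (n + int k - 1) \<Longrightarrow> X \<in> S"
proof (induction k arbitrary: X)
  case 0
  then have "zero_object T X" using t_le_ge_zero[of X "n - 1" n] by simp
  then show ?case using triangulated_subcatD(3)[OF S(1)] by blast
next
  case (Suc k)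
  let ?m = "n + int k"
  have X: "X \<in> obj T" "X \<in> t_le T t ?m" using Suc.prems t_ge_obj by auto
  obtain A B where AB: "A \<in> t_le T t (?m - 1)" "B \<in> t_ge T t ?m" and tr: "triangle A X B"
    using truncation[OF X(1), of "?m - 1"] by auto
  have o: "A \<in> obj T" "B \<in> obj T" using AB t_le_obj t_ge_obj by auto
  have "B \<in> t_le T t ?m" by (rule t_le_cone[OF tr X(2)]) (use AB t_le_mono in auto)
  then have "shift T ?m B \<in> heart t" using AB o by (simp add: heart_iff shift_t_le_iff shift_t_ge_iff)
  then have "shift T (- ?m) (shift T ?m B) \<in> S" using triangulated_subcat_shift[OF S(1)] S(2) by blast
  then have "B \<in> S" using o by simp
  moreover have "A \<in> t_ge T t n"
    by (rule t_ge_cocone[OF tr Suc.prems(1)]) (use AB t_ge_antimono[of B ?m "n - 1"] in auto)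
  then have "A \<in> S" using Suc.IH AB by simp
  ultimately show ?case using triangulated_subcat_extension[OF S(1) tr] by blast
qed

text \<open>Boundedness above puts every object that is bounded below into finitely many degrees,
  where devissage applies.\<close>

lemma heart_hull:
  assumes "t_bounded_above T t"
  shows "triangulated_subcat T hull heart t = (\<Union>n. t_ge T t n)"
proof (rule hull_unique)
  show "heart t \<subseteq> (\<Union>n. t_ge T t n)" using heart_iff by blast
  show "triangulated_subcat T (\<Union>n. t_ge T t n)" by (rule triangulated_subcat_t_ge)
  fix S assume S: "heart t \<subseteq> S" "triangulated_subcat T S"
  show "(\<Union>n. t_ge T t n) \<subseteq> S"
  proof
    fix X assume "X \<in> (\<Union>n. t_ge T t n)"
    then obtain n where n: "X \<in> t_ge T t n" by blast
    then obtain m where "X \<in> t_le T t m" using assms t_ge_obj unfolding t_bounded_above_def by blast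
    then have "X \<in> t_le T t (n + int (nat (m - n + 1)) - 1)" by (rule t_le_mono) simp
    then show "X \<in> S" using t_bounded_in_triangulated_subcat[OF S(2,1) n] by blast
  qed
qed

section \<open>Monomorphisms, cokernels and simple objects of the heart\<close>

lemma linear_category_heart: "linear_category K (full T (heart t))"
  by (rule linear_category_full[OF heart_obj])

text \<open>The obstructions lie in \<open>Hom(W, Z[-1])\<close> for cancelling \<open>f\<close> and
  in \<open>Hom(X[1], W)\<close> for uniqueness along \<open>g\<close>. Both are negative extensions
  in the heart and vanish.\<close>

lemma heart_mono_cokernel:
  assumes tr: "(X, Y, Z, f, g, h) \<in> tri T" and H: "X \<in> heart t" "Y \<in> heart t" "Z \<in> heart t"
  shows "is_mono (full T (heart t)) X Y f" "is_cokernel (full T (heart t)) X Y Z f g"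
proof -
  note tt = tri_typed[OF tr]
  show "is_mono (full T (heart t)) X Y f"
  proof (rule linear_category.is_monoI[OF linear_category_heart], unfold full_simps)
    fix W u assume W: "W \<in> heart t" and u: "u \<in> mor T W X" "f \<cdot> u = zmor T W Y"
    show "u = zmor T W X"
      by (rule tri_mono[OF tr _ _ u]) (use W H heart_obj heart_orth_shift in auto)
  qed (use H tt in auto)
  have o1: "orth (shift T 1 X) W" if W: "W \<in> heart t" for W
    using heart_orth_shift[OF H(1) W, of "- 1"] orth_shift_left[of X W 1] W heart_obj tt by auto
  show "is_cokernel (full T (heart t)) X Y Z f g"
    unfolding is_cokernel_def full_simps
  proof (intro conjI ballI impI ex_ex1I)
    show "g \<cdot> f = zmor T X Z" by (rule tri_comp_zero[OF tr])
    fix W e assume W: "W \<in> heart t" and e: "e \<in> mor T Y W" "e \<cdot> f = zmor T X W"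
    have Wo: "W \<in> obj T" using W heart_obj by blast
    show "\<exists>u. u \<in> mor T Z W \<and> u \<cdot> g = e" using tri_factor_right[OF tr Wo e] by blast
    fix u v assume u: "u \<in> mor T Z W \<and> u \<cdot> g = e" and v: "v \<in> mor T Z W \<and> v \<cdot> g = e"
    have "(u \<ominus>\<^bsub>Hom T Z W\<^esub> v) \<cdot> g = zmor T Y W"
      using cmp_minus_left[of Y Z W u v g] u v tt Wo e minus_eq_zmor_iff[of Y W e e] by simp
    then have "u \<ominus>\<^bsub>Hom T Z W\<^esub> v = zmor T Z W"
      using tri_epi[OF tr Wo o1[OF W]] u v tt Wo minus_closed by blast
    then show "u = v" using minus_eq_zmor_iff u v tt Wo by blast
  qed (use H tt in auto)
qed

text \<open>Kernels in the heart: truncate the cocone \<open>W\<close> of \<open>f\<close>, which lies in degrees 0 and 1.\<close>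

lemma heart_kernel:
  assumes tr: "(X, Y, Z, f, g, h) \<in> tri T" and H: "X \<in> heart t" "Y \<in> heart t"
  shows "\<exists>N k. is_mono (full T (heart t)) N X k \<and> f \<cdot> k = zmor T N Y \<and>
    (zero_object T N \<longrightarrow> Z \<in> heart t)"
proof -
  note tt = tri_typed[OF tr]
  have X: "X \<in> t_le T t 0" "X \<in> t_ge T t 0" and Y: "Y \<in> t_le T t 0" "Y \<in> t_ge T t 0"
    using H heart_iff by auto
  have Z: "Z \<in> t_le T t 0" "Z \<in> t_ge T t (- 1)"
    using t_le_cone[OF triangleI[OF tr] Y(1)] t_le_mono[OF X(1), of 1]
      t_ge_cone[OF triangleI[OF tr], of "- 1"] t_ge_antimono[OF Y(2), of "- 1"] X by auto
  define W where "W = shift T (- 1) Z"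
  have W: "W \<in> obj T" "W \<in> t_ge T t 0" using Z tt by (simp_all add: W_def shift_t_ge_iff)
  obtain k0 where k0: "(W, X, Y, k0, f, g) \<in> tri T" using tri_rotate_back[OF tr] W_def by blast
  obtain N B a b c where N: "N \<in> t_le T t 0" and B: "B \<in> t_ge T t 1" and trN: "(N, W, B, a, b, c) \<in> tri T"
    using truncation[OF W(1), of 0] unfolding triangle_def by auto
  note tN = tri_typed[OF trN] and tk = tri_typed[OF k0]
  have "N \<in> t_ge T t 0" by (rule t_ge_cocone[OF triangleI[OF trN] W(2)]) (use B t_ge_antimono in auto)
  then have NH: "N \<in> heart t" using N heart_iff by blast
  have k: "k0 \<cdot> a \<in> mor T N X" using cmp_closed[of N W X k0 a] tN tk by blast
  have "f \<cdot> (k0 \<cdot> a) = (f \<cdot> k0) \<cdot> a" using cmp_assoc[of N W X Y a k0 f] tN tk by simp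
  also have "\<dots> = zmor T N Y" using tri_comp_zero[OF k0] cmp_zmor_left[of N W Y a] tN tk by simp
  finally have fk: "f \<cdot> (k0 \<cdot> a) = zmor T N Y" .
  have mono: "is_mono (full T (heart t)) N X (k0 \<cdot> a)"
  proof (rule linear_category.is_monoI[OF linear_category_heart], unfold full_simps)
    fix V u assume V: "V \<in> heart t" and u: "u \<in> mor T V N" "(k0 \<cdot> a) \<cdot> u = zmor T V X"
    have Vo: "V \<in> obj T" using V heart_obj by blast
    have V0: "V \<in> t_le T t 0" using V heart_iff by blast
    have au: "a \<cdot> u \<in> mor T V W" using cmp_closed[of V N W a u] tN u Vo by blast
    have "k0 \<cdot> (a \<cdot> u) = zmor T V X" using cmp_assoc[of V N W X u a k0] tN tk u Vo by simp
    then have "a \<cdot> u = zmor T V W"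
      using tri_mono[OF k0 Vo _ au] heart_orth_shift[OF V H(2)] by simp
    then show "u = zmor T V N"
      using tri_mono[OF trN Vo _ u(1)] t_le_ge_orth[OF V0, of "shift T (- 1) B" 2] B tN
      by (simp add: shift_t_ge_iff)
  qed (use NH H k in auto)
  \<comment> \<open>A zero truncation \<open>N\<close> leaves \<open>W\<close> in degrees \<ge> 1,
    so its shift \<open>Z\<close> loses its possible part in degree -1.\<close>
  have "Z \<in> heart t" if "zero_object T N"
  proof -
    have "isomorphic T W B" using triangle_zero_left_iso[OF triangleI[OF trN] that] .
    then have "W \<in> t_ge T t 1" using B t_ge_retract isomorphic_retract by blast
    then have "Z \<in> t_ge T t 0" using tt by (simp add: W_def shift_t_ge_iff)
    then show ?thesis using Z heart_iff by blast
  qed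
  then show ?thesis using mono fk by blast
qed

text \<open>The kernel map of a monomorphism is zero and is itself a monomorphism, so its source
  vanishes; then the kernel construction already says that the cone lies in the heart.\<close>

lemma heart_mono_cone:
  assumes tr: "(X, Y, Z, f, g, h) \<in> tri T" and m: "is_mono (full T (heart t)) X Y f"
  shows "Z \<in> heart t"
proof -
  note tt = tri_typed[OF tr]
  have H: "X \<in> heart t" "Y \<in> heart t" using m unfolding is_mono_def by auto
  obtain N k where N: "is_mono (full T (heart t)) N X k" "f \<cdot> k = zmor T N Y"
    "zero_object T N \<Longrightarrow> Z \<in> heart t" using heart_kernel[OF tr H] by blast
  have NH: "N \<in> heart t" "k \<in> mor T N X" using N(1) unfolding is_mono_def by auto
  have No: "N \<in> obj T" using NH heart_obj by blast
  have "f \<cdot> k = f \<cdot> zmor T N X" using N(2) cmp_zmor_right[of N X Y f] No tt by simp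
  then have "k = zmor T N X"
    using m NH No tt unfolding is_mono_def by auto
  \<comment> \<open>A zero map cannot tell the identity of \<open>N\<close> from zero, but a
    monomorphism must.\<close>
  then have "k \<cdot> idm T N = k \<cdot> zmor T N N"
    using cmp_zmor_left[of N N X] No tt idm_closed[of N] cmp_zmor_right[of N N X k] by simp
  then have "idm T N = zmor T N N"
    using N(1) NH No idm_closed[of N] unfolding is_mono_def by auto
  then show ?thesis using N(3) zero_objectI No by blast
qed

lemma simple_objectD:
  assumes "simple_object (full T (heart t)) S"
  shows "S \<in> heart t" "\<not> zero_object T S"
    "is_mono (full T (heart t)) Y S f \<Longrightarrow> zero_object T Y \<or> is_isomorphism T Y S f"
proof -
  note * = assms[unfolded simple_object_def full_simps]
  show S: "S \<in> heart t" using * by blast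
  then show "\<not> zero_object T S" using * zero_object_full_iff[OF heart_obj] by blast
  show "zero_object T Y \<or> is_isomorphism T Y S f" if m: "is_mono (full T (heart t)) Y S f"
  proof -
    have "zero_object (full T (heart t)) Y \<or> is_isomorphism (full T (heart t)) Y S f" using * m by blast
    then show ?thesis
      using zero_object_full_iff[OF heart_obj] is_isomorphism_full_iff[OF heart_obj] by blast
  qed
qed

text \<open>The kernel of a non-zero map is not all of \<open>S\<close>, hence zero. So the map is a
  monomorphism with non-zero source into the simple object \<open>S'\<close>.\<close>

lemma schur:
  assumes S: "simple_object (full T (heart t)) S" and S': "simple_object (full T (heart t)) S'"
    and f: "f \<in> mor T S S'" "f \<noteq> zmor T S S'"
  shows "isomorphic T S S'"
proof -
  note H = simple_objectD(1)[OF S] simple_objectD(1)[OF S']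
  have o: "S \<in> obj T" "S' \<in> obj T" using H heart_obj by auto
  obtain Z g h where tr: "(S, S', Z, f, g, h) \<in> tri T" using tri_cone[OF o f(1)] by blast
  obtain N k where N: "is_mono (full T (heart t)) N S k" "f \<cdot> k = zmor T N S'"
    "zero_object T N \<Longrightarrow> Z \<in> heart t" using heart_kernel[OF tr H] by blast
  have "\<not> is_isomorphism T N S k"
  proof
    assume "is_isomorphism T N S k"
    then obtain k' where k: "k' \<in> mor T S N" "k \<in> mor T N S" "N \<in> obj T" "k \<cdot> k' = idm T S"
      unfolding is_isomorphism_def by blast
    have "f = f \<cdot> (k \<cdot> k')" using k f o idm_right by simp
    also have "\<dots> = zmor T S S'"
      using cmp_assoc[of S N S S' k' k f] k f o N(2) cmp_zmor_left[of S N S' k'] by simp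
    finally show False using f by blast
  qed
  then have "zero_object T N" using simple_objectD(3)[OF S N(1)] by blast
  then have "is_mono (full T (heart t)) S S' f" using heart_mono_cokernel(1)[OF tr H] N(3) by blast
  then show ?thesis
    using simple_objectD(3)[OF S'] simple_objectD(2)[OF S] unfolding isomorphic_def by blast
qed

text \<open>Each simple object receiving a non-zero map from \<open>X\<close> is isomorphic to a
  factor of a composition series: a map from \<open>Y\<close> that vanishes on the subobject
  \<open>X\<close> factors through the new factor \<open>S0\<close>, where Schur's lemma
  applies.\<close>

lemma finite_simple_quotients:
  assumes "has_finite_length (full T (heart t)) X"
  shows "\<exists>F. finite F \<and> F \<subseteq> {S. simple_object (full T (heart t)) S} \<and>
    (\<forall>S. simple_object (full T (heart t)) S \<longrightarrow> \<not> orth X S \<longrightarrow> (\<exists>S'\<in>F. isomorphic T S S'))"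
  using assms
proof (induction rule: has_finite_length.induct)
  case (zero X)
  then have "zero_object T X" using zero_object_full_iff[OF heart_obj] by blast
  then have "orth X S" if "simple_object (full T (heart t)) S" for S
    using zero_object_orth simple_objectD(1)[OF that] heart_obj by blast
  then show ?case by (intro exI[of _ "{}"]) auto
next
  case (step X Y f S0 g)
  then obtain F where F: "finite F" "F \<subseteq> {S. simple_object (full T (heart t)) S}"
    "\<And>S. simple_object (full T (heart t)) S \<Longrightarrow> \<not> orth X S \<Longrightarrow> \<exists>S'\<in>F. isomorphic T S S'" by blast
  have "\<exists>S'\<in>insert S0 F. isomorphic T S S'"
    if S: "simple_object (full T (heart t)) S" and no: "\<not> orth Y S" for S
  proof (cases "orth X S")
    case False
    then show ?thesis using F(3)[OF S] by blast
  next
    case True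
    have SH: "S \<in> heart t" using simple_objectD(1)[OF S] .
    have c: "X \<in> heart t" "Y \<in> heart t" "S0 \<in> heart t" "f \<in> mor T X Y" "g \<in> mor T Y S0"
      "\<And>h. h \<in> mor T Y S \<Longrightarrow> h \<cdot> f = zmor T X S \<Longrightarrow> \<exists>u. u \<in> mor T S0 S \<and> u \<cdot> g = h"
      using step(3) SH unfolding is_cokernel_def full_simps by blast+
    have o: "X \<in> obj T" "Y \<in> obj T" "S0 \<in> obj T" "S \<in> obj T" using c SH heart_obj by auto
    obtain u where u: "u \<in> mor T Y S" "u \<noteq> zmor T Y S" using no orthI o by blast
    have "u \<cdot> f = zmor T X S" using orthD[OF True] cmp_closed[of X Y S u f] o c u by blast
    then obtain v where v: "v \<in> mor T S0 S" "v \<cdot> g = u" using c(6) u by blast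
    have "v \<noteq> zmor T S0 S" using v u o c cmp_zmor_left[of Y S0 S g] by auto
    then show ?thesis using schur[OF step(4) S v(1)] isomorphic_sym by blast
  qed
  then show ?case using F step(4) by (intro exI[of _ "insert S0 F"]) auto
qed

end

section \<open>Weight structures adjacent to a t-structure\<close>

context triangulated_category
begin

section \<open>Finite-dimensional Hom spaces along triangles\<close>

lemma fin_dim_covariant_surj:
  assumes tr: "triangle X Y Z" and W: "W \<in> obj T" and o: "orth W Z"
    and fd: "vectorspace.fin_dim K (Hom T W X)"
  shows "vectorspace.fin_dim K (Hom T W Y)"
proof -
  obtain f g h where t: "(X, Y, Z, f, g, h) \<in> tri T" "X \<in> obj T" "Y \<in> obj T" "Z \<in> obj T"
    "f \<in> mor T X Y" "g \<in> mor T Y Z" using tr by (rule triangleE)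
  interpret L: linear_map K "Hom T W X" "Hom T W Y" "\<lambda>u. f \<cdot> u"
    by (rule cmp_linear_right[OF W t(2,3,5)])
  have "u \<in> (\<lambda>u. f \<cdot> u) ` mor T W X" if u: "u \<in> mor T W Y" for u
  proof -
    have "g \<cdot> u = zmor T W Z" using orthD[OF o cmp_closed[OF W t(3,4) t(6) u]] .
    then show ?thesis using tri_factor_left[OF t(1) W u] by blast
  qed
  then have "(\<lambda>u. f \<cdot> u) ` mor T W X = mor T W Y" by auto
  then show ?thesis by (rule L.surj_fin_dim[OF fd])
qed

lemma fin_dim_covariant_inj:
  assumes tr: "triangle X Y Z" and W: "W \<in> obj T" and o: "orth W X"
    and fd: "vectorspace.fin_dim K (Hom T W Z)"
  shows "vectorspace.fin_dim K (Hom T W Y)"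
proof -
  obtain f g h where t: "(X, Y, Z, f, g, h) \<in> tri T" "X \<in> obj T" "Y \<in> obj T" "Z \<in> obj T"
    "f \<in> mor T X Y" "g \<in> mor T Y Z" using tr by (rule triangleE)
  interpret L: linear_map K "Hom T W Y" "Hom T W Z" "\<lambda>u. g \<cdot> u"
    by (rule cmp_linear_right[OF W t(3,4,6)])
  have "inj_on (\<lambda>u. g \<cdot> u) (mor T W Y)"
  proof (rule inj_onI)
    fix u v assume u: "u \<in> mor T W Y" "v \<in> mor T W Y" and eq: "g \<cdot> u = g \<cdot> v"
    have "g \<cdot> (u \<ominus>\<^bsub>Hom T W Y\<^esub> v) = zmor T W Z"
      using cmp_minus_right[OF W t(3,4,6) u] eq cmp_closed[OF W t(3,4,6) u(2)]
        minus_eq_zmor_iff[OF W t(4), of "g \<cdot> v" "g \<cdot> v"] by simp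
    then obtain x where x: "x \<in> mor T W X" "f \<cdot> x = u \<ominus>\<^bsub>Hom T W Y\<^esub> v"
      using tri_factor_left[OF t(1) W minus_closed[OF W t(3) u]] by blast
    then have "u \<ominus>\<^bsub>Hom T W Y\<^esub> v = zmor T W Y"
      using orthD[OF o x(1)] cmp_zmor_right[OF W t(2,3,5)] by simp
    then show "u = v" using minus_eq_zmor_iff[OF W t(3) u] by blast
  qed
  then show ?thesis by (rule L.inj_fin_dim[OF fd])
qed

lemma fin_dim_contravariant_surj:
  assumes tr: "triangle X Y Z" and W: "W \<in> obj T" and o: "orth X W"
    and fd: "vectorspace.fin_dim K (Hom T Z W)"
  shows "vectorspace.fin_dim K (Hom T Y W)"
proof -
  obtain f g h where t: "(X, Y, Z, f, g, h) \<in> tri T" "X \<in> obj T" "Y \<in> obj T" "Z \<in> obj T"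
    "f \<in> mor T X Y" "g \<in> mor T Y Z" using tr by (rule triangleE)
  interpret L: linear_map K "Hom T Z W" "Hom T Y W" "\<lambda>u. u \<cdot> g"
    by (rule cmp_linear_left[OF t(3,4) W t(6)])
  have "u \<in> (\<lambda>u. u \<cdot> g) ` mor T Z W" if u: "u \<in> mor T Y W" for u
  proof -
    have "u \<cdot> f = zmor T X W" using orthD[OF o cmp_closed[OF t(2,3) W u t(5)]] .
    then show ?thesis using tri_factor_right[OF t(1) W u] by blast
  qed
  then have "(\<lambda>u. u \<cdot> g) ` mor T Z W = mor T Y W" by auto
  then show ?thesis by (rule L.surj_fin_dim[OF fd])
qed

lemma fin_dim_contravariant_inj:
  assumes tr: "triangle X Y Z" and W: "W \<in> obj T" and o: "orth Z W"
    and fd: "vectorspace.fin_dim K (Hom T X W)"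
  shows "vectorspace.fin_dim K (Hom T Y W)"
proof -
  obtain f g h where t: "(X, Y, Z, f, g, h) \<in> tri T" "X \<in> obj T" "Y \<in> obj T" "Z \<in> obj T"
    "f \<in> mor T X Y" "g \<in> mor T Y Z" using tr by (rule triangleE)
  interpret L: linear_map K "Hom T Y W" "Hom T X W" "\<lambda>u. u \<cdot> f"
    by (rule cmp_linear_left[OF t(2,3) W t(5)])
  have "inj_on (\<lambda>u. u \<cdot> f) (mor T Y W)"
  proof (rule inj_onI)
    fix u v assume u: "u \<in> mor T Y W" "v \<in> mor T Y W" and eq: "u \<cdot> f = v \<cdot> f"
    have "(u \<ominus>\<^bsub>Hom T Y W\<^esub> v) \<cdot> f = zmor T X W"
      using cmp_minus_left[OF t(2,3) W u t(5)] eq cmp_closed[OF t(2,3) W u(2) t(5)]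
        minus_eq_zmor_iff[OF t(2) W, of "v \<cdot> f" "v \<cdot> f"] by simp
    then obtain x where x: "x \<in> mor T Z W" "x \<cdot> g = u \<ominus>\<^bsub>Hom T Y W\<^esub> v"
      using tri_factor_right[OF t(1) W minus_closed[OF t(3) W u]] by blast
    then have "u \<ominus>\<^bsub>Hom T Y W\<^esub> v = zmor T Y W"
      using orthD[OF o x(1)] cmp_zmor_left[OF t(3,4) W t(6)] by simp
    then show "u = v" using minus_eq_zmor_iff[OF t(3) W u] by blast
  qed
  then show ?thesis by (rule L.inj_fin_dim[OF fd])
qed

lemma weight_structureD:
  assumes "weight_structure T w"
  shows "fst w \<subseteq> obj T" "snd w \<subseteq> obj T" "Karoubi_closed T (fst w)" "Karoubi_closed T (snd w)"
    and "X \<in> obj T \<Longrightarrow> \<exists>A\<in>snd w. \<exists>B\<in>fst w. triangle (shift T (- 1) A) X B"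
proof -
  note * = assms[unfolded weight_structure_def]
  show "fst w \<subseteq> obj T" "snd w \<subseteq> obj T" "Karoubi_closed T (fst w)" "Karoubi_closed T (snd w)"
    using * by simp_all
  have "\<forall>X\<in>obj T. \<exists>A\<in>shift_set T (- 1) (snd w). \<exists>B\<in>fst w. \<exists>f g h. (A, X, B, f, g, h) \<in> tri T"
    using * by simp
  then show "\<exists>A\<in>snd w. \<exists>B\<in>fst w. triangle (shift T (- 1) A) X B" if "X \<in> obj T"
    unfolding triangle_def using that by fast
qed

lemma retract_thick_hull:
  assumes ic: "idempotent_complete T" and "P \<subseteq> obj T" "set Xs \<subseteq> P" "is_biproduct T Xs Q" "retract T X Q"
  shows "X \<in> thick_subcat T hull P"
proof -
  have th: "thick_subcat T (thick_subcat T hull P)" by (rule thick_subcat_hull[OF assms(2)])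
  have "set Xs \<subseteq> thick_subcat T hull P" by (rule subset_trans[OF assms(3) hull_subset])
  then have "Q \<in> thick_subcat T hull P" by (rule thick_subcat_biproduct[OF th ic assms(4)])
  moreover have "direct_summand T X Q" by (rule retract_direct_summand[OF ic assms(5)])
  ultimately show ?thesis using th unfolding thick_subcat_def by simp
qed

end

text \<open>Supplies the pairwise non-isomorphic objects that a silting collection demands.\<close>

lemma (in linear_category) iso_representatives:
  assumes "finite F" "F \<subseteq> obj C"
  shows "\<exists>P\<subseteq>F. (\<forall>X\<in>F. \<exists>Y\<in>P. isomorphic C X Y) \<and> (\<forall>X\<in>P. \<forall>Y\<in>P. X \<noteq> Y \<longrightarrow> \<not> isomorphic C X Y)"
  using assms
proof (induction F rule: finite_induct)
  case empty then show ?case by blast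
next
  case (insert x F)
  then obtain P where P: "P \<subseteq> F" "\<forall>X\<in>F. \<exists>Y\<in>P. isomorphic C X Y"
    "\<forall>X\<in>P. \<forall>Y\<in>P. X \<noteq> Y \<longrightarrow> \<not> isomorphic C X Y" by auto
  show ?case
  proof (cases "\<exists>Y\<in>P. isomorphic C x Y")
    case True
    then show ?thesis using P by (intro exI[of _ P]) auto
  next
    case False
    then have "\<forall>Y\<in>P. \<not> isomorphic C Y x" using isomorphic_sym by blast
    moreover have "isomorphic C x x" using isomorphic_refl insert.prems by blast
    ultimately show ?thesis using P False by (intro exI[of _ "insert x P"]) auto
  qed
qed

section \<open>From an adjacent weight structure to a silting collection\<close>

context t_category
begin

text \<open>Decompose an object of the larger class by weights. In the first case the outer map out
  of \<open>A[-1]\<close> vanishes because \<open>X[1]\<close> has degree \<le> -1, in the second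
  the map into \<open>B[1]\<close> vanishes because that object has degree \<le> -1. Either way
  \<open>X\<close> is a retract of a piece of the right weight, and weight classes are
  Karoubi-closed.\<close>

lemma adjacent_weight_structure:
  assumes w: "weight_structure T w" and adj: "left_adjacent T w t"
  shows "fst w = fst t" "snd w = {X \<in> obj T. \<forall>A\<in>t_le T t (- 1). orth X A}"
proof -
  note o = weight_structureD(1,2)[OF w] and K = weight_structureD(3,4)[OF w]
    and dec = weight_structureD(5)[OF w]
  have "hom_zero T (snd w) (t_le T t (- 1))" "hom_zero T (fst w) (t_ge T t 1)"
    using adj unfolding left_adjacent_def by simp_all
  then have adj': "\<And>X A. X \<in> snd w \<Longrightarrow> A \<in> t_le T t (- 1) \<Longrightarrow> orth X A"
    "\<And>X B. X \<in> fst w \<Longrightarrow> B \<in> t_ge T t 1 \<Longrightarrow> orth X B"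
    using hom_zeroD by blast+
  have fst1: "fst w \<subseteq> fst t" using adj'(2) o fst_iff_orth by blast
  show fst_eq: "fst w = fst t"
  proof
    show "fst t \<subseteq> fst w"
    proof
      fix X assume X: "X \<in> fst t"
      have Xo: "X \<in> obj T" using X fst_obj by blast
      obtain A B where AB: "A \<in> snd w" "B \<in> fst w" and tr: "triangle (shift T (- 1) A) X B"
        using dec[OF Xo] by blast
      have Ao: "A \<in> obj T" using AB o by blast
      have "shift T 1 X \<in> t_le T t (- 1)" using X Xo by (simp add: shift_t_le_iff t_le_0)
      then have "orth (shift T (- 1) A) X" using adj'(1) AB Ao Xo by (simp add: orth_shift_left)
      then have "retract T X B" by (rule triangle_retract(2)[OF tr])
      then show "X \<in> fst w" using K(1) AB unfolding Karoubi_closed_def by blast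
    qed
  qed (rule fst1)
  show "snd w = {X \<in> obj T. \<forall>A\<in>t_le T t (- 1). orth X A}"
  proof
    show "snd w \<subseteq> {X \<in> obj T. \<forall>A\<in>t_le T t (- 1). orth X A}" using adj'(1) o by blast
    show "{X \<in> obj T. \<forall>A\<in>t_le T t (- 1). orth X A} \<subseteq> snd w"
    proof
      fix X assume X: "X \<in> {X \<in> obj T. \<forall>A\<in>t_le T t (- 1). orth X A}"
      have Xo: "X \<in> obj T" using X by blast
      \<comment> \<open>The decomposition of \<open>X[-1]\<close> is used so that, shifted back, it
        has \<open>A\<close> itself as its first term.\<close>
      obtain A B where AB: "A \<in> snd w" "B \<in> fst w" and tr: "triangle (shift T (- 1) A) (shift T (- 1) X) B"
        using dec[OF shift_obj[OF Xo]] by blast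
      have ABo: "A \<in> obj T" "B \<in> obj T" using AB o by blast+
      have "shift T 1 B \<in> t_le T t (- 1)" using AB fst1 ABo by (auto simp add: shift_t_le_iff t_le_0)
      then have "orth X (shift T 1 B)" using X by blast
      moreover have "triangle A X (shift T 1 B)" using triangle_shift[OF tr, of 1] Xo ABo by simp
      ultimately have "retract T X A" using triangle_retract(1) by blast
      then show "X \<in> snd w" using K(2) AB unfolding Karoubi_closed_def by blast
    qed
  qed
qed

lemma coheart_generates:
  assumes w: "weight_structure T w" and adj: "left_adjacent T w t"
    and bd: "t_bounded_above T t" and nd: "t_nondegenerate T t"
    and B: "B \<in> obj T" and o: "\<And>c m. c \<in> coheart w \<Longrightarrow> orth c (shift T m B)"
  shows "zero_object T B"
proof -
  note eq = adjacent_weight_structure[OF w adj]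
  note dec = weight_structureD(5)[OF w]
  have step: "B \<in> t_le T t (n - 1)" if n: "B \<in> t_le T t n" for n
  proof -
    let ?Y = "shift T n B"
    have Y: "?Y \<in> t_le T t 0" "?Y \<in> obj T" using n B by (simp_all add: shift_t_le_iff)
    obtain A C where AC: "A \<in> snd w" "C \<in> fst w" and tr: "triangle (shift T (- 1) A) (shift T (- 1) ?Y) C"
      using dec[OF shift_obj[OF Y(2)]] by blast
    have ACo: "A \<in> obj T" "C \<in> obj T" using AC eq fst_obj by auto
    have tr': "triangle A ?Y (shift T 1 C)" using triangle_shift[OF tr, of 1] B ACo by simp
    have C: "shift T 1 C \<in> t_le T t (- 1)" using AC eq(1) ACo by (simp add: shift_t_le_iff t_le_0)
    \<comment> \<open>\<open>A\<close> is the cocone of a map from degrees \<le> 0 to degrees \<le>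
      -1, so the weight part lies in the aisle and hence in the coheart. No maps from it to
      \<open>?Y\<close> then force \<open>?Y\<close> to be a retract of the part in degrees \<le>
      -1.\<close>
    then have "A \<in> t_le T t 0" using t_le_cocone[OF tr' Y(1)] by simp
    then have "A \<in> coheart w" using AC eq(1) unfolding coheart_def t_le_0 by simp
    then have "orth A ?Y" by (rule o)
    then have "retract T ?Y (shift T 1 C)" by (rule triangle_retract(2)[OF tr'])
    then have "?Y \<in> t_le T t (- 1)" using t_le_retract C by blast
    then show ?thesis using B by (simp add: shift_t_le_iff)
  qed
  obtain n where n: "B \<in> t_le T t n" using bd B unfolding t_bounded_above_def by blast
  have "B \<in> t_le T t (n - int k)" for k
  proof (induction k)
    case (Suc k)
    then show ?case using step[of "n - int k"] by (simp add: algebra_simps)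
  qed (use n in simp)
  then have "B \<in> t_le T t m" for m
    by (rule t_le_mono[of B "n - int (nat (n - m))" m]) simp
  then have "B \<in> (\<Inter>n. t_le T t n)" by blast
  then show ?thesis using nd unfolding t_nondegenerate_def by blast
qed

text \<open>For the non-trivial inclusions, truncate \<open>Y\<close> and show that the unwanted
  part receives no maps from any shift of \<open>P\<close>: on one side of a degree bound by the
  t-structure, on the other from the triangle and the condition on \<open>Y\<close>. The assumption
  \<open>gen\<close> says that \<open>P\<close> detects what the coheart detects, so
  \<open>coheart_generates\<close> makes that part zero.\<close>

lemma adjacent_coheart_silting:
  assumes w: "weight_structure T w" and adj: "left_adjacent T w t"
    and bd: "t_bounded_above T t" and nd: "t_nondegenerate T t"
    and PC: "P \<subseteq> coheart w"
    and gen: "\<And>Y c. Y \<in> obj T \<Longrightarrow> (\<And>p. p \<in> P \<Longrightarrow> orth p Y) \<Longrightarrow> c \<in> coheart w \<Longrightarrow> orth c Y"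
  shows "silting_t T P = t"
proof -
  note eq = adjacent_weight_structure[OF w adj]
  have co: "p \<in> obj T" "p \<in> t_le T t 0" if "p \<in> P" for p
    using that PC eq(1) fst_obj unfolding coheart_def t_le_0 by auto
  have p_le: "orth p A" if "p \<in> P" "A \<in> t_le T t (- 1)" for p A
    using that PC eq(2) unfolding coheart_def by auto
  have p_ge: "orth p B" if "p \<in> P" "B \<in> t_ge T t 1" for p B
    using t_le_ge_orth[OF co(2)[OF that(1)] that(2)] by simp
  have zero: "zero_object T B" if B: "B \<in> obj T" and o: "\<And>p m. p \<in> P \<Longrightarrow> orth p (shift T m B)" for B
    using coheart_generates[OF w adj bd nd B] gen[OF shift_obj[OF B]] o by blast
  have pos: "Y \<in> perp_pos T P \<longleftrightarrow> Y \<in> obj T \<and> (\<forall>m>0. \<forall>p\<in>P. orth p (shift T m Y))" for Y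
    unfolding perp_pos_def hom_zero_iff[of P] by blast
  have neg: "Y \<in> perp_neg T P \<longleftrightarrow> Y \<in> obj T \<and> (\<forall>m<0. \<forall>p\<in>P. orth p (shift T m Y))" for Y
    unfolding perp_neg_def hom_zero_iff[of P] by blast
  have "Y \<in> fst t" if Y: "Y \<in> perp_pos T P" for Y
  proof -
    have Yo: "Y \<in> obj T" and Yp: "\<And>m p. m > 0 \<Longrightarrow> p \<in> P \<Longrightarrow> orth p (shift T m Y)"
      using Y pos by blast+
    obtain A B where A: "A \<in> t_le T t 0" and B: "B \<in> t_ge T t 1" and tr: "triangle A Y B"
      using truncation[OF Yo, of 0] by auto
    have o: "A \<in> obj T" "B \<in> obj T" using A B t_le_obj t_ge_obj by auto
    have "orth p (shift T m B)" if p: "p \<in> P" for p m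
    proof (cases "m \<le> 0")
      case True
      then have "shift T m B \<in> t_ge T t 1" using B o t_ge_antimono[OF B, of "1 + m"]
        by (simp add: shift_t_ge_iff)
      then show ?thesis using p_ge p by blast
    next
      case False
      have tr': "triangle (shift T m Y) (shift T m B) (shift T (1 + m) A)"
        using triangle_shift[OF triangle_rotate[OF tr], of m] o by (simp add: add.commute)
      have "shift T (1 + m) A \<in> t_le T t (- 1)"
        using t_le_mono[OF A, of m] False o by (simp add: shift_t_le_iff)
      then show ?thesis
        using triangle_orth_right[OF tr' Yp p_le] False p co by simp
    qed
    then have "isomorphic T A Y" using triangle_zero_iso[OF tr zero] o by blast
    then show ?thesis
      using t_le_retract[OF isomorphic_retract[OF isomorphic_sym] A] unfolding t_le_0 by blast
  qed
  moreover have "Y \<in> perp_pos T P" if Y: "Y \<in> fst t" for Y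
  proof -
    have Yo: "Y \<in> obj T" using Y fst_obj by blast
    have "shift T m Y \<in> t_le T t (- 1)" if "m > 0" for m
      using t_le_mono[of Y 0 "m - 1"] Y Yo that by (simp add: shift_t_le_iff t_le_0)
    then show ?thesis using pos Yo p_le by blast
  qed
  ultimately have 1: "perp_pos T P = fst t" by blast
  have "Y \<in> snd t" if Y: "Y \<in> perp_neg T P" for Y
  proof -
    have Yo: "Y \<in> obj T" and Yp: "\<And>m p. m < 0 \<Longrightarrow> p \<in> P \<Longrightarrow> orth p (shift T m Y)"
      using Y neg by blast+
    obtain A B where A: "A \<in> t_le T t (- 1)" and B: "B \<in> t_ge T t 0" and tr: "triangle A Y B"
      using truncation[OF Yo, of "- 1"] by auto
    have o: "A \<in> obj T" "B \<in> obj T" using A B t_le_obj t_ge_obj by auto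
    have "orth p (shift T m A)" if p: "p \<in> P" for p m
    proof (cases "m \<ge> 0")
      case True
      then have "shift T m A \<in> t_le T t (- 1)" using o t_le_mono[OF A, of "m - 1"]
        by (simp add: shift_t_le_iff)
      then show ?thesis using p_le p by blast
    next
      case False
      have tr': "triangle (shift T (m - 1) B) (shift T m A) (shift T m Y)"
        using triangle_shift[OF triangle_rotate_back[OF tr], of m] o by simp
      have "shift T (m - 1) B \<in> t_ge T t 1"
        using t_ge_antimono[OF B, of m] False o by (simp add: shift_t_ge_iff)
      then show ?thesis
        using triangle_orth_right[OF tr' p_ge Yp] False p co by simp
    qed
    then have "isomorphic T Y B" using triangle_zero_left_iso[OF tr zero] o by blast
    then show ?thesis
      using t_ge_retract[OF isomorphic_retract B] unfolding t_ge_0 by blast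
  qed
  moreover have "Y \<in> perp_neg T P" if Y: "Y \<in> snd t" for Y
  proof -
    have Yo: "Y \<in> obj T" using Y snd_obj by blast
    have "shift T m Y \<in> t_ge T t 1" if "m < 0" for m
      using t_ge_antimono[of Y 0 "m + 1"] Y Yo that by (simp add: shift_t_ge_iff t_ge_0 add.commute)
    then show ?thesis using neg Yo p_ge by blast
  qed
  ultimately have "perp_neg T P = snd t" by blast
  then show ?thesis using 1 unfolding silting_t_def by simp
qed

text \<open>With \<open>h\<close> and \<open>H\<close> the degree-zero cohomology of
  \<open>p\<close> and \<open>X\<close>, the space \<open>Hom(h, H)\<close> surjects onto
  \<open>Hom(p, H)\<close>, into which \<open>Hom(p, A)\<close> embeds, and \<open>Hom(p, A)\<close>
  surjects onto \<open>Hom(p, X)\<close>.\<close>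

lemma adjacent_coheart_fin_dim:
  assumes w: "weight_structure T w" and adj: "left_adjacent T w t"
    and hf: "Hom_finite K (full T (heart t))" and p: "p \<in> coheart w" and X: "X \<in> obj T"
  shows "vectorspace.fin_dim K (Hom T p X)"
proof -
  note eq = adjacent_weight_structure[OF w adj]
  have p0: "p \<in> t_le T t 0" "p \<in> obj T" using p eq(1) fst_obj unfolding coheart_def t_le_0 by auto
  have p_le: "orth p A" if "A \<in> t_le T t (- 1)" for A
    using that p eq(2) unfolding coheart_def by auto
  obtain A B where A: "A \<in> t_le T t 0" and B: "B \<in> t_ge T t 1" and tr: "triangle A X B"
    using truncation[OF X, of 0] by auto
  have Ao: "A \<in> obj T" using A t_le_obj by blast
  obtain A' H where A': "A' \<in> t_le T t (- 1)" and H: "H \<in> t_ge T t 0" and tr': "triangle A' A H"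
    using truncation[OF Ao, of "- 1"] by auto
  have Hh: "H \<in> heart t"
    using t_le_cone[OF tr' A] t_le_mono[OF A', of 1] H heart_iff by simp
  obtain Q h where Q: "Q \<in> t_le T t (- 1)" and h: "h \<in> t_ge T t 0" and trp: "triangle Q p h"
    using truncation[OF p0(2), of "- 1"] by auto
  have hh: "h \<in> heart t"
    using t_le_cone[OF trp p0(1)] t_le_mono[OF Q, of 1] h heart_iff by simp
  have "vectorspace.fin_dim K (Hom T h H)"
    using hf Hh hh unfolding Hom_finite_def by simp
  then have "vectorspace.fin_dim K (Hom T p H)"
    using fin_dim_contravariant_surj[OF trp _ t_le_ge_orth[OF Q H]] t_ge_obj[OF H] by simp
  then have "vectorspace.fin_dim K (Hom T p A)"
    using fin_dim_covariant_inj[OF tr' p0(2) p_le[OF A']] by blast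
  then show ?thesis
    using fin_dim_covariant_surj[OF tr p0(2) t_le_ge_orth[OF p0(1) B]] by simp
qed

text \<open>Krull-Schmidt decompositions consist of objects with local endomorphism rings; these are
  indecomposable in the coheart and can be replaced by representatives. So every coheart object is a
  finite sum of objects of \<open>P\<close>, which identifies the coheart with the additive closure
  and gives equal thick hulls.\<close>

lemma adjacent_coheart_collection:
  assumes ic: "idempotent_complete T"
    and w: "weight_structure T w" and adj: "left_adjacent T w t"
    and bd: "t_bounded_above T t" and nd: "t_nondegenerate T t"
    and KS: "Krull_Schmidt (full T (coheart w))"
    and fin: "finite_up_to_iso T {X. indecomposable (full T (coheart w)) X}"
  shows "\<exists>P\<subseteq>coheart w. finite P \<and> silting_collection T P \<and>
    thick_subcat T hull P = thick_subcat T hull coheart w \<and> silting_t T P = t"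
proof -
  note eq = adjacent_weight_structure[OF w adj]
  let ?C = "coheart w"
  have C: "X \<in> ?C \<longleftrightarrow> X \<in> obj T \<and> (\<forall>B\<in>t_ge T t 1. orth X B) \<and> (\<forall>A\<in>t_le T t (- 1). orth X A)" for X
    unfolding coheart_def eq using fst_iff_orth by blast
  have Co: "?C \<subseteq> obj T" using C by blast
  have C_retract: "X \<in> ?C" if r: "retract T X Y" and Y: "Y \<in> ?C" for X Y
    unfolding C using retract_obj[OF r] orth_retract_left[OF r] Y[unfolded C] t_ge_obj t_le_obj by blast
  have C_biprod: "Q \<in> ?C" if b: "is_biproduct T Xs Q" and Xs: "set Xs \<subseteq> ?C" for Xs Q
  proof -
    have "orth Q B" if "B \<in> t_ge T t 1" for B
      using biproduct_orth_left[OF b t_ge_obj[OF that]] Xs C that by blast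
    moreover have "orth Q A" if "A \<in> t_le T t (- 1)" for A
      using biproduct_orth_left[OF b t_le_obj[OF that]] Xs C that by blast
    ultimately show ?thesis unfolding C using biproduct_obj(1)[OF b] by blast
  qed
  obtain F where F: "finite F" "F \<subseteq> {X. indecomposable (full T ?C) X}"
    "\<And>X. indecomposable (full T ?C) X \<Longrightarrow> \<exists>Y\<in>F. isomorphic T X Y"
    using fin unfolding finite_up_to_iso_def by blast
  have FC: "F \<subseteq> ?C" using F(2) unfolding indecomposable_def by auto
  obtain P where P: "P \<subseteq> F" "\<And>X. X \<in> F \<Longrightarrow> \<exists>Y\<in>P. isomorphic T X Y"
    "\<forall>X\<in>P. \<forall>Y\<in>P. X \<noteq> Y \<longrightarrow> \<not> isomorphic T X Y"
    using iso_representatives[OF F(1)] FC Co by (meson subset_trans)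
  have PC: "P \<subseteq> ?C" using P(1) FC by blast
  have finP: "finite P" using P(1) F(1) by (rule finite_subset)
  have lcC: "linear_category K (full T ?C)" by (rule linear_category_full[OF Co])
  have decomp: "\<exists>Ps. set Ps \<subseteq> P \<and> is_biproduct T Ps X" if X: "X \<in> ?C" for X
  proof -
    obtain Xs where Xs: "is_biproduct (full T ?C) Xs X" "\<forall>Y\<in>set Xs. local_ring (End_ring T Y)"
      using KS X unfolding Krull_Schmidt_def by auto
    have b: "is_biproduct T Xs X" "set Xs \<subseteq> ?C" using Xs(1) is_biproduct_full_iff[OF Co] by blast+
    have "\<exists>p\<in>P. isomorphic T Y p" if Y: "Y \<in> set Xs" for Y
    proof -
      have "indecomposable (full T ?C) Y"
        using linear_category.local_indecomposable[OF lcC, of Y] Y b Xs by auto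
      then obtain Z where "Z \<in> F" "isomorphic T Y Z" using F(3) by blast
      then show ?thesis using P(2) isomorphic_trans by blast
    qed
    then obtain r where r: "\<And>Y. Y \<in> set Xs \<Longrightarrow> r Y \<in> P \<and> isomorphic T Y (r Y)" by metis
    have "is_biproduct T (map r Xs) X"
      by (rule biproduct_isomorphic[OF b(1)]) (use r in auto)
    moreover have "set (map r Xs) \<subseteq> P" using r by auto
    ultimately show ?thesis by blast
  qed
  \<comment> \<open>Indecomposability is given inside the coheart; it carries over to
    \<open>T\<close> because the summands of a coheart object are again in the coheart.\<close>
  have ind: "indecomposable T p" if p: "p \<in> P" for p
  proof -
    have i: "indecomposable (full T ?C) p" using p P(1) F(2) by blast
    have pC: "p \<in> ?C" using p PC by blast
    have "zero_object T Y \<or> zero_object T Z" if b: "is_biproduct T [Y, Z] p" for Y Z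
    proof -
      have "Y \<in> ?C" "Z \<in> ?C" using is_biproduct_pair_retract[OF b] C_retract pC by blast+
      then have "is_biproduct (full T ?C) [Y, Z] p" using is_biproduct_full_iff[OF Co] b pC by auto
      then have "zero_object (full T ?C) Y \<or> zero_object (full T ?C) Z"
        using i unfolding indecomposable_def by blast
      then show ?thesis using zero_object_full_iff[OF Co] by blast
    qed
    moreover have "\<not> zero_object T p"
      using i pC zero_object_full_iff[OF Co] unfolding indecomposable_def by blast
    ultimately show ?thesis using pC Co unfolding indecomposable_def by blast
  qed
  have "orth c Y" if Y: "Y \<in> obj T" "\<And>p. p \<in> P \<Longrightarrow> orth p Y" and c: "c \<in> ?C" for Y c
  proof -
    obtain Ps where "set Ps \<subseteq> P" "is_biproduct T Ps c" using decomp[OF c] by blast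
    then show ?thesis using biproduct_orth_left[of Ps c Y] Y by blast
  qed
  then have st: "silting_t T P = t"
    by (rule adjacent_coheart_silting[OF w adj bd nd PC])
  obtain N where N: "zero_object T N" using zero_exists by blast
  have addP: "add_closure T P = ?C"
  proof
    show "add_closure T P \<subseteq> ?C"
      unfolding add_closure_def using C_retract[OF direct_summand_retract C_biprod] PC by blast
    show "?C \<subseteq> add_closure T P"
    proof
      fix X assume X: "X \<in> ?C"
      then obtain Ps where "set Ps \<subseteq> P" "is_biproduct T Ps X" using decomp by blast
      moreover have "direct_summand T X X"
        unfolding direct_summand_def using is_biproduct_zeroI[OF _ N] X Co by blast
      ultimately show "X \<in> add_closure T P" unfolding add_closure_def by blast
    qed
  qed
  have "silting_collection T P"
    unfolding silting_collection_def addP st using ind P(3) KS t_str by blast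
  moreover have "thick_subcat T hull P = thick_subcat T hull ?C"
  proof
    show "thick_subcat T hull P \<subseteq> thick_subcat T hull ?C" by (rule hull_mono[OF PC])
    have Po: "P \<subseteq> obj T" using PC Co by blast
    have "X \<in> thick_subcat T hull P" if X: "X \<in> ?C" for X
    proof -
      obtain Ps where "set Ps \<subseteq> P" "is_biproduct T Ps X" using decomp[OF X] by blast
      then show ?thesis
        using retract_thick_hull[OF ic Po] isomorphic_retract[OF isomorphic_refl] X Co by blast
    qed
    then show "thick_subcat T hull ?C \<subseteq> thick_subcat T hull P"
      using hull_minimal thick_subcat_hull[OF Po] by (metis subsetI)
  qed
  ultimately show ?thesis using PC finP st by blast
qed

end

section \<open>Finite silting collections\<close>

context triangulated_category
begin

text \<open>The octahedral axiom for the composite \<open>X -> Y -> B\<close>: its cocone is an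
  extension of the cocones \<open>A\<close> and \<open>Q\<close> of the two factors.\<close>

lemma triangle_comp:
  assumes QXY: "triangle Q X Y" and AYB: "triangle A Y B"
  shows "\<exists>E. triangle E X B \<and> triangle Q E A"
proof -
  obtain q f i where 1: "(X, Y, sh T Q, f, i, q) \<in> tri T"
    using triangle_rotate[OF QXY] unfolding triangle_def shift_1 by blast
  obtain j g j' where 2: "(Y, B, sh T A, g, j, j') \<in> tri T"
    using triangle_rotate[OF AYB] unfolding triangle_def shift_1 by blast
  note t = tri_typed[OF 1] tri_typed[OF 2]
  have gf: "g \<cdot> f \<in> mor T X B" using cmp_closed[of X Y B g f] t by blast
  obtain W k k' where 3: "(X, B, W, g \<cdot> f, k, k') \<in> tri T" using tri_cone[of X B "g \<cdot> f"] gf t by blast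
  have "triangle (sh T Q) W (sh T A)"
    using tri_octahedron[OF 1 2 3] unfolding triangle_def by blast
  then have "triangle Q (shift T (- 1) W) A"
    using triangle_shift[of "sh T Q" W "sh T A" "- 1"] triangle_obj[OF QXY] triangle_obj[OF AYB]
    by (simp flip: shift_1)
  moreover have "triangle (shift T (- 1) W) X B" using triangle_rotate_back[OF triangleI[OF 3]] .
  ultimately show ?thesis by blast
qed

text \<open>\<open>Q\<close> contains one copy of \<open>p\<close> for each element of a finite
  spanning set of \<open>Hom(p, X)\<close>, and \<open>ev\<close> evaluates it. The maps that lift
  through \<open>ev\<close> form a subspace containing the spanning set, so all maps from
  \<open>P\<close> lift.\<close>

lemma approximation:
  assumes finP: "finite P" and Po: "P \<subseteq> obj T" and X: "X \<in> obj T"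
    and fd: "\<And>p. p \<in> P \<Longrightarrow> vectorspace.fin_dim K (Hom T p X)"
  shows "\<exists>Xs Q ev. set Xs \<subseteq> P \<and> is_biproduct T Xs Q \<and> ev \<in> mor T Q X \<and>
    (\<forall>p\<in>P. \<forall>u\<in>mor T p X. \<exists>v\<in>mor T p Q. ev \<cdot> v = u)"
proof -
  have "\<exists>B. finite B \<and> B \<subseteq> mor T p X \<and> module.span K (Hom T p X) B = mor T p X" if "p \<in> P" for p
    using fd[OF that] vectorspace.fin_dim_def[OF Hom_vectorspace, of p X] that Po X by auto
  then obtain B where B: "\<And>p. p \<in> P \<Longrightarrow> finite (B p)" "\<And>p. p \<in> P \<Longrightarrow> B p \<subseteq> mor T p X"
    "\<And>p. p \<in> P \<Longrightarrow> module.span K (Hom T p X) (B p) = mor T p X"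
    by metis
  have "finite (Sigma P B)" using finP B(1) by blast
  then obtain ps where ps: "set ps = Sigma P B" using finite_list by blast
  have Xs: "set (map fst ps) \<subseteq> P" using ps by auto
  then obtain Q where Q: "is_biproduct T (map fst ps) Q"
    using additive Po unfolding additive_category_def by (meson subset_trans)
  have "snd (ps ! i) \<in> mor T (map fst ps ! i) X" if "i < length (map fst ps)" for i
  proof -
    have "ps ! i \<in> Sigma P B" using that ps by (metis length_map nth_mem)
    then obtain p b where "ps ! i = (p, b)" "p \<in> P" "b \<in> B p" by blast
    then show ?thesis using that B(2)[of p] by auto
  qed
  then obtain ev where ev: "ev \<in> mor T Q X"
    "\<forall>i<length (map fst ps). \<exists>v\<in>mor T (map fst ps ! i) Q. ev \<cdot> v = snd (ps ! i)"
    using biproduct_copair[OF Q X, of "\<lambda>i. snd (ps ! i)"] by blast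
  have Qo: "Q \<in> obj T" using biproduct_obj(1)[OF Q] .
  have "\<exists>v\<in>mor T p Q. ev \<cdot> v = u" if p: "p \<in> P" and u: "u \<in> mor T p X" for p u
  proof -
    have po: "p \<in> obj T" using p Po by blast
    interpret L: linear_map K "Hom T p Q" "Hom T p X" "\<lambda>v. ev \<cdot> v"
      by (rule cmp_linear_right[OF po Qo X ev(1)])
    have "B p \<subseteq> L.imT"
    proof
      fix b assume "b \<in> B p"
      then have "(p, b) \<in> set ps" using ps p by blast
      then obtain i where i: "i < length ps" "ps ! i = (p, b)" by (meson in_set_conv_nth)
      then have "\<exists>v\<in>mor T p Q. ev \<cdot> v = b" using ev(2) by fastforce
      then show "b \<in> L.imT" unfolding L.im_def by blast
    qed
    moreover have "submodule K L.imT (Hom T p X)" using L.imT_is_subspace L.W.is_module by blast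
    ultimately have "L.W.module.span (B p) \<subseteq> L.imT" by (rule L.W.module.span_is_subset)
    then have "u \<in> L.imT" using B(3)[OF p] u by auto
    then show ?thesis unfolding L.im_def by blast
  qed
  then show ?thesis using Xs Q ev(1) by blast
qed

end

locale finite_silting = triangulated_category K T
  for K :: "('k, 'r) ring_scheme" and T :: "('o, 'm, 'k, 'z) tri_cat_scheme" (structure) +
  fixes P :: "'o set"
  assumes idem: "idempotent_complete T"
    and finite_P: "finite P"
    and silting: "silting_collection T P"
    and Hom_P_fin_dim: "\<lbrakk>p \<in> P; X \<in> obj T\<rbrakk> \<Longrightarrow> vectorspace.fin_dim K (Hom T p X)"
    and bounded_above: "obj T = (\<Union>n. t_le T (silting_t T P) n)"

sublocale finite_silting \<subseteq> t_category K T "silting_t T P"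
  using silting by unfold_locales (simp add: silting_collection_def)

section \<open>Degrees detected by a silting collection\<close>

context finite_silting
begin

abbreviation t where "t \<equiv> silting_t T P"

lemma P_indecomposable: "p \<in> P \<Longrightarrow> indecomposable T p"
  using silting unfolding silting_collection_def by blast

lemma P_obj: "P \<subseteq> obj T"
  using P_indecomposable unfolding indecomposable_def by blast

lemma t_le_silting: "X \<in> t_le T t n \<longleftrightarrow> X \<in> obj T \<and> (\<forall>m>n. \<forall>p\<in>P. orth p (shift T m X))"
proof -
  have 1: "Y \<in> fst t \<longleftrightarrow> Y \<in> obj T \<and> (\<forall>m>0. \<forall>p\<in>P. orth p (shift T m Y))" for Y
    unfolding silting_t_def fst_conv perp_pos_def hom_zero_iff[of P] by blast
  have "(\<forall>m>0. \<forall>p\<in>P. orth p (shift T m (shift T n X))) \<longleftrightarrow> (\<forall>m>n. \<forall>p\<in>P. orth p (shift T m X))"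
    if "X \<in> obj T"
  proof
    assume a: "\<forall>m>0. \<forall>p\<in>P. orth p (shift T m (shift T n X))"
    have "orth p (shift T m X)" if "m > n" "p \<in> P" for m p
      using a[rule_format, of "m - n" p] that \<open>X \<in> obj T\<close> by simp
    then show "\<forall>m>n. \<forall>p\<in>P. orth p (shift T m X)" by blast
  qed (use that in simp)
  then show ?thesis unfolding t_le_iff 1 by auto
qed

lemma t_ge_silting: "X \<in> t_ge T t n \<longleftrightarrow> X \<in> obj T \<and> (\<forall>m<n. \<forall>p\<in>P. orth p (shift T m X))"
proof -
  have 1: "Y \<in> snd t \<longleftrightarrow> Y \<in> obj T \<and> (\<forall>m<0. \<forall>p\<in>P. orth p (shift T m Y))" for Y
    unfolding silting_t_def snd_conv perp_neg_def hom_zero_iff[of P] by blast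
  have "(\<forall>m<0. \<forall>p\<in>P. orth p (shift T m (shift T n X))) \<longleftrightarrow> (\<forall>m<n. \<forall>p\<in>P. orth p (shift T m X))"
    if "X \<in> obj T"
  proof
    assume a: "\<forall>m<0. \<forall>p\<in>P. orth p (shift T m (shift T n X))"
    have "orth p (shift T m X)" if "m < n" "p \<in> P" for m p
      using a[rule_format, of "m - n" p] that \<open>X \<in> obj T\<close> by simp
    then show "\<forall>m<n. \<forall>p\<in>P. orth p (shift T m X)" by blast
  qed (use that in simp)
  then show ?thesis unfolding t_ge_iff 1 by auto
qed

lemma P_orth_shift: "p \<in> P \<Longrightarrow> X \<in> t_le T t n \<Longrightarrow> n < m \<Longrightarrow> orth p (shift T m X)"
  using t_le_silting by blast

lemma P_orth: "p \<in> P \<Longrightarrow> X \<in> t_le T t (- 1) \<Longrightarrow> orth p X"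
  using P_orth_shift[of p X "- 1" 0] by simp

text \<open>An object in degrees \<ge> 1 receives no unshifted map from \<open>P\<close>, so
  \<open>p\<close> is a retract of its own truncation. In particular \<open>P\<close> has no
  positive self-extensions.\<close>

lemma P_t_le:
  assumes p: "p \<in> P" shows "p \<in> t_le T t 0"
proof -
  have po: "p \<in> obj T" using p P_obj by blast
  obtain A B where A: "A \<in> t_le T t 0" and B: "B \<in> t_ge T t 1" and tr: "triangle A p B"
    using truncation[OF po, of 0] by auto
  have "\<forall>m<1. \<forall>p\<in>P. orth p (shift T m B)" using t_ge_silting B by blast
  from this[rule_format, of 0 p] have "retract T p A" using triangle_retract(1)[OF tr] p by simp
  then show ?thesis using t_le_retract A by blast
qed

text \<open>The vanishing for all shifts is the defining condition of degrees \<le> 0 and of degrees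
  \<ge> 1 simultaneously.\<close>

lemma orth_P_zero:
  assumes "X \<in> obj T" "\<And>m p. p \<in> P \<Longrightarrow> orth p (shift T m X)"
  shows "zero_object T X"
proof -
  have "X \<in> t_le T t 0" "X \<in> t_ge T t 1" using assms t_le_silting t_ge_silting by auto
  then show ?thesis using t_le_ge_zero by simp
qed

lemma nondegenerate: "t_nondegenerate T t"
  unfolding t_nondegenerate_def
proof (intro conjI equalityI subsetI)
  fix X assume "X \<in> (\<Inter>n. t_le T t n)"
  then have X: "X \<in> t_le T t n" for n by blast
  have "zero_object T X"
  proof (rule orth_P_zero[OF t_le_obj[OF X]])
    show "orth p (shift T m X)" if "p \<in> P" for m p by (rule P_orth_shift[OF that X[of "m - 1"]]) simp
  qed
  then show "X \<in> {X. zero_object T X}" by blast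
next
  fix X assume "X \<in> (\<Inter>n. t_ge T t n)"
  then have X: "X \<in> t_ge T t n" for n by blast
  have "zero_object T X"
  proof (rule orth_P_zero[OF t_ge_obj[OF X]])
    show "orth p (shift T m X)" if "p \<in> P" for m p using X[of "m + 1"] that t_ge_silting by simp
  qed
  then show "X \<in> {X. zero_object T X}" by blast
qed (use zero_object_t in blast)+

text \<open>\<open>Y\<close> is the cone of an approximation. A map \<open>p -> Y\<close> lifts to
  \<open>X\<close> because \<open>p\<close> has no maps to \<open>Q[1]\<close>, then lifts to
  \<open>Q\<close> by the approximation property, and the composite \<open>Q -> X -> Y\<close> is
  zero. Hence degree 0 of \<open>Y\<close> is gone.\<close>

lemma silting_approximation:
  assumes X: "X \<in> t_le T t 0"
  shows "\<exists>Xs Q Y. set Xs \<subseteq> P \<and> is_biproduct T Xs Q \<and> triangle Q X Y \<and> Y \<in> t_le T t (- 1)"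
proof -
  note Xo = t_le_obj[OF X]
  obtain Xs Q ev where Q: "set Xs \<subseteq> P" "is_biproduct T Xs Q" and ev: "ev \<in> mor T Q X"
    and lift: "\<And>p u. p \<in> P \<Longrightarrow> u \<in> mor T p X \<Longrightarrow> \<exists>v\<in>mor T p Q. ev \<cdot> v = u"
    using approximation[OF finite_P P_obj Xo Hom_P_fin_dim[OF _ Xo]] by blast
  have Qo: "Q \<in> obj T" using biproduct_obj(1)[OF Q(2)] .
  have "orth Q B" if "B \<in> t_ge T t 1" for B
    using biproduct_orth_left[OF Q(2) t_ge_obj[OF that]] t_le_ge_orth[OF P_t_le that] Q(1) by auto
  then have Q0: "Q \<in> t_le T t 0" using t_le_iff_orth[of Q 0] Qo by simp
  obtain Y g h where tr: "(Q, X, Y, ev, g, h) \<in> tri T" using tri_cone[OF Qo Xo ev] by blast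
  note tt = tri_typed[OF tr]
  have Y0: "Y \<in> t_le T t 0" using t_le_cone[OF triangleI[OF tr] X] t_le_mono[OF Q0, of 1] by simp
  have "orth p Y" if p: "p \<in> P" for p
  proof -
    have po: "p \<in> obj T" using p P_obj by blast
    have sQ: "sh T Q \<in> obj T" using Qo sh_obj by blast
    show ?thesis
    proof (rule orthI[OF po])
      fix u assume u: "u \<in> mor T p Y"
      have "orth p (sh T Q)" using P_orth_shift[OF p Q0, of 1] by (simp add: shift_1)
      then have "h \<cdot> u = zmor T p (sh T Q)" using orthD cmp_closed[OF po _ sQ _ u] tt by blast
      then obtain v where v: "v \<in> mor T p X" "g \<cdot> v = u"
        using tri_factor_left[OF tri_rotate_fwd[OF tr] po u] by blast
      obtain v' where v': "v' \<in> mor T p Q" "ev \<cdot> v' = v" using lift[OF p v(1)] by blast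
      have "g \<cdot> v = (g \<cdot> ev) \<cdot> v'" using cmp_assoc[OF po Qo Xo _ v'(1) ev, of Y g] v' tt by simp
      then show "u = zmor T p Y"
        using tri_comp_zero[OF tr] v cmp_zmor_left[OF po Qo _ v'(1), of Y] tt by simp
    qed (use tt in blast)
  qed
  then have "orth p (shift T m Y)" if "m > - 1" "p \<in> P" for m p
    using P_orth_shift[OF that(2) Y0, of m] that by (cases "m = 0") auto
  then have "Y \<in> t_le T t (- 1)" using t_le_silting tt by blast
  then show ?thesis using Q triangleI[OF tr] by blast
qed

text \<open>Killing the maps from \<open>P\<close> into the top degree of \<open>X\<close>, one degree at a time.\<close>

lemma silting_weight_decomposition:
  assumes "X \<in> t_le T t (int k)"
  shows "\<exists>A B. triangle A X B \<and> B \<in> t_le T t 0 \<and> (\<forall>Y\<in>t_le T t 0. orth A Y)"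
  using assms
proof (induction k arbitrary: X)
  case 0
  obtain N where N: "zero_object T N" using zero_exists by blast
  have Xo: "X \<in> obj T" using 0 t_le_obj by blast
  have "triangle N X X" using triangleI[OF tri_zero_id[OF Xo N]] .
  moreover have "orth N Y" if "Y \<in> t_le T t 0" for Y using zero_object_orth(1)[OF N t_le_obj[OF that]] .
  moreover have "X \<in> t_le T t 0" using 0 by simp
  ultimately show ?case by blast
next
  case (Suc k)
  let ?n = "int (Suc k)"
  have Xo: "X \<in> obj T" using Suc.prems t_le_obj by blast
  have "shift T ?n X \<in> t_le T t 0" using Suc.prems Xo shift_t_le_iff[of X ?n 0] by simp
  then obtain Xs Q Y where Q: "set Xs \<subseteq> P" "is_biproduct T Xs Q" and tr: "triangle Q (shift T ?n X) Y"
    and Y: "Y \<in> t_le T t (- 1)" using silting_approximation by blast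
  have o: "Q \<in> obj T" "Y \<in> obj T" using triangle_obj[OF tr] by auto
  have tr': "triangle (shift T (- ?n) Q) X (shift T (- ?n) Y)"
    using triangle_shift[OF tr, of "- ?n"] Xo by simp
  have "shift T (- ?n) Y \<in> t_le T t (int k)" using Y o by (simp add: shift_t_le_iff)
  then obtain A B where AB: "triangle A (shift T (- ?n) Y) B" "B \<in> t_le T t 0" "\<And>Y. Y \<in> t_le T t 0 \<Longrightarrow> orth A Y"
    using Suc.IH by blast
  \<comment> \<open>Glues the approximation to the decomposition of its cone: \<open>E\<close> is an
    extension of \<open>A\<close> by the shift of \<open>Q\<close>, and neither of these has maps
    into the aisle.\<close>
  obtain E where E: "triangle E X B" "triangle (shift T (- ?n) Q) E A"
    using triangle_comp[OF tr' AB(1)] by blast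
  have "orth E Z" if Z: "Z \<in> t_le T t 0" for Z
  proof (rule triangle_orth_left[OF E(2) _ AB(3)[OF Z] t_le_obj[OF Z]])
    have Zo: "Z \<in> obj T" using Z t_le_obj by blast
    have "orth Q (shift T ?n Z)"
      by (rule biproduct_orth_left[OF Q(2) shift_obj[OF Zo]]) (rule P_orth_shift[OF _ Z], use Q(1) in auto)
    then show "orth (shift T (- ?n) Q) Z" using orth_shift_left[OF o(1) Zo, of "- ?n"] by (simp only: minus_minus)
  qed
  then show ?case using E(1) AB(2) by blast
qed

text \<open>By \<open>adjacent_weight_structure\<close> this is the only candidate for a weight
  structure left adjacent to \<open>t\<close>.\<close>

definition silting_w :: "'o set \<times> 'o set"
  where "silting_w = (fst t, {X \<in> obj T. \<forall>A\<in>t_le T t (- 1). orth X A})"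

lemma coheart_silting_w_iff:
  "X \<in> coheart silting_w \<longleftrightarrow> X \<in> t_le T t 0 \<and> (\<forall>A\<in>t_le T t (- 1). orth X A)"
  unfolding coheart_def silting_w_def t_le_0 using fst_obj by auto

lemma weight_structure_silting_w: "weight_structure T silting_w"
  unfolding weight_structure_def
proof (intro conjI ballI)
  show "fst silting_w \<subseteq> obj T" "snd silting_w \<subseteq> obj T"
    unfolding silting_w_def using fst_obj by auto
  show "Karoubi_closed T (fst silting_w)"
    unfolding silting_w_def Karoubi_closed_def fst_conv t_le_0[symmetric] using t_le_retract by blast
  show "Karoubi_closed T (snd silting_w)"
    unfolding silting_w_def Karoubi_closed_def snd_conv
  proof (intro ballI allI impI)
    fix X Y assume Y: "Y \<in> {X \<in> obj T. \<forall>A\<in>t_le T t (- 1). orth X A}" and r: "retract T X Y"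
    have "orth X A" if A: "A \<in> t_le T t (- 1)" for A
      using orth_retract_left[OF r _ t_le_obj[OF A]] Y A by blast
    then show "X \<in> {X \<in> obj T. \<forall>A\<in>t_le T t (- 1). orth X A}" using retract_obj(1)[OF r] by blast
  qed
  show "shift_set T 1 (fst silting_w) \<subseteq> fst silting_w"
    unfolding silting_w_def using fst_shift by auto
  have snd_orth: "orth (shift T (- 1) X) A" if X: "X \<in> snd silting_w" and A: "A \<in> t_le T t 0" for X A
  proof -
    have o: "X \<in> obj T" "A \<in> obj T" using X A t_le_obj unfolding silting_w_def by auto
    have "shift T 1 A \<in> t_le T t (- 1)" using A o by (simp add: shift_t_le_iff)
    then have "orth X (shift T 1 A)" using X unfolding silting_w_def by simp
    then show ?thesis using orth_shift_left[OF o, of "- 1"] by simp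
  qed
  show "shift_set T (- 1) (snd silting_w) \<subseteq> snd silting_w"
  proof
    fix Y assume "Y \<in> shift_set T (- 1) (snd silting_w)"
    then obtain X where X: "X \<in> snd silting_w" "Y = shift T (- 1) X" by blast
    have "X \<in> obj T" using X unfolding silting_w_def by simp
    then have "Y \<in> obj T" using X by simp
    moreover have "orth Y A" if "A \<in> t_le T t (- 1)" for A
      using snd_orth[OF X(1)] t_le_mono[OF that, of 0] X(2) by simp
    ultimately show "Y \<in> snd silting_w" unfolding silting_w_def by simp
  qed
  show "hom_zero T (shift_set T (- 1) (snd silting_w)) (fst silting_w)"
    using snd_orth hom_zero_iff[of "shift_set T (- 1) (snd silting_w)" "fst silting_w"]
    by (auto simp add: silting_w_def t_le_0)
  fix X assume X: "X \<in> obj T"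
  then obtain n where "X \<in> t_le T t n" using bounded_above by blast
  \<comment> \<open>The decomposition lemma counts degrees from 0 upwards, so the bound is first
    enlarged to a natural number.\<close>
  then have "X \<in> t_le T t (int (nat n))" by (rule t_le_mono) simp
  then obtain A B where AB: "triangle A X B" "B \<in> t_le T t 0" "\<And>Y. Y \<in> t_le T t 0 \<Longrightarrow> orth A Y"
    using silting_weight_decomposition by blast
  have Ao: "A \<in> obj T" using triangle_obj[OF AB(1)] by blast
  have "orth (shift T 1 A) Y" if Y: "Y \<in> t_le T t (- 1)" for Y
  proof -
    have Yo: "Y \<in> obj T" using Y t_le_obj by blast
    have "shift T (- 1) Y \<in> t_le T t 0" using Y Yo by (simp add: shift_t_le_iff)
    then show ?thesis using AB(3) orth_shift_left[OF Ao Yo, of 1] by simp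
  qed
  then have "shift T 1 A \<in> snd silting_w" using Ao unfolding silting_w_def by simp
  then have "A \<in> shift_set T (- 1) (snd silting_w)"
    using Ao by (intro image_eqI[of _ _ "shift T 1 A"]) simp_all
  moreover have "B \<in> fst silting_w" using AB(2) unfolding silting_w_def t_le_0 by simp
  ultimately show "\<exists>A\<in>shift_set T (- 1) (snd silting_w). \<exists>B\<in>fst silting_w. \<exists>f g h. (A, X, B, f, g, h) \<in> tri T"
    using AB(1) unfolding triangle_def by blast
qed

lemma left_adjacent_silting_w: "left_adjacent T silting_w t"
proof -
  have "hom_zero T (snd silting_w) (t_le T t (- 1))"
    using hom_zero_iff[of "snd silting_w" "t_le T t (- 1)"] by (simp add: silting_w_def)
  moreover have "hom_zero T (fst silting_w) (t_ge T t 1)"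
    using hom_zero_iff[of "fst silting_w" "t_ge T t 1"] fst_orth by (simp add: silting_w_def)
  ultimately show ?thesis unfolding left_adjacent_def by blast
qed

lemma bounded_above_silting_w: "w_bounded_above T silting_w"
  unfolding w_bounded_above_def silting_w_def fst_conv t_le_def[symmetric] by (rule bounded_above)

lemma P_coheart: "P \<subseteq> coheart silting_w"
  using coheart_silting_w_iff P_t_le P_orth by blast

lemma coheart_retract: "retract T X Y \<Longrightarrow> Y \<in> coheart silting_w \<Longrightarrow> X \<in> coheart silting_w"
  using coheart_silting_w_iff t_le_retract orth_retract_left t_le_obj by meson

lemma coheart_biproduct:
  assumes b: "is_biproduct T Xs Q" and "set Xs \<subseteq> coheart silting_w"
  shows "Q \<in> coheart silting_w"
proof -
  have "orth Q B" if B: "B \<in> t_ge T t 1" for B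
  proof (rule biproduct_orth_left[OF b t_ge_obj[OF B]])
    fix X assume "X \<in> set Xs"
    then have "X \<in> t_le T t 0" using assms(2) coheart_silting_w_iff by blast
    then show "orth X B" using t_le_ge_orth[OF _ B] by simp
  qed
  then have "Q \<in> t_le T t 0" using t_le_iff_orth[of Q 0] biproduct_obj(1)[OF b] by simp
  moreover have "orth Q A" if A: "A \<in> t_le T t (- 1)" for A
    using biproduct_orth_left[OF b t_le_obj[OF A]] assms(2) coheart_silting_w_iff A by blast
  ultimately show ?thesis using coheart_silting_w_iff by blast
qed

text \<open>An object of the coheart has no maps into degrees \<le> -1, so the triangle of its
  approximation splits.\<close>

lemma coheart_approximation:
  assumes X: "X \<in> coheart silting_w"
  shows "\<exists>Xs Q. set Xs \<subseteq> P \<and> is_biproduct T Xs Q \<and> retract T X Q"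
proof -
  obtain Xs Q Y where Q: "set Xs \<subseteq> P" "is_biproduct T Xs Q" "triangle Q X Y" "Y \<in> t_le T t (- 1)"
    using silting_approximation X coheart_silting_w_iff by blast
  then have "orth X Y" using X coheart_silting_w_iff by blast
  then show ?thesis using Q triangle_retract(1)[OF Q(3)] by blast
qed

lemma coheart_silting_w: "coheart silting_w = add_closure T P"
proof
  show "coheart silting_w \<subseteq> add_closure T P"
  proof
    fix X assume "X \<in> coheart silting_w"
    then obtain Xs Q where "set Xs \<subseteq> P" "is_biproduct T Xs Q" "retract T X Q"
      using coheart_approximation by blast
    then show "X \<in> add_closure T P"
      unfolding add_closure_def using retract_direct_summand[OF idem] by blast
  qed
  show "add_closure T P \<subseteq> coheart silting_w"
  proof
    fix X assume "X \<in> add_closure T P"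
    then obtain Xs Y where *: "set Xs \<subseteq> P" "is_biproduct T Xs Y" "direct_summand T X Y"
      unfolding add_closure_def by blast
    then have "Y \<in> coheart silting_w" using coheart_biproduct P_coheart by blast
    then show "X \<in> coheart silting_w" using coheart_retract direct_summand_retract *(3) by blast
  qed
qed

lemma coheart_obj: "coheart silting_w \<subseteq> obj T"
  using coheart_silting_w_iff t_le_obj by blast

lemma Krull_Schmidt_coheart: "Krull_Schmidt (full T (coheart silting_w))"
  using silting unfolding coheart_silting_w silting_collection_def by blast

lemma thick_hull_coheart: "thick_subcat T hull coheart silting_w = thick_subcat T hull P"
proof
  have "X \<in> thick_subcat T hull P" if "X \<in> coheart silting_w" for X
    using coheart_approximation[OF that] retract_thick_hull[OF idem P_obj] by blast
  then show "thick_subcat T hull coheart silting_w \<subseteq> thick_subcat T hull P"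
    by (intro hull_minimal thick_subcat_hull[OF P_obj]) blast
  show "thick_subcat T hull P \<subseteq> thick_subcat T hull coheart silting_w"
    by (rule hull_mono[OF P_coheart])
qed

text \<open>To pass from a retract of a sum to a retract of a single \<open>p\<close>, a local
  endomorphism ring is required. Therefore \<open>X\<close> is first identified with a local summand
  from its Krull-Schmidt decomposition; that summand is a retract of some \<open>p\<close> in
  \<open>P\<close>, hence isomorphic to it.\<close>

lemma finite_indecomposables_coheart:
  "finite_up_to_iso T {X. indecomposable (full T (coheart silting_w)) X}"
proof -
  let ?C = "coheart silting_w"
  have "indecomposable (full T ?C) p" if p: "p \<in> P" for p
    using P_indecomposable[OF p] p P_coheart is_biproduct_full_iff[OF coheart_obj]
      zero_object_full_iff[OF coheart_obj] is_biproduct_pair_retract[of _ _ p] coheart_retract[of _ p]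
    unfolding indecomposable_def full_simps by blast
  moreover have "\<exists>p\<in>P. isomorphic T X p" if i: "indecomposable (full T ?C) X" for X
  proof -
    have X: "X \<in> ?C" "\<not> zero_object T X"
      using i zero_object_full_iff[OF coheart_obj] unfolding indecomposable_def full_simps by blast+
    obtain Xs where Xs: "is_biproduct (full T ?C) Xs X" "\<forall>Y\<in>set Xs. local_ring (End_ring T Y)"
      using Krull_Schmidt_coheart X unfolding Krull_Schmidt_def by auto
    have b: "is_biproduct T Xs X" "set Xs \<subseteq> ?C" using Xs(1) is_biproduct_full_iff[OF coheart_obj] by blast+
    \<comment> \<open>An empty biproduct is a zero object, which indecomposability rules
      out.\<close>
    have "Xs \<noteq> []"
    proof
      assume "Xs = []"
      then have "orth X X" using biproduct_orth_left[OF b(1)] X coheart_obj by auto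
      then show False using X coheart_obj zero_object_iff_orth by blast
    qed
    then have Y: "hd Xs \<in> set Xs" "Xs ! 0 = hd Xs" "0 < length Xs" by (simp_all add: hd_conv_nth)
    let ?Y = "hd Xs"
    have YX: "retract T ?Y X" using biproduct_retract[OF b(1) Y(3)] Y(2) by simp
    have Yl: "local_ring (End_ring T ?Y)" using Xs Y by blast
    have Yo: "?Y \<in> obj T" using Y b coheart_obj by blast
    have Y0: "\<not> zero_object T ?Y"
      using local_indecomposable[OF Yo Yl] unfolding indecomposable_def by blast
    obtain Z where Z: "is_biproduct T [?Y, Z] X" using retract_complement[OF idem YX] by blast
    have "Z \<in> ?C" using is_biproduct_pair_retract(2)[OF Z] coheart_retract X by blast
    then have "is_biproduct (full T ?C) [?Y, Z] X"
      using Z X Y b is_biproduct_full_iff[OF coheart_obj] by auto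
    then have "zero_object T Z"
      using i Y0 zero_object_full_iff[OF coheart_obj] unfolding indecomposable_def by blast
    then have XY: "isomorphic T X ?Y" using biproduct_zero_isomorphic[OF Z] isomorphic_sym by blast
    obtain Ps Q where Ps: "set Ps \<subseteq> P" "is_biproduct T Ps Q" "retract T X Q"
      using coheart_approximation[OF X(1)] by blast
    obtain p where p: "p \<in> set Ps" "retract T ?Y p"
      using local_retract_biproduct[OF Yl retract_trans[OF YX Ps(3)] Ps(2)] by blast
    then have "isomorphic T ?Y p"
      using indecomposable_retract[OF idem P_indecomposable _ Y0] Ps(1) by blast
    then show ?thesis using XY isomorphic_trans p Ps(1) by blast
  qed
  ultimately show ?thesis unfolding finite_up_to_iso_def using finite_P by (intro exI[of _ P]) blast
qed

end

section \<open>The heart of a silting t-structure\<close>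

context triangulated_category
begin

text \<open>The two vanishing conditions cut the long exact sequence of \<open>Hom(p, -)\<close>
  down to a short one, so rank-nullity applies to composition with \<open>g\<close>, whose kernel is
  an injective image of \<open>Hom(p, X)\<close>.\<close>

lemma dim_short_exact:
  assumes tr: "(X, Y, Z, f, g, h) \<in> tri T" and p: "p \<in> obj T"
    and o: "orth p (shift T (- 1) Z)" "orth p (shift T 1 X)"
    and fd: "\<And>W. W \<in> obj T \<Longrightarrow> vectorspace.fin_dim K (Hom T p W)"
  shows "vectorspace.dim K (Hom T p Y) = vectorspace.dim K (Hom T p X) + vectorspace.dim K (Hom T p Z)"
proof -
  note tt = tri_typed[OF tr]
  have X: "X \<in> obj T" and Y: "Y \<in> obj T" and Z: "Z \<in> obj T" and f: "f \<in> mor T X Y" and g: "g \<in> mor T Y Z"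
    using tt by auto
  interpret F: linear_map K "Hom T p X" "Hom T p Y" "\<lambda>u. f \<cdot> u" by (rule cmp_linear_right[OF p X Y f])
  interpret G: linear_map K "Hom T p Y" "Hom T p Z" "\<lambda>u. g \<cdot> u" by (rule cmp_linear_right[OF p Y Z g])
  have inj: "inj_on (\<lambda>u. f \<cdot> u) (mor T p X)"
  proof (rule inj_onI)
    fix u v assume u: "u \<in> mor T p X" "v \<in> mor T p X" and eq: "f \<cdot> u = f \<cdot> v"
    have "f \<cdot> (u \<ominus>\<^bsub>Hom T p X\<^esub> v) = zmor T p Y"
      using cmp_minus_right[OF p X Y f u] eq cmp_closed[OF p X Y f u(2)]
        minus_eq_zmor_iff[OF p Y, of "f \<cdot> v" "f \<cdot> v"] by simp
    then have "u \<ominus>\<^bsub>Hom T p X\<^esub> v = zmor T p X"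
      using tri_mono[OF tr p o(1) minus_closed[OF p X u]] by blast
    then show "u = v" using minus_eq_zmor_iff[OF p X u] by blast
  qed
  have surj: "(\<lambda>u. g \<cdot> u) ` mor T p Y = mor T p Z"
  proof
    show "mor T p Z \<subseteq> (\<lambda>u. g \<cdot> u) ` mor T p Y"
    proof
      fix u assume u: "u \<in> mor T p Z"
      have sX: "sh T X \<in> obj T" using X sh_obj by blast
      have "h \<cdot> u = zmor T p (sh T X)"
        using orthD[OF o(2)[unfolded shift_1]] cmp_closed[OF p Z sX _ u] tt by blast
      then obtain v where "v \<in> mor T p Y" "g \<cdot> v = u"
        using tri_factor_left[OF tri_rotate_fwd[OF tr] p u] by blast
      then show "u \<in> (\<lambda>u. g \<cdot> u) ` mor T p Y" by blast
    qed
  qed auto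
  have ker: "G.kerT = (\<lambda>u. f \<cdot> u) ` mor T p X"
  proof
    show "G.kerT \<subseteq> (\<lambda>u. f \<cdot> u) ` mor T p X"
      unfolding G.ker_def using tri_factor_left[OF tr p] by blast
    show "(\<lambda>u. f \<cdot> u) ` mor T p X \<subseteq> G.kerT"
    proof
      fix w assume "w \<in> (\<lambda>u. f \<cdot> u) ` mor T p X"
      then obtain u where u: "u \<in> mor T p X" "w = f \<cdot> u" by blast
      have "g \<cdot> w = (g \<cdot> f) \<cdot> u" unfolding u(2) by (rule cmp_assoc[OF p X Y Z u(1) f g])
      also have "\<dots> = zmor T p Z" unfolding tri_comp_zero[OF tr] by (rule cmp_zmor_left[OF p X Z u(1)])
      finally show "w \<in> G.kerT" unfolding G.ker_def using cmp_closed[OF p X Y f u(1)] u by simp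
    qed
  qed
  have "vectorspace.dim K (Hom T p Y)
      = vectorspace.dim K ((Hom T p Z)\<lparr>carrier := G.imT\<rparr>) + vectorspace.dim K ((Hom T p Y)\<lparr>carrier := G.kerT\<rparr>)"
    using G.rank_nullity[OF fd[OF Y]] by simp
  also have "(Hom T p Z)\<lparr>carrier := G.imT\<rparr> = Hom T p Z"
    unfolding G.im_def surj by simp
  also have "vectorspace.dim K ((Hom T p Y)\<lparr>carrier := G.kerT\<rparr>) = vectorspace.dim K (Hom T p X)"
    unfolding ker by (rule F.dim_image_inj[OF fd[OF X] inj])
  finally show ?thesis by simp
qed

lemma dim_pos:
  assumes "X \<in> obj T" "Y \<in> obj T" "vectorspace.fin_dim K (Hom T X Y)" "\<not> orth X Y"
  shows "0 < vectorspace.dim K (Hom T X Y)"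
proof -
  interpret V: vectorspace K "Hom T X Y" using Hom_vectorspace assms by blast
  obtain B where B: "finite B" "V.basis B" using V.finite_basis_exists[OF assms(3)] by blast
  have "V.dim \<noteq> 0"
  proof
    assume "V.dim = 0"
    then have "B = {}" using V.dim_basis[OF B] B(1) by simp
    then have "mor T X Y = {zmor T X Y}" using B(2) unfolding V.basis_def by (simp add: V.span_empty)
    then show False using assms(4) unfolding hom_zero_def by blast
  qed
  then show ?thesis by simp
qed

end

section \<open>Finiteness properties of the heart\<close>

context finite_silting
begin

text \<open>Precomposition with the approximation \<open>Q -> X\<close> is injective on maps to
  \<open>Y\<close>, since the cone lies in degrees \<le> -1 and has no maps to
  \<open>Y\<close>.\<close>

lemma Hom_finite_heart: "Hom_finite K (full T (heart t))"
  unfolding Hom_finite_def full_simps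
proof (intro ballI)
  fix X Y assume X: "X \<in> heart t" and Y: "Y \<in> heart t"
  have Yo: "Y \<in> obj T" using Y heart_obj by blast
  obtain Xs Q Z where Q: "set Xs \<subseteq> P" "is_biproduct T Xs Q" "triangle Q X Z" "Z \<in> t_le T t (- 1)"
    using silting_approximation X heart_iff by blast
  have "Y \<in> t_ge T t 0" using Y heart_iff by blast
  then have "orth Z Y" using t_le_ge_orth[OF Q(4)] by simp
  moreover have "vectorspace.fin_dim K (Hom T Q Y)"
    by (rule biproduct_fin_dim[OF Q(2) Yo]) (use Q(1) Hom_P_fin_dim[OF _ Yo] in blast)
  ultimately show "vectorspace.fin_dim K (Hom T X Y)"
    using fin_dim_contravariant_inj[OF Q(3) Yo] by blast
qed

text \<open>On the heart the spaces \<open>Hom(p, X[m])\<close> with \<open>m \<noteq> 0\<close>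
  vanish anyway, so unshifted maps from \<open>P\<close> suffice to detect zero.\<close>

lemma heart_P_orth_zero:
  assumes X: "X \<in> heart t" and o: "\<And>p. p \<in> P \<Longrightarrow> orth p X" shows "zero_object T X"
proof -
  have X0: "X \<in> t_le T t 0" "X \<in> t_ge T t 0" using X heart_iff by auto
  have "orth p (shift T m X)" if "p \<in> P" for m p
    using P_orth_shift[OF that X0(1), of m] t_ge_silting[of X 0] X0(2) o[OF that] that
    by (cases "m = 0"; cases "m < 0") auto
  then show ?thesis using orth_P_zero t_le_obj[OF X0(1)] by blast
qed

text \<open>This is the dimension of \<open>Hom(Q, X)\<close> for \<open>Q\<close> the direct sum of
  \<open>P\<close>, that is, of the module attached to \<open>X\<close> over the endomorphism
  algebra of \<open>Q\<close>.\<close>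

definition heart_dim :: "'o \<Rightarrow> nat"
  where "heart_dim X = (\<Sum>p\<in>P. vectorspace.dim K (Hom T p X))"

lemma heart_dim_pos:
  assumes X: "X \<in> heart t" and "\<not> zero_object T X" shows "0 < heart_dim X"
proof -
  have Xo: "X \<in> obj T" using X heart_obj by blast
  obtain p where p: "p \<in> P" "\<not> orth p X" using heart_P_orth_zero[OF X] assms(2) by blast
  then have "0 < vectorspace.dim K (Hom T p X)" using dim_pos[OF _ Xo Hom_P_fin_dim[OF _ Xo]] P_obj by blast
  then show ?thesis unfolding heart_dim_def using p(1) finite_P
    by (metis gr0I sum_eq_0_iff)
qed

lemma heart_dim_add:
  assumes tr: "(X, Y, Z, f, g, h) \<in> tri T" and H: "X \<in> heart t" "Y \<in> heart t" "Z \<in> heart t"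
  shows "heart_dim Y = heart_dim X + heart_dim Z"
  unfolding heart_dim_def sum.distrib[symmetric]
proof (rule sum.cong[OF refl])
  fix p assume p: "p \<in> P"
  have po: "p \<in> obj T" using p P_obj by blast
  have "X \<in> t_le T t 0" "Z \<in> t_ge T t 0" using H heart_iff by auto
  then have "orth p (shift T 1 X)" "orth p (shift T (- 1) Z)"
    using P_orth_shift[OF p, of X 0 1] t_ge_silting[of Z 0] p by auto
  then show "vectorspace.dim K (Hom T p Y) = vectorspace.dim K (Hom T p X) + vectorspace.dim K (Hom T p Z)"
    using dim_short_exact[OF tr po] Hom_P_fin_dim[OF p] by blast
qed

text \<open>The obstruction to lifting lies in \<open>Hom(p, X[1])\<close> and vanishes for
  \<open>X\<close> in the heart: objects of \<open>P\<close> behave like projectives.\<close>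

lemma heart_P_lift:
  assumes tr: "(X, Y, Z, f, g, h) \<in> tri T" and X: "X \<in> heart t" and p: "p \<in> P" and u: "u \<in> mor T p Z"
  shows "\<exists>v\<in>mor T p Y. g \<cdot> v = u"
proof -
  note tt = tri_typed[OF tr]
  have po: "p \<in> obj T" using p P_obj by blast
  have sX: "sh T X \<in> obj T" using tt sh_obj by blast
  have "X \<in> t_le T t 0" using X heart_iff by blast
  then have "orth p (sh T X)" using P_orth_shift[OF p, of X 0 1] by (simp add: shift_1)
  then have "h \<cdot> u = zmor T p (sh T X)" using orthD cmp_closed[OF po _ sX _ u] tt by blast
  then show ?thesis using tri_factor_left[OF tri_rotate_fwd[OF tr] po u] by blast
qed

text \<open>Instead of the octahedral axiom, surjectivity on maps from \<open>P\<close> shows that the cocone of a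
  composite of two quotient maps stays in the heart.\<close>

lemma heart_quotient_comp:
  assumes tr: "(X, Y, Z, f, g, h) \<in> tri T" and H: "X \<in> heart t" "Y \<in> heart t"
    and tr': "(W, Z, V, i, j, k) \<in> tri T" and H': "W \<in> heart t" "V \<in> heart t"
  shows "\<exists>X' f' h'. X' \<in> heart t \<and> (X', Y, V, f', j \<cdot> g, h') \<in> tri T"
proof -
  note tt = tri_typed[OF tr] and tt' = tri_typed[OF tr']
  have o: "Y \<in> obj T" "Z \<in> obj T" "V \<in> obj T" using tt tt' by auto
  have jg: "j \<cdot> g \<in> mor T Y V" using cmp_closed[OF o] tt tt' by blast
  obtain U c d where trU: "(Y, V, U, j \<cdot> g, c, d) \<in> tri T" using tri_cone[OF o(1,3) jg] by blast
  define X' where "X' = shift T (- 1) U"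
  obtain f' where f': "(X', Y, V, f', j \<cdot> g, c) \<in> tri T"
    using tri_rotate_back[OF trU] X'_def by blast
  note tU = tri_typed[OF trU]
  have Y0: "Y \<in> t_le T t 0" "Y \<in> t_ge T t 0" and V0: "V \<in> t_le T t 0" "V \<in> t_ge T t 0"
    using H H' heart_iff by auto
  have "orth p U" if p: "p \<in> P" for p
  proof -
    have po: "p \<in> obj T" using p P_obj by blast
    have sY: "sh T Y \<in> obj T" using o sh_obj by blast
    show ?thesis
    proof (rule orthI[OF po])
      fix u assume u: "u \<in> mor T p U"
      obtain v where v: "v \<in> mor T p V" "c \<cdot> v = u" using heart_P_lift[OF trU H(2) p u] by blast
      obtain z where z: "z \<in> mor T p Z" "j \<cdot> z = v" using heart_P_lift[OF tr' H'(1) p v(1)] by blast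
      obtain y where y: "y \<in> mor T p Y" "g \<cdot> y = z" using heart_P_lift[OF tr H(1) p z(1)] by blast
      have "v = (j \<cdot> g) \<cdot> y" using cmp_assoc[OF po o y(1), of g j] y z tt tt' by simp
      then have "u = (c \<cdot> (j \<cdot> g)) \<cdot> y"
        using v(2) cmp_assoc[OF po o(1,3) _ y(1) jg, of U c] tU by simp
      then show "u = zmor T p U"
        unfolding tri_comp_zero[OF trU] using cmp_zmor_left[OF po o(1) _ y(1), of U] tU by simp
    qed (use tU in blast)
  qed
  moreover have "U \<in> t_le T t 0" using t_le_cone[OF triangleI[OF trU] V0(1)] t_le_mono[OF Y0(1), of 1] by simp
  ultimately have "orth p (shift T m U)" if "m > - 1" "p \<in> P" for m p
    using P_orth_shift[OF that(2), of U 0 m] that by (cases "m = 0") auto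
  \<comment> \<open>The cone of a map between heart objects lies in degrees \<le> 0; the vanishing
    of \<open>Hom(p, U)\<close> removes degree 0, which is what moves \<open>X'\<close> into the
    aisle.\<close>
  then have "U \<in> t_le T t (- 1)" using t_le_silting tU by blast
  then have "X' \<in> t_le T t 0" using tU unfolding X'_def by (simp add: shift_t_le_iff)
  moreover have "X' \<in> t_ge T t 0"
    using t_ge_cocone[OF triangleI[OF f'] Y0(2)] t_ge_antimono[OF V0(2), of "- 1"] by simp
  ultimately show ?thesis using f' heart_iff by blast
qed

text \<open>A non-zero quotient \<open>S\<close> of \<open>Y\<close> with least
  \<open>heart_dim\<close> is simple: a proper non-zero subobject \<open>W\<close> of
  \<open>S\<close> would have a non-zero cokernel \<open>V\<close>, again a quotient of
  \<open>Y\<close> but of smaller dimension. Quotients are minimized because composition series are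
  peeled off from the top.\<close>

lemma simple_quotient:
  assumes Y: "Y \<in> heart t" "\<not> zero_object T Y"
  shows "\<exists>X S f g h. (X, Y, S, f, g, h) \<in> tri T \<and> X \<in> heart t \<and> simple_object (full T (heart t)) S"
proof -
  let ?Q = "\<lambda>Z. Z \<in> heart t \<and> \<not> zero_object T Z \<and> (\<exists>X f g h. (X, Y, Z, f, g, h) \<in> tri T \<and> X \<in> heart t)"
  have Yo: "Y \<in> obj T" using Y heart_obj by blast
  obtain N where N: "zero_object T N" using zero_exists by blast
  have "N \<in> heart t" using zero_object_t[OF N] heart_iff by blast
  \<comment> \<open>\<open>Y\<close> is a quotient of itself with zero kernel, so the set to be
    minimized over is non-empty.\<close>
  then have "?Q Y" using tri_zero_id[OF Yo N] Y by blast
  then obtain S where S: "?Q S" and least: "\<And>Z. ?Q Z \<Longrightarrow> heart_dim S \<le> heart_dim Z"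
    using ex_has_least_nat[of ?Q Y heart_dim] by blast
  obtain X f g h where tr: "(X, Y, S, f, g, h) \<in> tri T" "X \<in> heart t" using S by blast
  have So: "S \<in> obj T" using S heart_obj by blast
  have "zero_object T W \<or> is_isomorphism T W S i" if m: "is_mono (full T (heart t)) W S i" for W i
  proof (rule ccontr)
    assume neg: "\<not> (zero_object T W \<or> is_isomorphism T W S i)"
    have W: "W \<in> heart t" "i \<in> mor T W S" using m unfolding is_mono_def by auto
    have Wo: "W \<in> obj T" using W heart_obj by blast
    obtain V j k where trV: "(W, S, V, i, j, k) \<in> tri T" using tri_cone[OF Wo So W(2)] by blast
    have V: "V \<in> heart t" by (rule heart_mono_cone[OF trV m])
    have "\<not> zero_object T V" using tri_zero_iso[OF trV] neg by blast
    moreover have "\<exists>X' f' h'. X' \<in> heart t \<and> (X', Y, V, f', j \<cdot> g, h') \<in> tri T"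
      by (rule heart_quotient_comp[OF tr(1,2) Y(1) trV W(1) V])
    ultimately have "heart_dim S \<le> heart_dim V" using least[of V] V by blast
    moreover have "heart_dim S = heart_dim W + heart_dim V"
      by (rule heart_dim_add[OF trV W(1) _ V]) (use S in blast)
    moreover have "0 < heart_dim W" using heart_dim_pos[OF W(1)] neg by blast
    ultimately show False by simp
  qed
  then have "simple_object (full T (heart t)) S"
    unfolding simple_object_def full_simps
    using S zero_object_full_iff[OF heart_obj] is_isomorphism_full_iff[OF heart_obj]
    by (metis full_simps(1) is_mono_def)
  then show ?thesis using tr by blast
qed

text \<open>The kernel of a simple quotient has strictly smaller \<open>heart_dim\<close>, which
  drives a strong induction.\<close>

lemma finite_length_heart: "finite_length (full T (heart t))"
  unfolding finite_length_def full_simps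
proof
  fix Y assume "Y \<in> heart t"
  then show "has_finite_length (full T (heart t)) Y"
  proof (induction "heart_dim Y" arbitrary: Y rule: less_induct)
    case less
    show ?case
    proof (cases "zero_object T Y")
      case True
      then show ?thesis
        using zero_object_full_iff[OF heart_obj] less.prems by (intro has_finite_length.zero) blast
    next
      case False
      then obtain X S f g h where tr: "(X, Y, S, f, g, h) \<in> tri T" "X \<in> heart t"
        and S: "simple_object (full T (heart t)) S" using simple_quotient less.prems by blast
      have SH: "S \<in> heart t" "\<not> zero_object T S" using simple_objectD[OF S] by auto
      have "heart_dim X < heart_dim Y"
        using heart_dim_add[OF tr less.prems SH(1)] heart_dim_pos[OF SH] by simp
      then have "has_finite_length (full T (heart t)) X" using less.hyps tr(2) by blast
      then show ?thesis
        using has_finite_length.step[OF _ heart_mono_cokernel[OF tr less.prems SH(1)] S] by blast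
    qed
  qed
qed

lemma finite_simples_heart: "finite_up_to_iso T {S. simple_object (full T (heart t)) S}"
proof -
  have "\<exists>F. finite F \<and> F \<subseteq> {S. simple_object (full T (heart t)) S} \<and>
      (\<forall>S. simple_object (full T (heart t)) S \<longrightarrow> \<not> orth p S \<longrightarrow> (\<exists>S'\<in>F. isomorphic T S S'))"
    if p: "p \<in> P" for p
  proof -
    have po: "p \<in> obj T" using p P_obj by blast
    obtain Q h where Q: "Q \<in> t_le T t (- 1)" and h: "h \<in> t_ge T t 0" and tr: "triangle Q p h"
      using truncation[OF po, of "- 1"] by auto
    have hh: "h \<in> heart t"
      using t_le_cone[OF tr P_t_le[OF p]] t_le_mono[OF Q, of 1] h heart_iff by simp
    obtain F where F: "finite F" "F \<subseteq> {S. simple_object (full T (heart t)) S}"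
      "\<And>S. simple_object (full T (heart t)) S \<Longrightarrow> \<not> orth h S \<Longrightarrow> \<exists>S'\<in>F. isomorphic T S S'"
      using finite_simple_quotients[of h] finite_length_heart hh unfolding finite_length_def by auto
    \<comment> \<open>Maps from \<open>p\<close> to an object of the heart factor through the
      truncation \<open>h\<close>, because \<open>Q\<close> lies in degrees \<le> -1.\<close>
    have "\<not> orth h S" if S: "simple_object (full T (heart t)) S" "\<not> orth p S" for S
    proof
      assume "orth h S"
      have SH: "S \<in> heart t" using simple_objectD(1)[OF S(1)] .
      then have "S \<in> t_ge T t 0" using heart_iff by blast
      then have "orth Q S" using t_le_ge_orth[OF Q] by simp
      then have "orth p S" using triangle_orth_left[OF tr _ \<open>orth h S\<close>] SH heart_obj by blast
      then show False using S by blast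
    qed
    then show ?thesis using F by blast
  qed
  then obtain F where F: "\<And>p. p \<in> P \<Longrightarrow> finite (F p)"
    "\<And>p. p \<in> P \<Longrightarrow> F p \<subseteq> {S. simple_object (full T (heart t)) S}"
    "\<And>p S. p \<in> P \<Longrightarrow> simple_object (full T (heart t)) S \<Longrightarrow> \<not> orth p S \<Longrightarrow> \<exists>S'\<in>F p. isomorphic T S S'"
    by metis
  have "\<exists>S'\<in>(\<Union>p\<in>P. F p). isomorphic T S S'" if S: "simple_object (full T (heart t)) S" for S
  proof -
    obtain p where "p \<in> P" "\<not> orth p S"
      using heart_P_orth_zero simple_objectD(1,2)[OF S] by blast
    then show ?thesis using F(3) S by blast
  qed
  moreover have "finite (\<Union>p\<in>P. F p)" using F(1) finite_P by blast
  moreover have "(\<Union>p\<in>P. F p) \<subseteq> {S. simple_object (full T (heart t)) S}" using F(2) by blast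
  ultimately show ?thesis unfolding finite_up_to_iso_def by blast
qed

lemma WT_pair_silting:
  "WT_pair K T (thick_subcat T hull P) (\<Union>n. t_ge T t n)"
proof -
  have tb: "t_bounded_above T t" unfolding t_bounded_above_def by (rule bounded_above)
  show ?thesis
    unfolding WT_pair_def
    by (intro exI[of _ silting_w] exI[of _ t] conjI weight_structure_silting_w t_str nondegenerate
        left_adjacent_silting_w bounded_above_silting_w tb thick_hull_coheart[symmetric]
        heart_hull[OF tb, symmetric] Krull_Schmidt_coheart finite_indecomposables_coheart
        Hom_finite_heart finite_length_heart finite_simples_heart)
qed

end

section \<open>The equivalence of WT pairs and finite silting collections\<close>

theorem proposition3p21:
  fixes K :: "('k, 'r) ring_scheme"
    and T :: "('o, 'm, 'k) tri_cat"
    and C D :: "'o set"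
  assumes "triangulated_category K T"
    and "idempotent_complete T"
    and "thick_subcat T C"
    and "thick_subcat T D"
  shows "WT_pair K T C D \<longleftrightarrow>
    (\<exists>P. finite P \<and> silting_collection T P \<and>
      (\<forall>X\<in>obj T. \<forall>p\<in>P. vectorspace.fin_dim K (Hom T p X)) \<and>
      thick_subcat T hull P = C \<and>
      obj T = (\<Union>n. t_le T (silting_t T P) n) \<and>
      D = (\<Union>n. t_ge T (silting_t T P) n))"
proof
  assume "WT_pair K T C D"
  then obtain w t where w: "weight_structure T w" and t: "t_structure T t"
    and nd: "t_nondegenerate T t" and adj: "left_adjacent T w t" and tb: "t_bounded_above T t"
    and C: "C = thick_subcat T hull coheart w" and D: "D = triangulated_subcat T hull heart t"
    and KS: "Krull_Schmidt (full T (coheart w))"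
    and fin: "finite_up_to_iso T {X. indecomposable (full T (coheart w)) X}"
    and hf: "Hom_finite K (full T (heart t))"
    unfolding WT_pair_def by blast
  interpret t_category K T t
    using assms(1) t by (intro t_category.intro t_category_axioms.intro)
  obtain P where P: "P \<subseteq> coheart w" "finite P" "silting_collection T P"
    "thick_subcat T hull P = thick_subcat T hull coheart w" "silting_t T P = t"
    using adjacent_coheart_collection[OF assms(2) w adj tb nd KS fin] by blast
  have "vectorspace.fin_dim K (Hom T p X)" if "p \<in> P" "X \<in> obj T" for p X
    using adjacent_coheart_fin_dim[OF w adj hf _ that(2)] that(1) P(1) by blast
  moreover have "obj T = (\<Union>n. t_le T t n)" using tb unfolding t_bounded_above_def .
  moreover have "D = (\<Union>n. t_ge T t n)" unfolding D by (rule heart_hull[OF tb])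
  ultimately show "\<exists>P. finite P \<and> silting_collection T P \<and>
      (\<forall>X\<in>obj T. \<forall>p\<in>P. vectorspace.fin_dim K (Hom T p X)) \<and>
      thick_subcat T hull P = C \<and>
      obj T = (\<Union>n. t_le T (silting_t T P) n) \<and>
      D = (\<Union>n. t_ge T (silting_t T P) n)"
    using P C by (intro exI[of _ P]) simp
next
  assume "\<exists>P. finite P \<and> silting_collection T P \<and>
      (\<forall>X\<in>obj T. \<forall>p\<in>P. vectorspace.fin_dim K (Hom T p X)) \<and>
      thick_subcat T hull P = C \<and>
      obj T = (\<Union>n. t_le T (silting_t T P) n) \<and>
      D = (\<Union>n. t_ge T (silting_t T P) n)"
  then obtain P where P: "finite P" "silting_collection T P"
    "\<forall>X\<in>obj T. \<forall>p\<in>P. vectorspace.fin_dim K (Hom T p X)"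
    "thick_subcat T hull P = C" "obj T = (\<Union>n. t_le T (silting_t T P) n)"
    "D = (\<Union>n. t_ge T (silting_t T P) n)"
    by blast
  interpret finite_silting K T P
    using assms(1,2) P(1-3,5) by (intro finite_silting.intro finite_silting_axioms.intro) blast+
  show "WT_pair K T C D" using WT_pair_silting unfolding P(4,6) .
qed

end
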